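(* Let $m,p\in\mathbb{N}$, $r\in\mathbb{N}_0$ and $\mathbf{k}=(k_1,\dots,k_r)\in\mathbb{N}^r$ (with $\mathbf{k}=\emptyset$, $|\mathbf{k}|=0$ when $r=0$). Then $$\sum_{n=1}^\infty\frac{\binom{2n}{n}}{4^n}\frac{t_n(2_{p-1})t^\star_n(\mathbf{k})}{(2n+1)^m}\in i\,\mathrm{CMZV}^4_{2p+m+|\mathbf{k}|-2},\qquad\sum_{n=1}^\infty\frac{4^n\zeta_{n-1}(2_{p-1})t^\star_n(\mathbf{k})}{\binom{2n}{n}n^{m+1}}\in\mathrm{CMZV}^4_{2p+m+|\mathbf{k}|-1}.$$
   Context: $i=\sqrt{-1}$. For $n\in\mathbb{N}_0$: $\zeta_n(\mathbf{a})=\sum_{n\ge n_1>\cdots>n_s>0}\prod_j n_j^{-a_j}$, $t_n(\mathbf{a})=\sum_{n\ge n_1>\cdots>n_s>0}\prod_j(2n_j-1)^{-a_j}$, $t^\star_n(\mathbf{a})=\sum_{n\ge n_1\ge\cdots\ge n_s>0}\prod_j(2n_j-1)^{-a_j}$, each equal to $1$ for the empty composition and $0$ when the sum is empty; $2_d$ is the string of $d$ twos. $\mathrm{CMZV}^4_w$ is the $\mathbb{Q}$-span of colored multiple zeta values $\sum_{n_1>\cdots>n_s>0}\prod_j z_j^{n_j}n_j^{-a_j}$ of weight $a_1+\cdots+a_s=w$, with each $z_j$ a fourth root of unity and $(a_1,z_1)\ne(1,1)$; $i\,\mathrm{CMZV}^4_w=\{i x: x\in\mathrm{CMZV}^4_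w\}$.
   Formalization: For p=1 and k=∅ the first sum is taken from n=0 rather than n=1: as written it fails, e.g. m=1 gives π/2−1, which is not in i CMZV^4_1; in all other cases the n=0 term vanishes and the claim is as stated. *)

theory Defs
  imports "HOL-Analysis.Analysis"
begin

text \<open>A composition is a list of positive natural numbers; list position \<open>j\<close> holds the
  entry with index \<open>j + 1\<close>.\<close>

definition composition :: "nat list \<Rightarrow> bool" where
  "composition ks \<longleftrightarrow> (\<forall>k\<in>set ks. 1 \<le> k)"

definition decreasing_tuples :: "nat \<Rightarrow> nat \<Rightarrow> nat list set" where
  "decreasing_tuples s n = {ns. length ns = s \<and> set ns \<subseteq> {1..n} \<and> sorted_wrt (>) ns}"

definition weakly_decreasing_tuples :: "nat \<Rightarrow> nat \<Rightarrow> nat list set" where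
  "weakly_decreasing_tuples s n = {ns. length ns = s \<and> set ns \<subseteq> {1..n} \<and> sorted_wrt (\<ge>) ns}"

definition zeta_sum :: "nat \<Rightarrow> nat list \<Rightarrow> real" where
  "zeta_sum n as =
     (\<Sum>ns\<in>decreasing_tuples (length as) n. \<Prod>j<length as. 1 / real (ns ! j) ^ (as ! j))"

definition t_sum :: "nat \<Rightarrow> nat list \<Rightarrow> real" where
  "t_sum n as =
     (\<Sum>ns\<in>decreasing_tuples (length as) n.
        \<Prod>j<length as. 1 / (2 * real (ns ! j) - 1) ^ (as ! j))"

definition t_star_sum :: "nat \<Rightarrow> nat list \<Rightarrow> real" where
  "t_star_sum n as =
     (\<Sum>ns\<in>weakly_decreasing_tuples (length as) n.
        \<Prod>j<length as. 1 / (2 * real (ns ! j) - 1) ^ (as ! j))"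

definition cmzv_partial :: "nat \<Rightarrow> nat list \<Rightarrow> complex list \<Rightarrow> complex" where
  "cmzv_partial N as zs =
     (\<Sum>ns\<in>decreasing_tuples (length as) N.
        \<Prod>j<length as. (zs ! j) ^ (ns ! j) / of_nat (ns ! j) ^ (as ! j))"

text \<open>For \<open>a\<^sub>1 = 1\<close> and \<open>z\<^sub>1 \<noteq> 1\<close> the series over all \<open>n\<^sub>1 > \<dots> > n\<^sub>s > 0\<close> converges only
  conditionally, so its value is the limit of the partial sums over \<open>n\<^sub>1 \<le> N\<close>.\<close>

definition cmzv :: "nat list \<Rightarrow> complex list \<Rightarrow> complex" where
  "cmzv as zs = lim (\<lambda>N. cmzv_partial N as zs)"

definition admissible4 :: "nat list \<Rightarrow> complex list \<Rightarrow> bool" where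
  "admissible4 as zs \<longleftrightarrow>
     composition as \<and> length zs = length as \<and> (\<forall>z\<in>set zs. z ^ 4 = 1) \<and>
     (as \<noteq> [] \<longrightarrow> (hd as, hd zs) \<noteq> (1, 1))"

interpretation rat_complex: vector_space "\<lambda>(q::rat) (x::complex). of_rat q * x"
  by unfold_locales (simp_all add: algebra_simps of_rat_add of_rat_mult)

definition CMZV4 :: "nat \<Rightarrow> complex set" where
  "CMZV4 w = rat_complex.span {cmzv as zs | as zs. admissible4 as zs \<and> sum_list as = w}"

definition iCMZV4 :: "nat \<Rightarrow> complex set" where
  "iCMZV4 w = (\<lambda>x. \<i> * x) ` CMZV4 w"

definition series1_term :: "nat \<Rightarrow> nat \<Rightarrow> nat list \<Rightarrow> nat \<Rightarrow> real" where
  "series1_term m p ks n =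
     real ((2 * n) choose n) / 4 ^ n *
     (t_sum n (replicate (p - 1) 2) * t_star_sum n ks) / (2 * real n + 1) ^ m"

definition series2_term :: "nat \<Rightarrow> nat \<Rightarrow> nat list \<Rightarrow> nat \<Rightarrow> real" where
  "series2_term m p ks n =
     4 ^ n * zeta_sum (n - 1) (replicate (p - 1) 2) * t_star_sum n ks /
     (real ((2 * n) choose n) * real n ^ (m + 1))"

text \<open>Membership of \<open>\<Sum>\<^bsub>n \<ge> n0\<^esub> f n\<close> in \<open>A\<close>, including convergence of the series.\<close>

definition series_from_in :: "nat \<Rightarrow> (nat \<Rightarrow> real) \<Rightarrow> complex set \<Rightarrow> bool" where
  "series_from_in n0 f A \<longleftrightarrow>
     summable (\<lambda>n. f (n + n0)) \<and> complex_of_real (\<Sum>n. f (n + n0)) \<in> A"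

end

theory Submission
  imports Defs "HOL-Real_Asymp.Real_Asymp"
begin

text \<open>
  Substituting \<open>x = 2u/(1 + u\<^sup>2)\<close> makes \<open>dx/x\<close>, \<open>dx/(1 - x\<^sup>2)\<close>, \<open>x dx/(1 - x\<^sup>2)\<close> and
  \<open>\<i> dx/sqrt(1 - x\<^sup>2)\<close> integer combinations of \<open>du/u\<close> and \<open>du/(a - u)\<close> with \<open>a\<^sup>4 = 1\<close>.
  Without the star sum, the generating functions in \<open>x\<close> of the two series are iterated integrals
  of such forms, starting from powers of the arcsine.  A star sum is peeled off from its outermost
  index: if \<open>F(x) = \<Sum> c\<^sub>n x\<^sup>2\<^sup>n\<close> then the tails \<open>\<Sum>\<^bsub>n > j\<^esub> c\<^sub>n\<close> have the generating function
  \<open>(F(1) - F(x))/(1 - x\<^sup>2)\<close>, so every entry of the star composition again amounts to integrating these forms,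
  with the constant \<open>F(1)\<close> as a new coefficient.  Hence all generating functions are
  combinations of iterated integrals whose coefficients are colored multiple zeta values.
  By shuffle regularization such a function is near \<open>u = 1\<close> a polynomial in \<open>-ln (1 - u)\<close> with
  coefficients in the colored multiple zeta values, up to a rapidly vanishing error; a finite
  limit is its constant term.
\<close>

section \<open>Central binomial coefficients and Abel's limit theorem\<close>

text \<open>The factor \<open>\<i>\<close> in the first claim has one source: for theta = arcsin x,
  it is \<open>\<i>\<close> times d theta that is an integer combination of the forms. The first
  series comes from odd powers of theta, where one factor \<open>\<i>\<close> survives; the second
  comes from even powers, where the factors pair up to signs. Two obstacles shape the proof. Single
  iterated integrals may diverge at \<open>u = 1\<close> although their combination converges, so
  errors must stay negligible after multiplication by any power of the logarithm. An error of order
  \<open>sqrt (1 - u)\<close> does, and it comes from one majorant: the sequence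
  \<open>central_binom\<close> reproduces itself, up to a factor 2, under partial sums divided by
  the index, so it bounds the coefficients of all words, and its generating function
  \<open>1 / sqrt (1 - u)\<close> is integrable up to 1. The other obstacle is parity. Division of
  the coefficients by \<open>2 * real n + 1\<close> is integration against dx/x only for odd series,
  whereas the tail formula speaks of even ones. The missing or surplus factor x is absorbed by
  passing between the forms dx/(1 - x^2), x dx/(1 - x^2) and dx/x.\<close>

definition central_binom :: "nat \<Rightarrow> real" where
  "central_binom n = real ((2 * n) choose n) / 4 ^ n"

lemma central_binom_0 [simp]: "central_binom 0 = 1"
  by (simp add: central_binom_def)

lemma central_binom_pos: "central_binom n > 0"
  by (simp add: central_binom_def)

lemma central_binom_Suc: "central_binom (Suc n) = central_binom n * (2 * real n + 1) / (2 * real n + 2)"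
proof -
  have *: "central_binom k = fact (2 * k) / (fact k * fact k * 4 ^ k)" for k
    unfolding central_binom_def by (subst binomial_fact) (auto simp: mult_2)
  have "fact (2 * Suc n) = (2 * real n + 2) * (2 * real n + 1) * fact (2 * n)"
    by (simp add: algebra_simps)
  then show ?thesis
    unfolding * by (simp add: divide_simps) (simp add: algebra_simps)
qed

text \<open>A letter \<open>a \<noteq> 0\<close> turns coefficients into weighted partial sums
  divided by n. This identity says that \<open>central_binom\<close> survives that operation at the
  cost of a factor 2.\<close>

lemma sum_central_binom: "(\<Sum>k<n. central_binom k) = 2 * real n * central_binom n"
proof (induction n)
  case (Suc n)
  then show ?case by (simp add: central_binom_Suc field_simps)
qed simp

text \<open>The factor \<open>2 * real n + 1\<close> makes the product decrease: consecutive values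
  have quotient (2n+1)(2n+3)/(2n+2)^2 < 1. With the factor \<open>4 * real n\<close> of the lower
  bound it increases instead, so the order n^(-1/2) is exact.\<close>

lemma central_binom_upper: "central_binom n ^ 2 * (2 * real n + 1) \<le> 1"
proof (induction n)
  case (Suc n)
  have "central_binom (Suc n) ^ 2 * (2 * real (Suc n) + 1) =
      central_binom n ^ 2 * (2 * real n + 1) * ((2 * real n + 1) * (2 * real n + 3) / (2 * real n + 2) ^ 2)"
    by (simp add: central_binom_Suc power2_eq_square divide_simps)
  also have "\<dots> \<le> 1 * 1"
  proof (intro mult_mono Suc.IH)
    show "(2 * real n + 1) * (2 * real n + 3) / (2 * real n + 2) ^ 2 \<le> 1"
    proof -
      have "(2 * real n + 1) * (2 * real n + 3) \<le> (2 * real n + 2) ^ 2"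
        by (simp add: power2_eq_square algebra_simps)
      moreover have "0 < (2 * real n + 2) ^ 2" by (intro zero_less_power) simp
      ultimately show ?thesis by (simp only: divide_le_eq_1_pos)
    qed
  qed auto
  finally show ?case by simp
qed simp

lemma central_binom_lower: "n \<ge> 1 \<Longrightarrow> 1 \<le> central_binom n ^ 2 * (4 * real n)"
proof (induction n rule: dec_induct)
  case base
  have "central_binom 1 = 1 / 2" using central_binom_Suc[of 0] by simp
  then have "central_binom 1 ^ 2 * (4 * real 1) = 1" by (simp only:) (simp add: power2_eq_square)
  then show ?case by simp
next
  case (step n)
  have "1 * 1 \<le> central_binom n ^ 2 * (4 * real n) * ((2 * real n + 1) ^ 2 / (4 * real n * (real n + 1)))"
  proof (intro mult_mono step)
    have "0 < 4 * real n * (real n + 1)" using step by simp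
    moreover have "4 * real n * (real n + 1) \<le> (2 * real n + 1) ^ 2"
      by (simp add: power2_eq_square algebra_simps)
    ultimately show "1 \<le> (2 * real n + 1) ^ 2 / (4 * real n * (real n + 1))"
      by (simp only: le_divide_eq_1_pos)
  qed auto
  also have "\<dots> = central_binom (Suc n) ^ 2 * (4 * real (Suc n))"
    using step by (simp add: central_binom_Suc power2_eq_square divide_simps) (simp add: algebra_simps)
  finally show ?case by simp
qed

lemma central_binom_le_powr: "n \<ge> 1 \<Longrightarrow> central_binom n \<le> real n powr (-1/2)"
proof -
  assume n: "n \<ge> 1"
  have "central_binom n ^ 2 * real n \<le> central_binom n ^ 2 * (2 * real n + 1)"
    by (intro mult_left_mono) auto
  then have "central_binom n ^ 2 * real n \<le> 1" using central_binom_upper[of n] by linarith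
  then have "central_binom n ^ 2 \<le> 1 / real n"
    using n by (simp add: field_simps)
  also have "\<dots> = (real n powr (-1/2)) ^ 2"
    using n by (simp flip: powr_realpow add: powr_powr powr_minus field_simps)
  finally show ?thesis
    by (rule power2_le_imp_le) auto
qed

lemma inverse_central_binom_le_powr: "n \<ge> 1 \<Longrightarrow> 1 / central_binom n \<le> 2 * real n powr (1/2)"
proof -
  assume n: "n \<ge> 1"
  have "(1 / central_binom n) ^ 2 \<le> 4 * real n"
    using central_binom_lower[OF n] central_binom_pos[of n] by (simp add: field_simps)
  also have "\<dots> = (2 * real n powr (1/2)) ^ 2"
    using n by (simp add: power_mult_distrib powr_half_sqrt)
  finally show ?thesis
    by (rule power2_le_imp_le) auto
qed

lemma central_binom_le_1: "central_binom n \<le> 1"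
proof -
  have "central_binom n ^ 2 * 1 \<le> central_binom n ^ 2 * (2 * real n + 1)"
    by (intro mult_left_mono) auto
  with central_binom_upper[of n] have "central_binom n ^ 2 \<le> 1 ^ 2" by simp
  then show ?thesis by (rule power2_le_imp_le) simp
qed

lemma central_binom_div_summable: "summable (\<lambda>n. central_binom n / real n)"
proof (rule summable_comparison_test_ev)
  show "summable (\<lambda>n. real n powr (-3/2))"
    by (simp add: summable_real_powr_iff)
  have "norm (central_binom n / real n) \<le> real n powr (-3/2)" if "n \<ge> 1" for n
  proof -
    have "central_binom n / real n \<le> real n powr (-1/2) / real n powr 1"
      using central_binom_le_powr[OF that] central_binom_pos[of n] that by (intro divide_mono) auto
    also have "\<dots> = real n powr (-3/2)"
      using that by (subst powr_diff[symmetric]) auto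
    finally show ?thesis using central_binom_pos[of n] by simp
  qed
  then show "\<forall>\<^sub>F n in sequentially. norm (central_binom n / real n) \<le> real n powr (-3/2)"
    using eventually_sequentially by blast
qed

lemma central_binom_tendsto_0: "central_binom \<longlonglongrightarrow> 0"
proof (rule tendsto_sandwich)
  show "\<forall>\<^sub>F n in sequentially. 0 \<le> central_binom n" using central_binom_pos by (auto intro!: always_eventually less_imp_le)
  show "\<forall>\<^sub>F n in sequentially. central_binom n \<le> real n powr (-1/2)"
    using central_binom_le_powr eventually_sequentially by blast
  show "(\<lambda>n. real n powr (-1/2)) \<longlonglongrightarrow> 0" by real_asymp
qed auto

lemma summable_bounded_powser:
  fixes c :: "nat \<Rightarrow> 'a::{real_normed_field,banach}"
  assumes "\<And>n. norm (c n) \<le> B" "norm z < 1"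
  shows "summable (\<lambda>n. c n * z ^ n)"
proof (rule summable_comparison_test)
  show "summable (\<lambda>n. B * norm z ^ n)" using assms by (intro summable_mult summable_geometric) auto
  show "\<exists>N. \<forall>n\<ge>N. norm (c n * z ^ n) \<le> B * norm z ^ n"
    using assms by (auto simp: norm_mult norm_power intro!: mult_right_mono)
qed

text \<open>This is the binomial series with exponent -1/2. What matters later is that the
  singularity of the bound at 1 is integrable.\<close>

lemma central_binom_powser_le: 
  assumes "0 \<le> u" "u < 1"
  shows "summable (\<lambda>n. central_binom n * u ^ n)" "(\<Sum>n. central_binom n * u ^ n) \<le> 1 / sqrt (1 - u)"
proof -
  show s: "summable (\<lambda>n. central_binom n * u ^ n)"
    by (rule summable_bounded_powser[of _ 1]) (use assms central_binom_le_1 central_binom_pos in \<open>auto simp: abs_of_pos\<close>)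
  have g: "((-1/2::real) gchoose n) * (-1) ^ n = central_binom n" for n
  proof (induction n)
    case (Suc n)
    have "((-1/2::real) gchoose Suc n) * (-1) ^ Suc n
        = ((-1/2) gchoose n) * (-1) ^ n * ((2 * real n + 1) / (2 * real n + 2))"
    proof -
      have "((-1/2::real) gchoose Suc n) = ((-1/2) gchoose n) * ((-1/2 - real n) / (real n + 1))"
        using gbinomial_mult_1[of "-1/2::real" n] by (simp add: field_simps)
      then show ?thesis by (simp only:) (simp add: field_simps)
    qed
    with Suc show ?case by (simp add: central_binom_Suc)
  qed simp
  have "(\<lambda>n. ((-1/2) gchoose n) * (-u) ^ n) sums (1 + (-u)) powr (-1/2)"
    by (rule gen_binomial_real) (use assms in auto)
  moreover have "((-1/2) gchoose n) * (-u) ^ n = central_binom n * u ^ n" for n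
    using g[of n] by (simp add: power_minus[of u])
  ultimately have "(\<Sum>n. central_binom n * u ^ n) = (1 - u) powr (-1/2)"
    by (simp add: sums_iff)
  also have "\<dots> = 1 / sqrt (1 - u)"
    using assms by (simp add: powr_minus powr_half_sqrt field_simps)
  finally show "(\<Sum>n. central_binom n * u ^ n) \<le> 1 / sqrt (1 - u)" by simp
qed

text \<open>Summation by parts: with \<open>S n\<close> the error of the n-th partial sum, the
  difference to the limit is \<open>1 - u\<close> times the power series of the errors. The finitely
  many large errors are killed by the factor \<open>1 - u\<close>, and the others contribute at most
  \<open>e / 2\<close>.\<close>

lemma Abel_limit:
  fixes a :: "nat \<Rightarrow> complex"
  assumes "a sums s"
  shows "((\<lambda>u. \<Sum>n. a n * of_real u ^ n) \<longlongrightarrow> s) (at_left (1::real))"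
proof -
  define S where "S n = (\<Sum>k\<le>n. a k) - s" for n
  have S0: "S \<longlonglongrightarrow> 0"
    using assms unfolding S_def sums_def_le by (simp add: LIM_zero)
  then have "Bseq S" by (intro convergent_imp_Bseq) (auto simp: convergent_def)
  then obtain B where B: "\<And>n. norm (S n) \<le> B" unfolding Bseq_def by blast
  have eq: "(\<Sum>n. a n * of_real u ^ n) - s = (1 - of_real u) * (\<Sum>n. S n * of_real u ^ n)"
    if u: "0 < u" "u < 1" for u :: real
  proof -
    define x where "x = complex_of_real u"
    have nx: "norm x < 1" using u by (simp add: x_def)
    have sS: "summable (\<lambda>n. S n * x ^ n)"
      using B nx by (rule summable_bounded_powser)
    \<comment> \<open>\<open>S 0\<close> is \<open>a 0 - s\<close>, so the limit has to be added
      back at index 0.\<close>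
    have aS: "a n = (if n = 0 then S 0 + s else S n - S (n - 1))" for n
      by (cases n) (auto simp: S_def)
    have "(\<lambda>n. S n * x ^ n) sums (\<Sum>n. S n * x ^ n)" using sS by (simp add: summable_sums)
    moreover from sums_mult[OF this, of x]
    have "(\<lambda>n. if n = 0 then 0 else S (n - 1) * x ^ n) sums (x * (\<Sum>n. S n * x ^ n) + 0)"
      using sums_Suc[of "\<lambda>n. if n = 0 then 0 else S (n - 1) * x ^ n"] by (simp add: mult_ac)
    moreover have "(\<lambda>n. if n = 0 then s else 0) sums s"
      using sums_single[of 0 "\<lambda>_. s"] by (simp add: if_distrib cong: if_cong)
    ultimately have "(\<lambda>n. S n * x ^ n - (if n = 0 then 0 else S (n - 1) * x ^ n) + (if n = 0 then s else 0))
       sums ((\<Sum>n. S n * x ^ n) - (x * (\<Sum>n. S n * x ^ n) + 0) + s)"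
      by (intro sums_add sums_diff)
    also have "(\<lambda>n. S n * x ^ n - (if n = 0 then 0 else S (n - 1) * x ^ n) + (if n = 0 then s else 0))
       = (\<lambda>n. a n * x ^ n)"
      by (rule ext) (auto simp: aS algebra_simps)
    finally show ?thesis
      by (simp add: sums_iff x_def algebra_simps)
  qed
  have "((\<lambda>u. (1 - of_real u) * (\<Sum>n. S n * of_real u ^ n)) \<longlongrightarrow> 0) (at_left (1::real))"
    unfolding tendsto_iff
  proof (intro allI impI)
    fix e :: real assume e: "e > 0"
    obtain N where N: "\<And>n. n \<ge> N \<Longrightarrow> norm (S n) < e / 2"
      using LIMSEQ_D[OF S0, of "e / 2"] e by auto
    have "((\<lambda>u. (1 - u) * (\<Sum>n<N. norm (S n))) \<longlongrightarrow> (1 - 1) * (\<Sum>n<N. norm (S n))) (at_left (1::real))"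
      by (intro tendsto_intros)
    then have "\<forall>\<^sub>F u in at_left 1. (1 - u) * (\<Sum>n<N. norm (S n)) < e / 2"
      using e by (intro order_tendstoD(2)[where y = 0 and a = "e / 2"]) auto
    moreover have "\<forall>\<^sub>F u::real in at_left 1. u \<in> {0<..<1}"
      by (rule eventually_at_left_real) simp
    ultimately show "\<forall>\<^sub>F u in at_left 1. dist ((1 - of_real u) * (\<Sum>n. S n * of_real u ^ n)) 0 < e"
    proof eventually_elim
      case (elim u)
      define x where "x = complex_of_real u"
      have nx: "norm x < 1" using elim by (simp add: x_def)
      have sS: "summable (\<lambda>n. norm (S n) * u ^ n)"
        by (rule summable_bounded_powser[of _ B]) (use B elim in auto)
      have g: "summable (\<lambda>n. e / 2 * u ^ n)" using elim by (intro summable_mult summable_geometric) auto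
      have h: "summable (\<lambda>n. if n < N then norm (S n) else 0)"
        by (rule summable_finite[of "{..<N}"]) auto
      have "norm (\<Sum>n. S n * x ^ n) \<le> (\<Sum>n. norm (S n) * u ^ n)"
        using summable_norm[of "\<lambda>n. S n * x ^ n"] sS elim by (simp add: norm_mult norm_power x_def)
      also have "\<dots> \<le> (\<Sum>n. (if n < N then norm (S n) else 0) + e / 2 * u ^ n)"
      proof (intro suminf_le sS summable_add g h)
        fix n show "norm (S n) * u ^ n \<le> (if n < N then norm (S n) else 0) + e / 2 * u ^ n"
          using N[of n] elim e
          by (cases "n < N")
             (auto simp: not_less intro!: mult_right_mono add_increasing2 mult_left_le power_le_one)
      qed
      also have "\<dots> = (\<Sum>n<N. norm (S n)) + e / 2 / (1 - u)"
      proof -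
        have "(\<Sum>n. if n < N then norm (S n) else 0) = (\<Sum>n<N. norm (S n))"
          by (subst suminf_finite[of "{..<N}"]) auto
        then show ?thesis using elim
          suminf_add[OF h g] suminf_mult[OF summable_geometric, of u "e / 2"] suminf_geometric[of u]
          by simp
      qed
      finally have "(1 - u) * norm (\<Sum>n. S n * x ^ n) \<le> (1 - u) * ((\<Sum>n<N. norm (S n)) + e / 2 / (1 - u))"
        using elim by (intro mult_left_mono) auto
      also have "\<dots> = (1 - u) * (\<Sum>n<N. norm (S n)) + e / 2"
        using elim by (simp add: field_simps)
      also have "\<dots> < e" using elim by simp
      finally have "(1 - u) * norm (\<Sum>n. S n * x ^ n) < e" .
      moreover have "norm (1 - x) = 1 - u"
        using elim norm_of_real[of "1 - u", where 'a = complex] by (simp add: x_def)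
      ultimately show ?case by (simp add: norm_mult x_def)
    qed
  qed
  then have "((\<lambda>u. (\<Sum>n. a n * of_real u ^ n) - s) \<longlongrightarrow> 0) (at_left (1::real))"
  proof (rule tendsto_cong[THEN iffD1, rotated])
    show "\<forall>\<^sub>F u::real in at_left 1. (1 - of_real u) * (\<Sum>n. S n * of_real u ^ n) = (\<Sum>n. a n * of_real u ^ n) - s"
      by (rule eventually_mono[OF eventually_at_left_real[of 0 1]]) (use eq in auto)
  qed
  then show ?thesis by (simp add: LIM_zero_iff)
qed

section \<open>Iterated integrals as power series\<close>

text \<open>A word lists the differential forms of an iterated integral over \<open>[0, u]\<close>, outermost first:
  the letter \<open>0\<close> stands for \<open>du/u\<close> and \<open>a \<noteq> 0\<close> for \<open>du/(a - u)\<close>.  Convergence at \<open>0\<close> forbids the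
  last letter \<open>0\<close>, and convergence at \<open>1\<close> forbids the first letter \<open>1\<close>.\<close>

definition mz_letters :: "complex set" where
  "mz_letters = insert 0 {z. z ^ 4 = 1}"

definition valid_word :: "complex list \<Rightarrow> bool" where
  "valid_word w \<longleftrightarrow> set w \<subseteq> mz_letters \<and> (w \<noteq> [] \<longrightarrow> last w \<noteq> 0)"

definition admissible_word :: "complex list \<Rightarrow> bool" where
  "admissible_word w \<longleftrightarrow> valid_word w \<and> (w \<noteq> [] \<longrightarrow> hd w \<noteq> 1)"

text \<open>Expanding \<open>1 / (a - u)\<close> geometrically and integrating shifts the exponent
  by one, which gives the powers \<open>(1 / a) ^ (n - k)\<close>. Division by
  \<open>of_nat 0\<close> yields 0, so every nonempty word gets constant term 0, as an integral
  starting at 0 should.\<close>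

fun word_coeff :: "complex list \<Rightarrow> nat \<Rightarrow> complex" where
  "word_coeff [] n = (if n = 0 then 1 else 0)"
| "word_coeff (a # w) n =
     (if a = 0 then word_coeff w n else \<Sum>k<n. word_coeff w k * (1 / a) ^ (n - k)) / of_nat n"

definition diff_form :: "complex \<Rightarrow> real \<Rightarrow> complex" where
  "diff_form a u = (if a = 0 then 1 / of_real u else 1 / (a - of_real u))"

definition word_fun :: "complex list \<Rightarrow> real \<Rightarrow> complex" where
  "word_fun w u = (\<Sum>n. word_coeff w n * of_real u ^ n)"

lemma norm_letter: "a \<in> mz_letters \<Longrightarrow> a \<noteq> 0 \<Longrightarrow> norm a = 1"
proof -
  assume "a \<in> mz_letters" "a \<noteq> 0"
  then have "norm a ^ 4 = 1 ^ 4" by (simp add: mz_letters_def flip: norm_power)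
  then show "norm a = 1" by (subst (asm) power_eq_iff_eq_base) auto
qed

text \<open>A constant bound would not suffice later: the decay n^(-1/2) of the majorant gives both
  convergence at 1 and its rate. Each letter costs a factor 2, by \<open>sum_central_binom\<close>
  for nonzero letters and trivially for the letter 0.\<close>

lemma word_coeff_bound: "set w \<subseteq> mz_letters \<Longrightarrow> norm (word_coeff w n) \<le> 2 ^ length w * central_binom n"
proof (induction w arbitrary: n)
  case Nil
  show ?case using central_binom_pos[of n] by (auto intro: less_imp_le)
next
  case (Cons a w)
  have IH: "norm (word_coeff w k) \<le> 2 ^ length w * central_binom k" for k using Cons by auto
  show ?case
  proof (cases "n = 0")
    case True
    then show ?thesis using central_binom_pos[of n] by (auto intro: less_imp_le)
  next
    case n: False
    show ?thesis
    proof (cases "a = 0")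
      case True
      have "norm (word_coeff w n) / real n \<le> norm (word_coeff w n) / 1"
        using n by (intro divide_left_mono) auto
      also have "\<dots> \<le> 2 ^ length w * central_binom n" using IH[of n] by simp
      also have "\<dots> \<le> 2 * (2 ^ length w * central_binom n)" using central_binom_pos[of n] by simp
      finally show ?thesis using True by (simp add: norm_divide)
    next
      case False
      then have "norm a = 1" using norm_letter[of a] Cons.prems by auto
      then have "norm (\<Sum>k<n. word_coeff w k * (1 / a) ^ (n - k)) \<le> (\<Sum>k<n. 2 ^ length w * central_binom k)"
        using IH by (intro sum_norm_le) (simp add: norm_mult norm_power norm_divide)
      also have "\<dots> = 2 ^ length w * (2 * real n * central_binom n)"
        by (simp add: sum_central_binom flip: sum_distrib_left)
      finally show ?thesis using False n by (simp add: norm_divide field_simps)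
    qed
  qed
qed

lemma word_coeff_bound': "set w \<subseteq> mz_letters \<Longrightarrow> norm (word_coeff w n) \<le> 2 ^ length w"
  using word_coeff_bound[of w n] central_binom_le_1[of n] by (meson mult_left_le order.trans zero_le_numeral zero_le_power)

lemma word_coeff_0: "w \<noteq> [] \<Longrightarrow> word_coeff w 0 = 0"
  by (cases w) auto

text \<open>This is the differential equation (a - u) f' = g read off coefficientwise, with f and g
  the functions of \<open>a # w\<close> and \<open>w\<close>.\<close>

lemma word_coeff_rec:
  assumes "a \<noteq> 0"
  shows "a * (of_nat (Suc n) * word_coeff (a # w) (Suc n)) = of_nat n * word_coeff (a # w) n + word_coeff w n"
proof -
  have "a * (\<Sum>k<Suc n. word_coeff w k * (1 / a) ^ (Suc n - k)) = (\<Sum>k<n. word_coeff w k * (1 / a) ^ (n - k)) + word_coeff w n"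
    using assms by (simp add: sum_distrib_left distrib_left Suc_diff_le mult_ac)
  moreover have "n = 0 \<Longrightarrow> (\<Sum>k<n. word_coeff w k * (1 / a) ^ (n - k)) = 0" by simp
  ultimately show ?thesis using assms by (auto simp del: sum.lessThan_Suc of_nat_Suc)
qed

lemma summable_word_fun:
  fixes z :: complex
  assumes "set w \<subseteq> mz_letters" "norm z < 1"
  shows "summable (\<lambda>n. word_coeff w n * z ^ n)"
  using word_coeff_bound'[OF assms(1)] assms(2) by (rule summable_bounded_powser)

lemma word_fun_bound:
  assumes "set w \<subseteq> mz_letters" "0 \<le> u" "u < 1"
  shows "norm (word_fun w u) \<le> 2 ^ length w / sqrt (1 - u)"
proof -
  have s: "summable (\<lambda>n. 2 ^ length w * (central_binom n * u ^ n))"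
    using central_binom_powser_le(1)[OF assms(2,3)] by (intro summable_mult)
  have "norm (word_fun w u) \<le> (\<Sum>n. 2 ^ length w * (central_binom n * u ^ n))"
    unfolding word_fun_def
  proof (rule norm_suminf_le[OF _ s])
    fix n show "norm (word_coeff w n * of_real u ^ n) \<le> 2 ^ length w * (central_binom n * u ^ n)"
      using word_coeff_bound[OF assms(1), of n] assms(2)
      by (simp add: norm_mult norm_power mult_right_mono flip: mult.assoc)
  qed
  also have "\<dots> = 2 ^ length w * (\<Sum>n. central_binom n * u ^ n)"
    using central_binom_powser_le(1)[OF assms(2,3)] by (rule suminf_mult)
  also have "\<dots> \<le> 2 ^ length w * (1 / sqrt (1 - u))"
    using central_binom_powser_le(2)[OF assms(2,3)] by (intro mult_left_mono) auto
  finally show ?thesis by simp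
qed

lemma word_fun_Nil [simp]: "word_fun [] u = 1"
proof -
  have "(\<lambda>n. word_coeff [] n * of_real u ^ n) = (\<lambda>n. if n = 0 then 1 else 0)" by auto
  then show ?thesis unfolding word_fun_def by (simp only:) (subst suminf_finite[of "{0}"], auto)
qed

lemma valid_word_Cons: "valid_word (a # w) \<longleftrightarrow> a \<in> mz_letters \<and> valid_word w \<and> (w = [] \<longrightarrow> a \<noteq> 0)"
  by (auto simp: valid_word_def)

lemma valid_word_mz_letters: "valid_word w \<Longrightarrow> set w \<subseteq> mz_letters"
  by (simp add: valid_word_def)

lemma word_fun_deriv:
  assumes v: "valid_word (a # w)" and u: "0 < u" "u < 1"
  shows "(word_fun (a # w) has_vector_derivative diff_form a u * word_fun w u) (at u)"
proof -
  define z where "z = complex_of_real u"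
  have nz: "norm z < 1" "z \<noteq> 0" using u by (auto simp: z_def)
  define c where "c = word_coeff (a # w)"
  define d where "d = diffs c"
  have lt: "set (a # w) \<subseteq> mz_letters" "set w \<subseteq> mz_letters" using v by (auto simp: valid_word_def)
  have sc: "summable (\<lambda>n. c n * y ^ n)" if "norm y < 1" for y
    using summable_word_fun[OF lt(1) that] by (simp add: c_def)
  have D: "((\<lambda>z. \<Sum>n. c n * z ^ n) has_field_derivative (\<Sum>n. d n * z ^ n)) (at z)"
    unfolding d_def using sc nz(1) by (rule termdiffs_strong')
  have sd: "summable (\<lambda>n. d n * z ^ n)"
    unfolding d_def using nz(1) sc by (rule termdiff_converges)
  have "(\<Sum>n. d n * z ^ n) = diff_form a u * word_fun w u"
  proof (cases "a = 0")
    case True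
    \<comment> \<open>Validity forbids the word \<open>[0]\<close>. Hence \<open>w\<close> is
      nonempty and its series has no constant term that du/u could not integrate.\<close>
    then have w: "w \<noteq> []" using v by (auto simp: valid_word_def)
    have "d n = word_coeff w (Suc n)" for n
      using True by (simp add: d_def diffs_def c_def del: of_nat_Suc)
    then have "(\<Sum>n. d n * z ^ n) * z = (\<Sum>n. word_coeff w (Suc n) * z ^ Suc n)"
      using sd by (subst suminf_mult2) (auto simp: mult_ac)
    also have "\<dots> = word_fun w u"
      using suminf_split_head[OF summable_word_fun[OF lt(2) nz(1)]] word_coeff_0[OF w] by (simp add: word_fun_def z_def)
    finally show ?thesis using True nz by (simp add: diff_form_def z_def field_simps)
  next
    case False
    have "norm a = 1" using False norm_letter lt by auto
    then have az: "a \<noteq> z" using nz by auto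
    have dn: "a * d n = (if n = 0 then 0 else d (n - 1)) + word_coeff w n" for n
      using word_coeff_rec[OF False, of n w] by (cases n) (auto simp: d_def diffs_def c_def simp del: of_nat_Suc word_coeff.simps)
    have "(\<lambda>n. d n * z ^ n) sums (\<Sum>n. d n * z ^ n)" (is "_ sums ?s") using sd by (simp add: summable_sums)
    note sums_mult[OF this, of a] sums_mult[OF this, of z]
    then have "(\<lambda>n. a * (d n * z ^ n)) sums (a * ?s)"
      "(\<lambda>n. if n = 0 then 0 else d (n - 1) * z ^ n) sums (z * ?s + 0)"
      using sums_Suc[of "\<lambda>n. if n = 0 then 0 else d (n - 1) * z ^ n"] by (simp_all add: mult_ac)
    then have "(\<lambda>n. a * (d n * z ^ n) - (if n = 0 then 0 else d (n - 1) * z ^ n)) sums (a * ?s - (z * ?s + 0))"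
      by (rule sums_diff)
    also have "(\<lambda>n. a * (d n * z ^ n) - (if n = 0 then 0 else d (n - 1) * z ^ n)) = (\<lambda>n. word_coeff w n * z ^ n)"
      using dn by (auto simp: algebra_simps simp flip: mult.assoc)
    finally have "word_fun w u = (a - z) * ?s" by (simp add: sums_iff word_fun_def z_def algebra_simps)
    then show ?thesis using False az by (simp add: diff_form_def z_def field_simps)
  qed
  with D have "((\<lambda>z. \<Sum>n. c n * z ^ n) has_field_derivative (diff_form a u * word_fun w u)) (at (of_real u))"
    by (simp add: z_def)
  from has_vector_derivative_real_field[OF this]
  show ?thesis by (simp add: word_fun_def[abs_def] c_def del: word_coeff.simps)
qed

lemma word_fun_tendsto_0:
  assumes "set w \<subseteq> mz_letters" "w \<noteq> []"
  shows "(word_fun w \<longlongrightarrow> 0) (at_right 0)"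
proof -
  have "isCont (\<lambda>z. \<Sum>n. word_coeff w n * z ^ n) (0::complex)"
    by (rule isCont_powser[where K = "1/2"]) (use summable_word_fun[OF assms(1), of "1/2"] in auto)
  then have "((\<lambda>z. \<Sum>n. word_coeff w n * z ^ n) \<longlongrightarrow> 0) (nhds (0::complex))"
    using word_coeff_0[OF assms(2)] by (simp add: isCont_def tendsto_nhds_iff)
  moreover have "filterlim complex_of_real (nhds 0) (at_right 0)"
    by (auto intro!: tendsto_eq_intros)
  ultimately show ?thesis unfolding word_fun_def[abs_def] by (rule filterlim_compose)
qed

lemma admissible_word_summable:
  assumes "admissible_word w"
  shows "summable (word_coeff w)"
proof (cases w)
  case Nil
  moreover have "summable (word_coeff [])" by (rule summable_finite[of "{0}"]) auto
  ultimately show ?thesis by simp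
next
  case (Cons a v)
  have lt: "set v \<subseteq> mz_letters" "a \<in> mz_letters" "set w \<subseteq> mz_letters" "a \<noteq> 1"
    using assms Cons by (auto simp: admissible_word_def valid_word_def)
  have b: "norm (word_coeff v n) / real n \<le> 2 ^ length v * (central_binom n / real n)" for n
    using word_coeff_bound[OF lt(1), of n] by (simp add: divide_right_mono)
  have sv: "summable (\<lambda>n. norm (word_coeff v n / of_nat n))"
    by (rule summable_comparison_test'[OF summable_mult[OF central_binom_div_summable]])
       (use b in \<open>auto simp: norm_divide\<close>)
  show ?thesis
  proof (cases "a = 0")
    case True
    then have "word_coeff w = (\<lambda>n. word_coeff v n / of_nat n)" using Cons by (intro ext) simp
    then show ?thesis using summable_norm_cancel[OF sv] by (simp only:)
  next
    case False
    (* For the first letter a, (a - 1) e_n telescopes up to an absolutely summable error. *)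
    define e where "e = word_coeff w"
    have e_le: "norm (e n) \<le> 2 ^ length w * central_binom n" for n
      using word_coeff_bound[OF lt(3)] by (simp add: e_def)
    have e0: "e \<longlonglongrightarrow> 0"
      by (rule Lim_null_comparison[OF always_eventually tendsto_mult_right_zero[OF central_binom_tendsto_0]])
         (use e_le in auto)
    have "summable (\<lambda>n. e (Suc n) / of_nat n)"
    proof (rule summable_comparison_test'[OF summable_mult[OF central_binom_div_summable]])
      fix n :: nat
      have "central_binom (Suc n) \<le> central_binom n * 1"
        unfolding central_binom_Suc times_divide_eq_right[symmetric] using central_binom_pos[of n]
        by (intro mult_left_mono) (auto simp: divide_simps)
      then have "2 ^ length w * central_binom (Suc n) \<le> 2 ^ length w * central_binom n" by simp
      with e_le[of "Suc n"] have "norm (e (Suc n)) \<le> 2 ^ length w * central_binom n" by linarith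
      then show "norm (e (Suc n) / of_nat n) \<le> 2 ^ length w * (central_binom n / real n)"
        using divide_right_mono[of "norm (e (Suc n))" "2 ^ length w * central_binom n" "real n"]
        by (simp add: norm_divide)
    qed
    then have "summable (\<lambda>n. word_coeff v n / of_nat n - a * (e (Suc n) / of_nat n))"
      using summable_norm_cancel[OF sv] by (intro summable_diff summable_mult)
    moreover have "summable (\<lambda>n. a * (e n - e (Suc n)))"
      using telescope_summable'[OF e0] by (rule summable_mult)
    ultimately have "summable (\<lambda>n. (word_coeff v n / of_nat n - a * (e (Suc n) / of_nat n)) + a * (e n - e (Suc n)))"
      by (rule summable_add)
    \<comment> \<open>This is \<open>word_coeff_rec\<close> divided by n. The left side is summable,
      and \<open>a \<noteq> 1\<close> lets the factor \<open>a - 1\<close> be cancelled.\<close>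
    moreover have "(word_coeff v n / of_nat n - a * (e (Suc n) / of_nat n)) + a * (e n - e (Suc n)) = (a - 1) * e n"
      if "n \<ge> 1" for n
    proof -
      have "a * (of_nat (Suc n) * e (Suc n)) = of_nat n * e n + word_coeff v n"
        using word_coeff_rec[OF False, of n v] by (simp add: e_def Cons del: word_coeff.simps)
      then show ?thesis using that by (simp add: field_simps)
    qed
    ultimately have "summable (\<lambda>n. (a - 1) * e n)"
      by (elim summable_cong[THEN iffD1, rotated]) (rule eventually_sequentiallyI[of 1], simp)
    then show ?thesis using lt(4) by (simp add: e_def summable_mult_D)
  qed
qed

definition word_val :: "complex list \<Rightarrow> complex" where
  "word_val w = (\<Sum>n. word_coeff w n)"

lemma word_fun_tendsto_word_val: "admissible_word w \<Longrightarrow> (word_fun w \<longlongrightarrow> word_val w) (at_left 1)"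
  using Abel_limit[of "word_coeff w" "word_val w"] admissible_word_summable[of w]
  by (simp add: word_fun_def[abs_def] word_val_def summable_sums)

text \<open>The first letter is not 1, so its form is bounded near 1, and the remaining word is at
  most a multiple of \<open>1 / sqrt (1 - x)\<close>. Integrating from u to 1 gives the rate.
  Starting at 1/2 avoids the pole of \<open>diff_form 0\<close> at 0.\<close>

lemma word_fun_word_val_rate:
  assumes "admissible_word w"
  shows "\<exists>C. \<forall>u. 1/2 \<le> u \<longrightarrow> u < 1 \<longrightarrow> norm (word_fun w u - word_val w) \<le> C * sqrt (1 - u)"
proof (cases w)
  case Nil
  have "word_val [] = 1" unfolding word_val_def by (subst suminf_finite[of "{0}"]) auto
  then show ?thesis using Nil by (auto intro!: exI[of _ 0])
next
  case (Cons a v)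
  have lt: "set v \<subseteq> mz_letters" "a \<in> mz_letters" "valid_word w" "a \<noteq> 1"
    using assms Cons by (auto simp: admissible_word_def valid_word_def)
  obtain K where K: "K \<ge> 0" "\<And>u. 1/2 \<le> u \<Longrightarrow> u \<le> 1 \<Longrightarrow> norm (diff_form a u) \<le> K"
  proof -
    have "continuous_on {1/2..1} (diff_form a)"
    proof (cases "a = 0")
      case False
      then have "a \<noteq> of_real x" if "1/2 \<le> x" "x \<le> 1" for x
        using norm_letter[OF lt(2)] lt(4) that by auto
      with False show ?thesis unfolding diff_form_def[abs_def] by (auto intro!: continuous_intros)
    qed (auto simp: diff_form_def[abs_def] intro!: continuous_intros)
    then have "compact (diff_form a ` {1/2..1})" by (rule compact_continuous_image) auto
    then obtain K where "\<And>x. x \<in> diff_form a ` {1/2..1} \<Longrightarrow> norm x \<le> K"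
      using compact_imp_bounded bounded_iff by metis
    then show ?thesis using that[of "max K 0"] by (auto simp: le_max_iff_disj)
  qed
  define M where "M = K * 2 ^ length v"
  have M: "M \<ge> 0" using K by (simp add: M_def)
  have le: "norm (word_fun w s - word_fun w u) \<le> 2 * M * sqrt (1 - u)" if us: "1/2 \<le> u" "u < s" "s < 1" for u s
  proof -
    \<comment> \<open>The comparison function \<open>- 2 * M * sqrt (1 - x)\<close> is a primitive
      of \<open>M / sqrt (1 - x)\<close>, so the bound stays finite as \<open>s\<close> approaches
      1.\<close>
    have "norm (word_fun w s - word_fun w u) \<le> - 2 * M * sqrt (1 - s) - - 2 * M * sqrt (1 - u)"
    proof (rule differentiable_bound_general)
      have der: "(word_fun w has_vector_derivative diff_form a x * word_fun v x) (at x)" if "u \<le> x" "x \<le> s" for x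
        using word_fun_deriv[of a v x] lt that us Cons by auto
      then show "continuous_on {u..s} (word_fun w)"
        by (intro continuous_at_imp_continuous_on ballI) (meson atLeastAtMost_iff has_vector_derivative_continuous)
      show "(word_fun w has_vector_derivative diff_form a x * word_fun v x) (at x)" if "u < x" "x < s" for x
        using der that by auto
      show "((\<lambda>x. - 2 * M * sqrt (1 - x)) has_vector_derivative M / sqrt (1 - x)) (at x)" if "u < x" "x < s" for x
        unfolding has_real_derivative_iff_has_vector_derivative[symmetric]
        using that us by (auto intro!: derivative_eq_intros simp: field_simps)
      show "norm (diff_form a x * word_fun v x) \<le> M / sqrt (1 - x)" if "u < x" "x < s" for x
      proof -
        have "norm (diff_form a x) * norm (word_fun v x) \<le> K * (2 ^ length v / sqrt (1 - x))"
          using K word_fun_bound[OF lt(1), of x] that us by (intro mult_mono) auto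
        then show ?thesis by (simp add: norm_mult M_def)
      qed
    qed (use us in \<open>auto intro!: continuous_intros\<close>)
    also have "\<dots> \<le> 2 * M * sqrt (1 - u)" using M us by simp
    finally show ?thesis .
  qed
  have "norm (word_fun w u - word_val w) \<le> 2 * M * sqrt (1 - u)" if u: "1/2 \<le> u" "u < 1" for u
  proof -
    have "((\<lambda>s. norm (word_fun w s - word_fun w u)) \<longlongrightarrow> norm (word_val w - word_fun w u)) (at_left 1)"
      by (intro tendsto_intros word_fun_tendsto_word_val assms)
    moreover have "\<forall>\<^sub>F s in at_left 1. norm (word_fun w s - word_fun w u) \<le> 2 * M * sqrt (1 - u)"
      using eventually_at_left_real[OF u(2)] by (rule eventually_mono) (use le u in auto)
    ultimately have "norm (word_val w - word_fun w u) \<le> 2 * M * sqrt (1 - u)"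
      by (rule tendsto_upperbound) auto
    then show ?thesis by (simp add: norm_minus_commute)
  qed
  then show ?thesis by blast
qed

section \<open>Nested sums and the span of colored multiple zeta values\<close>

lemma finite_decreasing_tuples [simp]: "finite (decreasing_tuples s N)"
  by (rule finite_subset[OF _ finite_lists_length_eq[of "{1..N}" s]]) (auto simp: decreasing_tuples_def)

lemma finite_weakly_decreasing_tuples [simp]: "finite (weakly_decreasing_tuples s N)"
  by (rule finite_subset[OF _ finite_lists_length_eq[of "{1..N}" s]])
     (auto simp: weakly_decreasing_tuples_def)

lemma decreasing_tuples_0 [simp]: "decreasing_tuples 0 N = {[]}"
  by (auto simp: decreasing_tuples_def)

lemma weakly_decreasing_tuples_0 [simp]: "weakly_decreasing_tuples 0 N = {[]}"
  by (auto simp: weakly_decreasing_tuples_def)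

lemma decreasing_tuples_Suc:
  "decreasing_tuples (Suc s) N = (\<lambda>(n, ns). n # ns) ` (SIGMA n:{1..N}. decreasing_tuples s (n - 1))"
proof (intro equalityI subsetI)
  fix x assume "x \<in> decreasing_tuples (Suc s) N"
  then obtain n ns where "x = n # ns" "length ns = s" "set ns \<subseteq> {1..N}" "n \<in> {1..N}"
    "sorted_wrt (>) ns" "\<forall>k\<in>set ns. k < n"
    by (cases x) (auto simp: decreasing_tuples_def)
  then show "x \<in> (\<lambda>(n, ns). n # ns) ` (SIGMA n:{1..N}. decreasing_tuples s (n - 1))"
    by (force simp: decreasing_tuples_def)
next
  fix x assume "x \<in> (\<lambda>(n, ns). n # ns) ` (SIGMA n:{1..N}. decreasing_tuples s (n - 1))"
  then show "x \<in> decreasing_tuples (Suc s) N"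
    by (force simp: decreasing_tuples_def)
qed

lemma weakly_decreasing_tuples_Suc:
  "weakly_decreasing_tuples (Suc s) N = (\<lambda>(n, ns). n # ns) ` (SIGMA n:{1..N}. weakly_decreasing_tuples s n)"
proof (intro equalityI subsetI)
  fix x assume "x \<in> weakly_decreasing_tuples (Suc s) N"
  then obtain n ns where "x = n # ns" "length ns = s" "set ns \<subseteq> {1..N}" "n \<in> {1..N}"
    "sorted_wrt (\<ge>) ns" "\<forall>k\<in>set ns. k \<le> n"
    by (cases x) (auto simp: weakly_decreasing_tuples_def)
  then show "x \<in> (\<lambda>(n, ns). n # ns) ` (SIGMA n:{1..N}. weakly_decreasing_tuples s n)"
    by (force simp: weakly_decreasing_tuples_def)
next
  fix x assume "x \<in> (\<lambda>(n, ns). n # ns) ` (SIGMA n:{1..N}. weakly_decreasing_tuples s n)"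
  then show "x \<in> weakly_decreasing_tuples (Suc s) N"
    by (force simp: weakly_decreasing_tuples_def)
qed

lemma sum_decreasing_tuples_Suc:
  fixes f :: "nat \<Rightarrow> nat \<Rightarrow> 'a::comm_semiring_1"
  shows "(\<Sum>ns\<in>decreasing_tuples (Suc s) N. \<Prod>j<Suc s. f j (ns ! j)) =
    (\<Sum>n=1..N. f 0 n * (\<Sum>ns\<in>decreasing_tuples s (n - 1). \<Prod>j<s. f (Suc j) (ns ! j)))"
proof -
  have "inj_on (\<lambda>(n, ns). n # ns) (SIGMA n:{1..N}. decreasing_tuples s (n - 1))"
    by (auto simp: inj_on_def)
  then show ?thesis
    unfolding decreasing_tuples_Suc
    by (subst sum.reindex)
       (auto simp: sum.Sigma sum_distrib_left prod.lessThan_Suc_shift case_prod_unfold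
             simp del: prod.lessThan_Suc intro!: sum.cong)
qed

lemma sum_weakly_decreasing_tuples_Suc:
  fixes f :: "nat \<Rightarrow> nat \<Rightarrow> 'a::comm_semiring_1"
  shows "(\<Sum>ns\<in>weakly_decreasing_tuples (Suc s) N. \<Prod>j<Suc s. f j (ns ! j)) =
    (\<Sum>n=1..N. f 0 n * (\<Sum>ns\<in>weakly_decreasing_tuples s n. \<Prod>j<s. f (Suc j) (ns ! j)))"
proof -
  have "inj_on (\<lambda>(n, ns). n # ns) (SIGMA n:{1..N}. weakly_decreasing_tuples s n)"
    by (auto simp: inj_on_def)
  then show ?thesis
    unfolding weakly_decreasing_tuples_Suc
    by (subst sum.reindex)
       (auto simp: sum.Sigma sum_distrib_left prod.lessThan_Suc_shift case_prod_unfold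
             simp del: prod.lessThan_Suc intro!: sum.cong)
qed

lemma zeta_sum_Nil [simp]: "zeta_sum n [] = 1"
  by (simp add: zeta_sum_def)

lemma zeta_sum_Cons: "zeta_sum n (a # as) = (\<Sum>k=1..n. 1 / real k ^ a * zeta_sum (k - 1) as)"
  unfolding zeta_sum_def list.size add_0_right add_Suc_right
  by (subst sum_decreasing_tuples_Suc) simp

lemma t_sum_Nil [simp]: "t_sum n [] = 1"
  by (simp add: t_sum_def)

lemma t_sum_Cons: "t_sum n (a # as) = (\<Sum>k=1..n. 1 / (2 * real k - 1) ^ a * t_sum (k - 1) as)"
  unfolding t_sum_def list.size add_0_right add_Suc_right
  by (subst sum_decreasing_tuples_Suc) simp

lemma t_star_sum_Nil [simp]: "t_star_sum n [] = 1"
  by (simp add: t_star_sum_def)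

lemma t_star_sum_Cons: "t_star_sum n (a # as) = (\<Sum>k=1..n. 1 / (2 * real k - 1) ^ a * t_star_sum k as)"
  unfolding t_star_sum_def list.size add_0_right add_Suc_right
  by (subst sum_weakly_decreasing_tuples_Suc) simp

lemma cmzv_partial_Nil [simp]: "cmzv_partial n [] zs = 1"
  by (simp add: cmzv_partial_def)

lemma cmzv_partial_Cons:
  "cmzv_partial n (a # as) (z # zs) = (\<Sum>k=1..n. z ^ k / of_nat k ^ a * cmzv_partial (k - 1) as zs)"
  unfolding cmzv_partial_def list.size add_0_right add_Suc_right
  by (subst sum_decreasing_tuples_Suc) simp

section \<open>Colored multiple zeta values as values of words\<close>

text \<open>The part of the nested sum whose largest index is n. The value 1 of the empty
  composition at n = 0 acts as a final index 0 below all others, so the strict inequality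
  \<open>k < n\<close> also covers the innermost sum.\<close>

fun cmzv_coeff :: "nat list \<Rightarrow> complex list \<Rightarrow> nat \<Rightarrow> complex" where
  "cmzv_coeff [] zs n = (if n = 0 then 1 else 0)"
| "cmzv_coeff (a # as) zs n = hd zs ^ n / of_nat n ^ a * (\<Sum>k<n. cmzv_coeff as (tl zs) k)"

lemma cmzv_partial_eq:
  "length zs = length as \<Longrightarrow> cmzv_partial N as zs = (\<Sum>n\<le>N. cmzv_coeff as zs n)"
proof (induction as arbitrary: zs N)
  case Nil
  then show ?case by (simp add: sum.delta)
next
  case (Cons a as)
  then obtain z zs' where zs: "zs = z # zs'" "length zs' = length as" by (cases zs) auto
  have "(\<Sum>n\<le>N. cmzv_coeff (a # as) zs n) = (\<Sum>n=1..N. cmzv_coeff (a # as) zs n)"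
    by (rule sum.mono_neutral_right) (auto simp: not_le)
  also have "\<dots> = (\<Sum>k=1..N. z ^ k / of_nat k ^ a * cmzv_partial (k - 1) as zs')"
  proof (rule sum.cong[OF refl])
    fix k assume "k \<in> {1..N}"
    then have "{..<k} = {..k - 1}" by auto
    then show "cmzv_coeff (a # as) zs k = z ^ k / of_nat k ^ a * cmzv_partial (k - 1) as zs'"
      using Cons.IH[OF zs(2)] zs(1) by simp
  qed
  finally show ?case using zs by (simp add: cmzv_partial_Cons)
qed

fun twist_head :: "complex \<Rightarrow> complex list \<Rightarrow> complex list" where
  "twist_head c [] = []"
| "twist_head c (z # zs) = c * z # zs"

lemma length_twist_head [simp]: "length (twist_head c zs) = length zs"
  by (cases zs) auto

lemma twist_head_twist_head: "twist_head c (twist_head d zs) = twist_head (c * d) zs"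
  by (cases zs) auto

lemma twist_head_1 [simp]: "twist_head 1 zs = zs"
  by (cases zs) auto

lemma set_twist_head: "c ^ 4 = 1 \<Longrightarrow> \<forall>z\<in>set zs. z ^ 4 = 1 \<Longrightarrow> \<forall>z\<in>set (twist_head c zs). z ^ 4 = 1"
  by (cases zs) (auto simp: power_mult_distrib)

lemma cmzv_coeff_twist_head:
  "length zs = length as \<Longrightarrow> cmzv_coeff as (twist_head c zs) n = c ^ n * cmzv_coeff as zs n"
  by (cases as; cases zs) (auto simp: power_mult_distrib)

text \<open>The nonzero letters are the inverses of the products of the first arguments z_1, z_1
  z_2, and so on; \<open>twist_head\<close> carries the product along. An exponent \<open>a\<close>
  contributes its nonzero letter and \<open>a - 1\<close> letters 0, so length equals
  weight.\<close>

fun word_of :: "nat list \<Rightarrow> complex list \<Rightarrow> complex list" where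
  "word_of [] zs = []"
| "word_of (a # as) zs = replicate (a - 1) 0 @ 1 / hd zs # word_of as (twist_head (hd zs) (tl zs))"

lemma word_coeff_replicate_0: "word_coeff (replicate j 0 @ w) n = word_coeff w n / of_nat n ^ j"
  by (induction j) auto

text \<open>A letter \<open>1 / z\<close> contributes \<open>z ^ (n - k)\<close>, depending on the
  gap between neighbouring indices, whereas a multiple zeta value has \<open>z ^ n\<close>. The
  twist of the inner arguments supplies the missing \<open>z ^ k\<close>.\<close>

lemma word_coeff_word_of:
  "length zs = length as \<Longrightarrow> composition as \<Longrightarrow> \<forall>z\<in>set zs. z ^ 4 = 1 \<Longrightarrow>
    word_coeff (word_of as zs) n = cmzv_coeff as zs n"
proof (induction as arbitrary: zs n)
  case (Cons a as)
  then obtain z zs' where zs: "zs = z # zs'" "length zs' = length as" by (cases zs) auto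
  have z: "z ^ 4 = 1" "z \<noteq> 0" using Cons.prems zs by (auto simp: power_0_left)
  have "word_coeff (word_of as (twist_head z zs')) k = z ^ k * cmzv_coeff as zs' k" for k
    using Cons zs z set_twist_head[OF z(1), of zs']
    by (subst Cons.IH) (auto simp: composition_def cmzv_coeff_twist_head)
  then have "(\<Sum>k<n. word_coeff (word_of as (twist_head z zs')) k * z ^ (n - k)) = (\<Sum>k<n. z ^ n * cmzv_coeff as zs' k)"
    by (intro sum.cong) (auto simp flip: power_add)
  moreover have "a \<ge> 1" using Cons.prems by (auto simp: composition_def)
  ultimately show ?case
    using zs z by (cases a) (auto simp: word_coeff_replicate_0 sum_distrib_left sum_divide_distrib)
qed auto

lemma word_of_valid_word:
  "length zs = length as \<Longrightarrow> composition as \<Longrightarrow> \<forall>z\<in>set zs. z ^ 4 = 1 \<Longrightarrow>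
    valid_word (word_of as zs) \<and> length (word_of as zs) = sum_list as"
proof (induction as arbitrary: zs)
  case (Cons a as)
  then obtain z zs' where zs: "zs = z # zs'" "length zs' = length as" by (cases zs) auto
  have z: "z ^ 4 = 1" "z \<noteq> 0" using Cons.prems zs by (auto simp: power_0_left)
  have "valid_word (word_of as (twist_head z zs')) \<and> length (word_of as (twist_head z zs')) = sum_list as"
    using Cons zs z set_twist_head[OF z(1), of zs'] by (intro Cons.IH) (auto simp: composition_def)
  moreover have "a \<ge> 1" using Cons.prems by (auto simp: composition_def)
  moreover have "1 / z \<in> mz_letters" using z by (simp add: mz_letters_def power_divide)
  ultimately show ?case
    using zs z by (auto simp: valid_word_def mz_letters_def)
qed (auto simp: valid_word_def)

lemma hd_word_of:
  "length zs = length as \<Longrightarrow> composition as \<Longrightarrow> \<forall>z\<in>set zs. z ^ 4 = 1 \<Longrightarrow> as \<noteq> [] \<Longrightarrow>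
     hd (word_of as zs) = 1 \<longleftrightarrow> (hd as, hd zs) = (1, 1)"
proof (cases as)
  case (Cons a as')
  assume "length zs = length as" "composition as" "\<forall>z\<in>set zs. z ^ 4 = 1"
  with Cons obtain z zs' where "zs = z # zs'" "a \<ge> 1" "z ^ 4 = 1"
    by (cases zs) (auto simp: composition_def)
  then show ?thesis using Cons by (cases "a = 1") (auto simp: hd_append)
qed auto

text \<open>Read from the front, a letter 0 raises the first exponent, and a nonzero letter opens a
  new entry with exponent 1. Since valid words do not end in 0, there is always an entry to
  raise.\<close>

lemma valid_word_imp_word_of:
  "valid_word w \<Longrightarrow> \<exists>as zs. word_of as zs = w \<and> length zs = length as \<and> composition as \<and> (\<forall>z\<in>set zs. z ^ 4 = 1)"
proof (induction w)
  case Nil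
  show ?case by (intro exI[of _ "[]"]) (simp add: composition_def)
next
  case (Cons b w)
  then have "valid_word w" "b \<in> mz_letters" by (auto simp: valid_word_Cons)
  with Cons.IH obtain as zs where IH: "word_of as zs = w" "length zs = length as" "composition as"
    "\<forall>z\<in>set zs. z ^ 4 = 1" by blast
  show ?case
  proof (cases "b = 0")
    case True
    with Cons.prems have "w \<noteq> []" by (auto simp: valid_word_Cons)
    with IH obtain a as' where as: "as = a # as'" by (cases as) auto
    with IH have "a \<ge> 1" by (auto simp: composition_def)
    then obtain k where "a = Suc k" by (cases a) auto
    with as IH True show ?thesis
      by (intro exI[of _ "Suc a # as'"] exI[of _ zs]) (auto simp: composition_def)
  next
    case False
    then have b: "b ^ 4 = 1" using \<open>b \<in> mz_letters\<close> by (simp add: mz_letters_def)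
    have "\<forall>z\<in>set (twist_head b zs). z ^ 4 = 1" using IH b by (intro set_twist_head) auto
    \<comment> \<open>The new argument \<open>1 / b\<close> will twist the next one by
      \<open>1 / b\<close>; twisting the old head by \<open>b\<close> beforehand undoes
      this.\<close>
    with b False IH show ?thesis
      by (intro exI[of _ "1 # as"] exI[of _ "1 / b # twist_head b zs"])
         (auto simp: composition_def twist_head_twist_head power_divide)
  qed
qed

lemma cmzv_eq_word_val:
  assumes "admissible4 as zs"
  shows "admissible_word (word_of as zs)" "length (word_of as zs) = sum_list as" "cmzv as zs = word_val (word_of as zs)"
proof -
  have *: "length zs = length as" "composition as" "\<forall>z\<in>set zs. z ^ 4 = 1"
    using assms by (auto simp: admissible4_def)
  show a: "admissible_word (word_of as zs)"
    using word_of_valid_word[OF *] hd_word_of[OF *] assms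
    by (cases "as = []") (auto simp: admissible_word_def admissible4_def)
  show "length (word_of as zs) = sum_list as" using word_of_valid_word[OF *] by simp
  have "(\<lambda>N. \<Sum>n\<le>N. word_coeff (word_of as zs) n) \<longlonglongrightarrow> word_val (word_of as zs)"
    using admissible_word_summable[OF a] unfolding word_val_def by (rule summable_LIMSEQ')
  then show "cmzv as zs = word_val (word_of as zs)"
    using * by (simp add: cmzv_def cmzv_partial_eq word_coeff_word_of limI)
qed

text \<open>From here on the span is handled through words alone, with length in the role of weight.
  The condition on the first pair of a colored value becomes the condition that the word does not
  start with 1.\<close>

lemma CMZV4_eq: "CMZV4 n = rat_complex.span {word_val w | w. admissible_word w \<and> length w = n}"
proof -
  have "{cmzv as zs | as zs. admissible4 as zs \<and> sum_list as = n} = {word_val w | w. admissible_word w \<and> length w = n}"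
  proof (intro equalityI subsetI)
    fix x assume "x \<in> {word_val w | w. admissible_word w \<and> length w = n}"
    then obtain w where w: "x = word_val w" "admissible_word w" "length w = n" by blast
    then have "valid_word w" by (simp add: admissible_word_def)
    then obtain as zs where as: "word_of as zs = w" "length zs = length as" "composition as"
      "\<forall>z\<in>set zs. z ^ 4 = 1" using valid_word_imp_word_of by blast
    have "as \<noteq> [] \<Longrightarrow> w \<noteq> []" using as(1) by (cases as) auto
    then have "admissible4 as zs"
      using as w hd_word_of[OF as(2-4)] by (auto simp: admissible4_def admissible_word_def)
    with cmzv_eq_word_val[OF this] as w show "x \<in> {cmzv as zs | as zs. admissible4 as zs \<and> sum_list as = n}"
      unfolding mem_Collect_eq by (intro exI[of _ as] exI[of _ zs]) auto
  next
    fix x assume "x \<in> {cmzv as zs | as zs. admissible4 as zs \<and> sum_list as = n}"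
    then show "x \<in> {word_val w | w. admissible_word w \<and> length w = n}" using cmzv_eq_word_val by blast
  qed
  then show ?thesis by (simp add: CMZV4_def)
qed

lemma CMZV4_word_val: "admissible_word w \<Longrightarrow> word_val w \<in> CMZV4 (length w)"
  unfolding CMZV4_eq by (rule rat_complex.span_base) auto

lemma CMZV4_0 [simp]: "0 \<in> CMZV4 n"
  unfolding CMZV4_def by (rule rat_complex.span_zero)

lemma CMZV4_add: "x \<in> CMZV4 n \<Longrightarrow> y \<in> CMZV4 n \<Longrightarrow> x + y \<in> CMZV4 n"
  unfolding CMZV4_def by (rule rat_complex.span_add)

lemma CMZV4_diff: "x \<in> CMZV4 n \<Longrightarrow> y \<in> CMZV4 n \<Longrightarrow> x - y \<in> CMZV4 n"
  unfolding CMZV4_def by (rule rat_complex.span_diff)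

lemma CMZV4_scale: "x \<in> CMZV4 n \<Longrightarrow> of_rat q * x \<in> CMZV4 n"
  unfolding CMZV4_def by (rule rat_complex.span_scale)

section \<open>The shuffle product\<close>

text \<open>The forms may be singular at both ends of the interval, so only derivatives inside
  \<open>(0, 1)\<close> and the limit at 0 are compared.\<close>

lemma eq_by_derivative:
  fixes f g :: "real \<Rightarrow> complex"
  assumes f: "\<And>x. 0 < x \<Longrightarrow> x < 1 \<Longrightarrow> (f has_vector_derivative D x) (at x)"
    and g: "\<And>x. 0 < x \<Longrightarrow> x < 1 \<Longrightarrow> (g has_vector_derivative D x) (at x)"
    and f0: "(f \<longlongrightarrow> 0) (at_right 0)" and g0: "(g \<longlongrightarrow> 0) (at_right 0)"
    and u: "0 < u" "u < 1"
  shows "f u = g u"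
proof -
  obtain c where c: "\<And>x. x \<in> {0<..<1} \<Longrightarrow> f x - g x = c"
  proof (rule has_vector_derivative_zero_constant[of "{0<..<1::real}" "\<lambda>x. f x - g x"])
    fix x :: real assume "x \<in> {0<..<1}"
    then have "((\<lambda>x. f x - g x) has_vector_derivative D x - D x) (at x)"
      using f g by (intro derivative_intros) auto
    then show "((\<lambda>x. f x - g x) has_vector_derivative 0) (at x within {0<..<1})"
      by (auto intro: has_vector_derivative_at_within)
  qed auto
  have "((\<lambda>x. f x - g x) \<longlongrightarrow> 0 - 0) (at_right 0)" using f0 g0 by (rule tendsto_diff)
  moreover have "\<forall>\<^sub>F x in at_right 0. f x - g x = c"
    by (rule eventually_mono[OF eventually_at_right_real[of 0 1]]) (use c in auto)
  ultimately have "((\<lambda>_. c) \<longlongrightarrow> 0) (at_right (0::real))"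
    by (subst (asm) tendsto_cong) auto
  then have "c = 0" by (subst (asm) tendsto_const_iff) auto
  with c[of u] u show ?thesis by auto
qed

text \<open>A list rather than a set, because the shuffle product counts equal words with
  multiplicity.\<close>

fun shuffle_words :: "'a list \<Rightarrow> 'a list \<Rightarrow> 'a list list" where
  "shuffle_words [] v = [v]"
| "shuffle_words (a # u) [] = [a # u]"
| "shuffle_words (a # u) (b # v) = map ((#) a) (shuffle_words u (b # v)) @ map ((#) b) (shuffle_words (a # u) v)"

lemma shuffle_words_Nil2 [simp]: "shuffle_words u [] = [u]"
  by (cases u) auto

lemma length_shuffle_words: "w \<in> set (shuffle_words u v) \<Longrightarrow> length w = length u + length v"
  by (induction u v arbitrary: w rule: shuffle_words.induct) auto

lemma set_shuffle_words: "w \<in> set (shuffle_words u v) \<Longrightarrow> set w = set u \<union> set v"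
  by (induction u v arbitrary: w rule: shuffle_words.induct) auto

lemma last_shuffle_words: "w \<in> set (shuffle_words u v) \<Longrightarrow> u \<noteq> [] \<Longrightarrow> v \<noteq> [] \<Longrightarrow> last w \<in> {last u, last v}"
proof (induction u v arbitrary: w rule: shuffle_words.induct)
  case (3 a u b v)
  from 3(3) consider x where "w = a # x" "x \<in> set (shuffle_words u (b # v))" |
     x where "w = b # x" "x \<in> set (shuffle_words (a # u) v)" by auto
  then show ?case
  proof cases
    case 1
    then have "x \<noteq> []" using length_shuffle_words[OF 1(2)] by auto
    then show ?thesis using 1 3(1)[OF 1(2)] by (cases "u = []") auto
  next
    case 2
    then have "x \<noteq> []" using length_shuffle_words[OF 2(2)] by auto
    then show ?thesis using 2 3(2)[OF 2(2)] by (cases "v = []") auto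
  qed
qed auto

lemma valid_word_shuffle_words: "w \<in> set (shuffle_words u v) \<Longrightarrow> valid_word u \<Longrightarrow> valid_word v \<Longrightarrow> valid_word w"
  using last_shuffle_words[of w u v] set_shuffle_words[of w u v] by (cases "u = [] \<or> v = []") (auto simp: valid_word_def)

lemma admissible_word_shuffle_words: "w \<in> set (shuffle_words u v) \<Longrightarrow> admissible_word u \<Longrightarrow> admissible_word v \<Longrightarrow> admissible_word w"
  using valid_word_shuffle_words[of w u v] by (cases u; cases v) (auto simp: admissible_word_def)

lemma word_fun_sum_list_deriv:
  assumes "\<forall>w\<in>set ws. valid_word (a # w)" "0 < x" "x < 1"
  shows "((\<lambda>x. \<Sum>w\<leftarrow>ws. word_fun (a # w) x) has_vector_derivative diff_form a x * (\<Sum>w\<leftarrow>ws. word_fun w x)) (at x)"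
  using assms(1)
proof (induction ws)
  case (Cons w ws)
  then show ?case using word_fun_deriv[of a w x] assms(2,3)
    by (auto simp: distrib_left intro!: has_vector_derivative_add)
qed simp

lemma word_fun_sum_list_tendsto_0:
  assumes "\<forall>w\<in>set ws. valid_word w \<and> w \<noteq> []"
  shows "((\<lambda>x. \<Sum>w\<leftarrow>ws. word_fun w x) \<longlongrightarrow> 0) (at_right 0)"
  using assms
proof (induction ws)
  case (Cons w ws)
  then show ?case using tendsto_add[OF word_fun_tendsto_0[of w] Cons.IH] by (auto simp: valid_word_mz_letters)
qed simp

text \<open>Both sides vanish at 0 and have the same derivative: the product rule strips the
  outermost form from one factor at a time, which is the case distinction on the first letter of a
  shuffle.\<close>

lemma word_fun_shuffle_words:
  "valid_word u \<Longrightarrow> valid_word v \<Longrightarrow> 0 < x \<Longrightarrow> x < 1 \<Longrightarrow> word_fun u x * word_fun v x = (\<Sum>w\<leftarrow>shuffle_words u v. word_fun w x)"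
proof (induction u v arbitrary: x rule: shuffle_words.induct)
  case (3 a u b v)
  have v: "valid_word (a # u)" "valid_word (b # v)" "valid_word u" "valid_word v"
    using 3(3,4) by (auto simp: valid_word_Cons)
  let ?D = "\<lambda>x. diff_form a x * (\<Sum>w\<leftarrow>shuffle_words u (b # v). word_fun w x) + diff_form b x * (\<Sum>w\<leftarrow>shuffle_words (a # u) v. word_fun w x)"
  have A: "valid_word (a # w)" if "w \<in> set (shuffle_words u (b # v))" for w
    using valid_word_shuffle_words[OF that v(3,2)] length_shuffle_words[OF that] v by (auto simp: valid_word_Cons)
  have B: "valid_word (b # w)" if "w \<in> set (shuffle_words (a # u) v)" for w
    using valid_word_shuffle_words[OF that v(1,4)] length_shuffle_words[OF that] v by (auto simp: valid_word_Cons)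
  show ?case
  proof (rule eq_by_derivative[where f = "\<lambda>x. word_fun (a # u) x * word_fun (b # v) x" and D = ?D])
    fix x :: real assume x: "0 < x" "x < 1"
    have "((\<lambda>x. word_fun (a # u) x * word_fun (b # v) x) has_vector_derivative
       word_fun (a # u) x * (diff_form b x * word_fun v x) + diff_form a x * word_fun u x * word_fun (b # v) x) (at x)"
      by (intro has_vector_derivative_mult word_fun_deriv v x)
    also have "word_fun (a # u) x * (diff_form b x * word_fun v x) + diff_form a x * word_fun u x * word_fun (b # v) x =
        diff_form a x * (word_fun u x * word_fun (b # v) x) + diff_form b x * (word_fun (a # u) x * word_fun v x)"
      by (simp add: algebra_simps)
    also have "\<dots> = ?D x" using 3(1)[of x] 3(2)[of x] v x by simp
    finally show "((\<lambda>x. word_fun (a # u) x * word_fun (b # v) x) has_vector_derivative ?D x) (at x)" .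
    have "((\<lambda>x. (\<Sum>w\<leftarrow>shuffle_words u (b # v). word_fun (a # w) x) + (\<Sum>w\<leftarrow>shuffle_words (a # u) v. word_fun (b # w) x))
        has_vector_derivative ?D x) (at x)"
      using A B x by (intro has_vector_derivative_add word_fun_sum_list_deriv) auto
    then show "((\<lambda>x. \<Sum>w\<leftarrow>shuffle_words (a # u) (b # v). word_fun w x) has_vector_derivative ?D x) (at x)"
      by (simp add: o_def)
  next
    have "((\<lambda>x. word_fun (a # u) x * word_fun (b # v) x) \<longlongrightarrow> 0 * 0) (at_right 0)"
      by (intro tendsto_mult word_fun_tendsto_0 valid_word_mz_letters v) auto
    then show "((\<lambda>x. word_fun (a # u) x * word_fun (b # v) x) \<longlongrightarrow> 0) (at_right 0)" by simp
    show "((\<lambda>x. \<Sum>w\<leftarrow>shuffle_words (a # u) (b # v). word_fun w x) \<longlongrightarrow> 0) (at_right 0)"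
      using A B by (intro word_fun_sum_list_tendsto_0) auto
  qed (use 3 in auto)
qed auto

lemma CMZV4_sum_list: "(\<And>x. x \<in> set xs \<Longrightarrow> f x \<in> CMZV4 n) \<Longrightarrow> (\<Sum>x\<leftarrow>xs. f x) \<in> CMZV4 n"
  by (induction xs) (auto intro: CMZV4_add)

lemma word_val_shuffle_words:
  assumes "admissible_word u" "admissible_word v"
  shows "word_val u * word_val v = (\<Sum>w\<leftarrow>shuffle_words u v. word_val w)"
proof -
  have "((\<lambda>x. word_fun u x * word_fun v x) \<longlongrightarrow> word_val u * word_val v) (at_left 1)"
    by (intro tendsto_mult word_fun_tendsto_word_val assms)
  moreover have "\<forall>\<^sub>F x in at_left 1. word_fun u x * word_fun v x = (\<Sum>w\<leftarrow>shuffle_words u v. word_fun w x)"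
    by (rule eventually_mono[OF eventually_at_left_real[of 0 1]])
       (use assms in \<open>auto simp: admissible_word_def word_fun_shuffle_words\<close>)
  ultimately have "((\<lambda>x. (\<Sum>w\<leftarrow>shuffle_words u v. word_fun w x)) \<longlongrightarrow> word_val u * word_val v) (at_left 1)"
    by (rule Lim_transform_eventually)
  moreover have "((\<lambda>x. (\<Sum>w\<leftarrow>ws. word_fun w x)) \<longlongrightarrow> (\<Sum>w\<leftarrow>ws. word_val w)) (at_left 1)" if "\<forall>w\<in>set ws. admissible_word w" for ws
    using that by (induction ws) (auto intro!: tendsto_add word_fun_tendsto_word_val)
  ultimately show ?thesis
    using admissible_word_shuffle_words assms by (intro tendsto_unique[of "at_left (1::real)"]) auto
qed

text \<open>Shuffles of two admissible words are admissible and their lengths add. The graded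
  product is needed because limits such as F(1) become coefficients in front of further
  words.\<close>

lemma CMZV4_mult:
  assumes "x \<in> CMZV4 a" "y \<in> CMZV4 b"
  shows "x * y \<in> CMZV4 (a + b)"
proof -
  let ?S = "\<lambda>n. {word_val w | w. admissible_word w \<and> length w = n}"
  have base: "word_val u * y \<in> CMZV4 (length u + b)" if u: "admissible_word u" for u
    using assms(2)[unfolded CMZV4_eq]
  proof (induction rule: rat_complex.span_induct_alt)
    case base
    then show ?case by simp
  next
    case (step c s y)
    then obtain v where v: "s = word_val v" "admissible_word v" "length v = b" by auto
    have "word_val u * word_val v \<in> CMZV4 (length u + b)"
      unfolding word_val_shuffle_words[OF u v(2)]
    proof (rule CMZV4_sum_list)
      fix w assume "w \<in> set (shuffle_words u v)"
      then show "word_val w \<in> CMZV4 (length u + b)"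
        using CMZV4_word_val[OF admissible_word_shuffle_words[OF _ u v(2)]] length_shuffle_words[of w u v] v(3) by metis
    qed
    then have "of_rat c * (word_val u * word_val v) + word_val u * y \<in> CMZV4 (length u + b)"
      by (intro CMZV4_add CMZV4_scale step)
    then show ?case using v by (simp add: algebra_simps)
  qed
  show ?thesis
    using assms(1)[unfolded CMZV4_eq]
  proof (induction rule: rat_complex.span_induct_alt)
    case base
    then show ?case by simp
  next
    case (step c s x)
    then obtain u where u: "s = word_val u" "admissible_word u" "length u = a" by auto
    have "of_rat c * (word_val u * y) + x * y \<in> CMZV4 (a + b)"
      using base[OF u(2)] u step by (intro CMZV4_add CMZV4_scale) auto
    then show ?case using u by (simp add: algebra_simps)
  qed
qed

lemma CMZV4_rat: "of_rat q \<in> CMZV4 0"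
proof -
  have "word_val [] = 1" unfolding word_val_def by (subst suminf_finite[of "{0}"]) auto
  then have "(1::complex) \<in> CMZV4 0" using CMZV4_word_val[of "[]"] by (simp add: admissible_word_def valid_word_def)
  from CMZV4_scale[OF this, of q] show ?thesis by simp
qed

section \<open>Logarithmic expansions at 1\<close>

definition neg_log :: "real \<Rightarrow> real" where
  "neg_log u = - ln (1 - u)"

text \<open>Unlike plain convergence to 0, this is preserved under multiplication by the logarithm,
  which the recursion over leading letters 1 requires.\<close>

definition rapidly_vanishing :: "(real \<Rightarrow> complex) \<Rightarrow> bool" where
  "rapidly_vanishing h \<longleftrightarrow> (\<forall>j. ((\<lambda>u. h u * of_real (neg_log u) ^ j) \<longlongrightarrow> 0) (at_left 1))"

lemma rapidly_vanishing_add: "rapidly_vanishing f \<Longrightarrow> rapidly_vanishing g \<Longrightarrow> rapidly_vanishing (\<lambda>u. f u + g u)"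
  unfolding rapidly_vanishing_def distrib_right by (auto intro: tendsto_add_zero)

lemma rapidly_vanishing_cmult: "rapidly_vanishing f \<Longrightarrow> rapidly_vanishing (\<lambda>u. c * f u)"
  unfolding rapidly_vanishing_def mult.assoc by (auto intro: tendsto_mult_right_zero)

lemma rapidly_vanishing_neg_log: "rapidly_vanishing f \<Longrightarrow> rapidly_vanishing (\<lambda>u. of_real (neg_log u) * f u)"
  unfolding rapidly_vanishing_def
proof (intro allI)
  fix j assume "\<forall>j. ((\<lambda>u. f u * of_real (neg_log u) ^ j) \<longlongrightarrow> 0) (at_left 1)"
  then have "((\<lambda>u. f u * of_real (neg_log u) ^ Suc j) \<longlongrightarrow> 0) (at_left 1)" by blast
  then show "((\<lambda>u. of_real (neg_log u) * f u * of_real (neg_log u) ^ j) \<longlongrightarrow> 0) (at_left 1)"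
    by (simp add: mult_ac)
qed

lemma rapidly_vanishing_sqrt:
  assumes "\<And>u. 1/2 \<le> u \<Longrightarrow> u < 1 \<Longrightarrow> norm (h u) \<le> C * sqrt (1 - u)"
  shows "rapidly_vanishing h"
  unfolding rapidly_vanishing_def
proof
  fix j
  show "((\<lambda>u. h u * of_real (neg_log u) ^ j) \<longlongrightarrow> 0) (at_left 1)"
  proof (rule Lim_null_comparison)
    show "((\<lambda>u. C * (sqrt (1 - u) * \<bar>neg_log u\<bar> ^ j)) \<longlongrightarrow> 0) (at_left 1)"
      unfolding neg_log_def by (rule tendsto_mult_right_zero) real_asymp
    show "\<forall>\<^sub>F u in at_left 1. norm (h u * of_real (neg_log u) ^ j) \<le> C * (sqrt (1 - u) * \<bar>neg_log u\<bar> ^ j)"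
    proof (rule eventually_mono[OF eventually_at_left_real[of "1/2" 1]])
      fix u :: real assume "u \<in> {1/2<..<1}"
      then have "norm (h u) * \<bar>neg_log u\<bar> ^ j \<le> C * sqrt (1 - u) * \<bar>neg_log u\<bar> ^ j"
        using assms[of u] by (intro mult_right_mono) auto
      then show "norm (h u * of_real (neg_log u) ^ j) \<le> C * (sqrt (1 - u) * \<bar>neg_log u\<bar> ^ j)"
        by (simp add: norm_mult norm_power mult_ac)
    qed simp
  qed
qed

text \<open>The logarithm itself is the function of the word \<open>[1]\<close> and counts as weight
  1, so the coefficient of its j-th power has weight \<open>n - j\<close>.\<close>

definition log_expansion :: "nat \<Rightarrow> (real \<Rightarrow> complex) \<Rightarrow> bool" where
  "log_expansion n f \<longleftrightarrow> (\<exists>c. (\<forall>j\<le>n. c j \<in> CMZV4 (n - j)) \<and>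
     rapidly_vanishing (\<lambda>u. f u - (\<Sum>j\<le>n. c j * of_real (neg_log u) ^ j)))"

lemma log_expansion_add:
  assumes "log_expansion n f" "log_expansion n g"
  shows "log_expansion n (\<lambda>u. f u + g u)"
proof -
  from assms obtain c d where "\<forall>j\<le>n. c j \<in> CMZV4 (n - j)" "\<forall>j\<le>n. d j \<in> CMZV4 (n - j)"
    and r: "rapidly_vanishing (\<lambda>u. f u - (\<Sum>j\<le>n. c j * of_real (neg_log u) ^ j))"
      "rapidly_vanishing (\<lambda>u. g u - (\<Sum>j\<le>n. d j * of_real (neg_log u) ^ j))"
    unfolding log_expansion_def by blast
  then show ?thesis
    unfolding log_expansion_def using rapidly_vanishing_add[OF r]
    by (intro exI[of _ "\<lambda>j. c j + d j"]) (auto intro: CMZV4_add simp: algebra_simps sum.distrib)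
qed

lemma log_expansion_cmult:
  assumes "log_expansion n f" "x \<in> CMZV4 a"
  shows "log_expansion (a + n) (\<lambda>u. x * f u)"
proof -
  from assms obtain c where c: "\<forall>j\<le>n. c j \<in> CMZV4 (n - j)"
    and r: "rapidly_vanishing (\<lambda>u. f u - (\<Sum>j\<le>n. c j * of_real (neg_log u) ^ j))"
    unfolding log_expansion_def by blast
  define d where "d j = (if j \<le> n then x * c j else 0)" for j
  have "d j \<in> CMZV4 (a + n - j)" if "j \<le> a + n" for j
    using CMZV4_mult[OF assms(2), of "c j" "n - j"] c by (auto simp: d_def)
  moreover have "(\<Sum>j\<le>a + n. d j * of_real (neg_log u) ^ j) = x * (\<Sum>j\<le>n. c j * of_real (neg_log u) ^ j)" for u
  proof -
    have "(\<Sum>j\<le>a + n. d j * of_real (neg_log u) ^ j) = (\<Sum>j\<le>n. d j * of_real (neg_log u) ^ j)"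
      by (rule sum.mono_neutral_right) (auto simp: d_def)
    then show ?thesis by (simp add: d_def sum_distrib_left mult_ac)
  qed
  ultimately show ?thesis
    unfolding log_expansion_def using rapidly_vanishing_cmult[OF r, of x]
    by (intro exI[of _ d]) (auto simp: right_diff_distrib)
qed

lemma log_expansion_rat: "log_expansion n f \<Longrightarrow> log_expansion n (\<lambda>u. of_rat q * f u)"
  using log_expansion_cmult[of n f "of_rat q" 0] CMZV4_rat[of q] by simp

lemma log_expansion_neg_log:
  assumes "log_expansion n f"
  shows "log_expansion (Suc n) (\<lambda>u. of_real (neg_log u) * f u)"
proof -
  from assms obtain c where c: "\<forall>j\<le>n. c j \<in> CMZV4 (n - j)"
    and r: "rapidly_vanishing (\<lambda>u. f u - (\<Sum>j\<le>n. c j * of_real (neg_log u) ^ j))"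
    unfolding log_expansion_def by blast
  define d where "d = case_nat 0 c"
  have "d j \<in> CMZV4 (Suc n - j)" if "j \<le> Suc n" for j
    using c that by (cases j) (auto simp: d_def)
  moreover have "(\<Sum>j\<le>Suc n. d j * of_real (neg_log u) ^ j) = of_real (neg_log u) * (\<Sum>j\<le>n. c j * of_real (neg_log u) ^ j)" for u
    by (subst sum.atMost_Suc_shift) (simp add: d_def sum_distrib_left mult_ac)
  ultimately show ?thesis
    unfolding log_expansion_def using rapidly_vanishing_neg_log[OF r]
    by (intro exI[of _ d]) (auto simp: right_diff_distrib simp del: sum.atMost_Suc)
qed

lemma log_expansion_cong:
  assumes "log_expansion n f" "\<And>u. 0 < u \<Longrightarrow> u < 1 \<Longrightarrow> f u = g u"
  shows "log_expansion n g"
proof -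
  have "rapidly_vanishing (\<lambda>u. f u - s u) \<longleftrightarrow> rapidly_vanishing (\<lambda>u. g u - s u)" for s
  proof -
    have "((\<lambda>u. (f u - s u) * of_real (neg_log u) ^ j) \<longlongrightarrow> 0) (at_left 1) \<longleftrightarrow>
        ((\<lambda>u. (g u - s u) * of_real (neg_log u) ^ j) \<longlongrightarrow> 0) (at_left 1)" for j
      by (rule tendsto_cong, rule eventually_mono[OF eventually_at_left_real[of 0 1]])
         (use assms(2) in auto)
    then show ?thesis by (simp add: rapidly_vanishing_def)
  qed
  then show ?thesis using assms(1) by (simp add: log_expansion_def)
qed

lemma log_expansion_0: "log_expansion n (\<lambda>_. 0)"
  unfolding log_expansion_def by (intro exI[of _ "\<lambda>_. 0"]) (simp add: rapidly_vanishing_def)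

lemma log_expansion_sum_list:
  "(\<And>x. x \<in> set xs \<Longrightarrow> log_expansion n (f x)) \<Longrightarrow> log_expansion n (\<lambda>u. \<Sum>x\<leftarrow>xs. f x u)"
  by (induction xs) (auto intro: log_expansion_add log_expansion_0)

lemma log_expansion_admissible_word:
  assumes "admissible_word w"
  shows "log_expansion (length w) (word_fun w)"
proof -
  obtain C where "\<And>u. 1/2 \<le> u \<Longrightarrow> u < 1 \<Longrightarrow> norm (word_fun w u - word_val w) \<le> C * sqrt (1 - u)"
    using word_fun_word_val_rate[OF assms] by blast
  then have r: "rapidly_vanishing (\<lambda>u. word_fun w u - word_val w)" by (rule rapidly_vanishing_sqrt)
  have s: "(\<Sum>j\<le>length w. (if j = 0 then word_val w else 0) * of_real (neg_log u) ^ j) = word_val w" for u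
    by (subst sum.atMost_shift) simp
  show ?thesis
    unfolding log_expansion_def using r CMZV4_word_val[OF assms]
    by (intro exI[of _ "\<lambda>j. if j = 0 then word_val w else 0"]) (auto simp: s)
qed

lemma word_fun_1: 
  assumes "0 < u" "u < 1"
  shows "word_fun [1] u = of_real (neg_log u)"
proof (rule eq_by_derivative[where f = "word_fun [1]" and g = "\<lambda>u. of_real (neg_log u)" and D = "\<lambda>x. 1 / (1 - of_real x)"])
  have v: "valid_word [1]" by (simp add: valid_word_def mz_letters_def)
  show "(word_fun [1] has_vector_derivative 1 / (1 - of_real x)) (at x)" if "0 < x" "x < 1" for x
    using word_fun_deriv[OF v that] by (simp add: diff_form_def)
  show "(word_fun [1] \<longlongrightarrow> 0) (at_right 0)"
    by (intro word_fun_tendsto_0) (auto simp: mz_letters_def)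
  show "((\<lambda>x. complex_of_real (neg_log x)) has_vector_derivative 1 / (1 - of_real x)) (at x)" if "0 < x" "x < 1" for x :: real
  proof -
    have "(neg_log has_real_derivative 1 / (1 - x)) (at x)"
      unfolding neg_log_def[abs_def] using that by (auto intro!: derivative_eq_intros)
    then have "((\<lambda>x. complex_of_real (neg_log x)) has_vector_derivative of_real (1 / (1 - x))) (at x)"
      by (rule has_vector_derivative_of_real)
    then show ?thesis by simp
  qed
  have "isCont neg_log 0" unfolding neg_log_def[abs_def] by (intro continuous_intros) auto
  then have "(neg_log \<longlongrightarrow> neg_log 0) (at_right 0)"
    unfolding isCont_def by (rule tendsto_mono[OF at_le, rotated]) simp
  then show "((\<lambda>x. complex_of_real (neg_log x)) \<longlongrightarrow> 0) (at_right 0)"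
    using tendsto_of_real by (fastforce simp: neg_log_def)
qed (use assms in auto)

text \<open>Inserting a further 1 before any of the \<open>k\<close> leading ones always produces
  the same word; the other insertions happen behind the run, inside \<open>y\<close>.\<close>

lemma sum_list_shuffle_words_1:
  fixes f :: "complex list \<Rightarrow> complex"
  shows "(\<Sum>x\<leftarrow>shuffle_words [1] (replicate k 1 @ y). f x) =
    of_nat k * f (replicate (Suc k) 1 @ y) + (\<Sum>x\<leftarrow>shuffle_words [1] y. f (replicate k 1 @ x))"
proof (induction k arbitrary: f)
  case (Suc k)
  show ?case
    using Suc.IH[of "\<lambda>x. f (1 # x)"] by (simp add: o_def algebra_simps)
qed simp

text \<open>Shuffle regularization: multiplying the function of \<open>replicate k 1 @ y\<close> by
  the logarithm gives \<open>Suc k\<close> times the wanted function plus words with only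
  \<open>k\<close> extracted ones. Solving for the wanted one is a recursion on \<open>k\<close>,
  with \<open>y\<close> arbitrary because the remaining words have longer admissible parts.\<close>

lemma log_expansion_replicate_1:
  "admissible_word y \<Longrightarrow> log_expansion (k + length y) (word_fun (replicate k 1 @ y))"
proof (induction k arbitrary: y)
  case 0
  then show ?case using log_expansion_admissible_word by simp
next
  case (Suc k)
  have v1: "valid_word [1]" by (simp add: valid_word_def mz_letters_def)
  have vr: "valid_word (replicate k 1 @ z)" if "admissible_word z" for z
    using that by (auto simp: admissible_word_def valid_word_def mz_letters_def last_append)
  \<comment> \<open>The shuffles that keep the first letter of \<open>y\<close> in front. That
    letter is not 1, so they stay admissible. The one omitted shuffle \<open>1 # y\<close> raises
    the multiplicity from \<open>k\<close> to \<open>Suc k\<close>.\<close>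
  define rest where "rest = (case y of [] \<Rightarrow> [] | a # v \<Rightarrow> map ((#) a) (shuffle_words [1] v))"
  have shuffle_words_y: "shuffle_words [1] y = (1 # y) # rest"
    by (cases y) (auto simp: rest_def)
  have rest: "admissible_word z \<and> length z = Suc (length y)" if "z \<in> set rest" for z
  proof (cases y)
    case (Cons a v)
    with that obtain x where x: "z = a # x" "x \<in> set (shuffle_words [1] v)" by (auto simp: rest_def)
    have v: "valid_word v" "a \<in> mz_letters" "a \<noteq> 1" using Suc.prems Cons by (auto simp: admissible_word_def valid_word_Cons)
    have "x \<noteq> []" using length_shuffle_words[OF x(2)] by auto
    then show ?thesis using valid_word_shuffle_words[OF x(2) v1 v(1)] length_shuffle_words[OF x(2)] x v Cons
      by (auto simp: admissible_word_def valid_word_Cons)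
  qed (use that in \<open>auto simp: rest_def\<close>)
  have eq: "of_rat (1 / of_nat (Suc k)) * (of_real (neg_log u) * word_fun (replicate k 1 @ y) u +
      of_rat (-1) * (\<Sum>z\<leftarrow>rest. word_fun (replicate k 1 @ z) u)) = word_fun (replicate (Suc k) 1 @ y) u"
    if u: "0 < u" "u < 1" for u
  proof -
    have "of_real (neg_log u) * word_fun (replicate k 1 @ y) u = (\<Sum>x\<leftarrow>shuffle_words [1] (replicate k 1 @ y). word_fun x u)"
      using word_fun_shuffle_words[OF v1 vr[OF Suc.prems] u] by (simp add: word_fun_1 u)
    also have "\<dots> = of_nat (Suc k) * word_fun (replicate (Suc k) 1 @ y) u + (\<Sum>z\<leftarrow>rest. word_fun (replicate k 1 @ z) u)"
      unfolding sum_list_shuffle_words_1 shuffle_words_y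
      by (simp add: algebra_simps replicate_app_Cons_same)
    finally show ?thesis
      by (simp add: of_rat_divide of_rat_add field_simps del: of_nat_Suc replicate.simps)
  qed
  have "log_expansion (Suc (k + length y)) (\<lambda>u. \<Sum>z\<leftarrow>rest. word_fun (replicate k 1 @ z) u)"
  proof (rule log_expansion_sum_list)
    fix z assume "z \<in> set rest"
    with rest Suc.IH[of z] show "log_expansion (Suc (k + length y)) (word_fun (replicate k 1 @ z))" by auto
  qed
  from log_expansion_rat[OF log_expansion_add[OF log_expansion_neg_log[OF Suc.IH[OF Suc.prems]] log_expansion_rat[OF this]]]
  have "log_expansion (Suc (k + length y)) (\<lambda>u. of_rat (1 / of_nat (Suc k)) *
      (of_real (neg_log u) * word_fun (replicate k 1 @ y) u + of_rat (-1) * (\<Sum>z\<leftarrow>rest. word_fun (replicate k 1 @ z) u)))" .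
  from log_expansion_cong[OF this eq] show ?case by simp
qed

lemma valid_word_decomp: "valid_word w \<Longrightarrow> \<exists>k y. w = replicate k 1 @ y \<and> admissible_word y"
proof (induction w)
  case Nil
  show ?case by (intro exI[of _ 0]) (auto simp: admissible_word_def valid_word_def)
next
  case (Cons a w)
  show ?case
  proof (cases "a = 1")
    case True
    with Cons obtain k y where "w = replicate k 1 @ y" "admissible_word y" by (auto simp: valid_word_Cons)
    with True show ?thesis by (intro exI[of _ "Suc k"] exI[of _ y]) auto
  next
    case False
    with Cons.prems show ?thesis by (intro exI[of _ 0] exI[of _ "a # w"]) (auto simp: admissible_word_def)
  qed
qed

lemma log_expansion_word_fun: "valid_word w \<Longrightarrow> log_expansion (length w) (word_fun w)"
  using valid_word_decomp[of w] log_expansion_replicate_1 by auto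

text \<open>Since the logarithm tends to infinity, dividing by its top power isolates the leading
  coefficient, which must be 0. Removing it lowers the degree until the constant term is
  left.\<close>

lemma tendsto_neg_log_poly:
  fixes c :: "nat \<Rightarrow> complex"
  assumes "((\<lambda>u. \<Sum>j\<le>n. c j * of_real (neg_log u) ^ j) \<longlongrightarrow> A) (at_left 1)"
  shows "A = c 0"
  using assms
proof (induction n)
  case 0
  then show ?case by (simp add: tendsto_const_iff)
next
  case (Suc n)
  have inv: "((\<lambda>u. complex_of_real (inverse (neg_log u))) \<longlongrightarrow> of_real 0) (at_left 1)"
    unfolding neg_log_def by (rule tendsto_of_real) real_asymp
  have nz: "\<forall>\<^sub>F u in at_left 1. neg_log u \<noteq> 0"
    by (rule eventually_mono[OF eventually_at_left_real[of 0 1]]) (auto simp: neg_log_def)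
  have "((\<lambda>u. (\<Sum>j\<le>Suc n. c j * of_real (neg_log u) ^ j) * of_real (inverse (neg_log u)) ^ Suc n
       - (\<Sum>j\<le>n. c j * of_real (inverse (neg_log u)) ^ (Suc n - j))) \<longlongrightarrow>
      A * of_real 0 ^ Suc n - (\<Sum>j\<le>n. c j * of_real 0 ^ (Suc n - j))) (at_left 1)"
    by (intro tendsto_intros Suc.prems inv)
  also have "A * of_real 0 ^ Suc n - (\<Sum>j\<le>n. c j * of_real 0 ^ (Suc n - j)) = 0"
    by (simp add: power_0_left)
  finally have "((\<lambda>u. c (Suc n)) \<longlongrightarrow> 0) (at_left (1::real))"
  proof (rule Lim_transform_eventually)
    show "\<forall>\<^sub>F u in at_left 1. (\<Sum>j\<le>Suc n. c j * of_real (neg_log u) ^ j) * of_real (inverse (neg_log u)) ^ Suc n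
       - (\<Sum>j\<le>n. c j * of_real (inverse (neg_log u)) ^ (Suc n - j)) = c (Suc n)"
      using nz
    proof eventually_elim
      case (elim u)
      define x where "x = complex_of_real (neg_log u)"
      have x: "x \<noteq> 0" "complex_of_real (inverse (neg_log u)) = inverse x" using elim by (auto simp: x_def)
      have "c j * x ^ j * inverse x ^ Suc n = c j * inverse x ^ (Suc n - j)" if "j \<le> n" for j
      proof -
        have "inverse x ^ Suc n = inverse x ^ j * inverse x ^ (Suc n - j)"
          using that by (subst power_add[symmetric]) auto
        then show ?thesis using x(1) by (simp add: power_inverse mult.assoc)
      qed
      then have "(\<Sum>j\<le>n. c j * x ^ j) * inverse x ^ Suc n = (\<Sum>j\<le>n. c j * inverse x ^ (Suc n - j))"
        unfolding sum_distrib_right by (intro sum.cong) auto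
      moreover have "x ^ Suc n * inverse x ^ Suc n = 1"
        using x(1) by (simp flip: power_mult_distrib del: power_Suc)
      ultimately show ?case unfolding x(2) x_def[symmetric] sum.atMost_Suc distrib_right mult.assoc
        by (simp del: power_Suc)
    qed
  qed
  then have "c (Suc n) = 0" by (simp add: tendsto_const_iff)
  with Suc show ?case by simp
qed

lemma log_expansion_limit:
  assumes "log_expansion n f" "(f \<longlongrightarrow> A) (at_left 1)"
  shows "A \<in> CMZV4 n"
proof -
  from assms obtain c where c: "\<forall>j\<le>n. c j \<in> CMZV4 (n - j)"
    and r: "rapidly_vanishing (\<lambda>u. f u - (\<Sum>j\<le>n. c j * of_real (neg_log u) ^ j))"
    unfolding log_expansion_def by blast
  from r[unfolded rapidly_vanishing_def, rule_format, of 0]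
  have "((\<lambda>u. f u - (\<Sum>j\<le>n. c j * of_real (neg_log u) ^ j)) \<longlongrightarrow> 0) (at_left 1)" by simp
  from tendsto_diff[OF assms(2) this] have "A = c 0" by (intro tendsto_neg_log_poly[of _ n]) simp
  with c show ?thesis by auto
qed

section \<open>Primitives and the rational parametrization\<close>

text \<open>Excluding the empty word makes these functions vanish at \<open>0\<close>, so that they can be
  integrated against \<open>du/u\<close>.\<close>

definition mzfun :: "nat \<Rightarrow> (real \<Rightarrow> complex) \<Rightarrow> bool" where
  "mzfun n f \<longleftrightarrow> (\<exists>ts. (\<forall>(c, v)\<in>set ts. valid_word v \<and> v \<noteq> [] \<and> length v \<le> n \<and> c \<in> CMZV4 (n - length v)) \<and>
     (\<forall>u. 0 < u \<longrightarrow> u < 1 \<longrightarrow> f u = (\<Sum>(c, v)\<leftarrow>ts. c * word_fun v u)))"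

text \<open>Phrased through a primitive so that a form times a constant is included as well: a
  nonzero constant does not vanish at 0 and hence is no \<open>mzfun\<close>, but its integral
  against du/(a - u) is one.\<close>

definition mzder :: "nat \<Rightarrow> (real \<Rightarrow> complex) \<Rightarrow> bool" where
  "mzder n h \<longleftrightarrow> (\<exists>f. mzfun (Suc n) f \<and>
     (\<forall>u. 0 < u \<longrightarrow> u < 1 \<longrightarrow> (f has_vector_derivative h u) (at u)))"

lemma mzfun_cong: "mzfun n f \<Longrightarrow> (\<And>u. 0 < u \<Longrightarrow> u < 1 \<Longrightarrow> f u = g u) \<Longrightarrow> mzfun n g"
  unfolding mzfun_def by (elim exE) (rule exI, auto)

lemma mzfun_add:
  assumes "mzfun n f" "mzfun n g"
  shows "mzfun n (\<lambda>u. f u + g u)"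
proof -
  from assms obtain ts us
    where "\<forall>(c, v)\<in>set ts. valid_word v \<and> v \<noteq> [] \<and> length v \<le> n \<and> c \<in> CMZV4 (n - length v)"
      "\<forall>(c, v)\<in>set us. valid_word v \<and> v \<noteq> [] \<and> length v \<le> n \<and> c \<in> CMZV4 (n - length v)"
      "\<forall>u. 0 < u \<longrightarrow> u < 1 \<longrightarrow> f u = (\<Sum>(c, v)\<leftarrow>ts. c * word_fun v u)"
      "\<forall>u. 0 < u \<longrightarrow> u < 1 \<longrightarrow> g u = (\<Sum>(c, v)\<leftarrow>us. c * word_fun v u)"
    unfolding mzfun_def by blast
  then show ?thesis unfolding mzfun_def by (intro exI[of _ "ts @ us"]) auto
qed

lemma mzfun_cmult:
  assumes "mzfun n f" "x \<in> CMZV4 a"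
  shows "mzfun (a + n) (\<lambda>u. x * f u)"
proof -
  from assms obtain ts
    where ts: "\<forall>(c, v)\<in>set ts. valid_word v \<and> v \<noteq> [] \<and> length v \<le> n \<and> c \<in> CMZV4 (n - length v)"
      "\<forall>u. 0 < u \<longrightarrow> u < 1 \<longrightarrow> f u = (\<Sum>(c, v)\<leftarrow>ts. c * word_fun v u)"
    unfolding mzfun_def by blast
  have "x * c \<in> CMZV4 (a + n - length v)" if "(c, v) \<in> set ts" for c v
    using ts(1) that CMZV4_mult[OF assms(2), of c "n - length v"] by fastforce
  then have "\<forall>(c, v)\<in>set (map (\<lambda>(c, v). (x * c, v)) ts).
      valid_word v \<and> v \<noteq> [] \<and> length v \<le> a + n \<and> c \<in> CMZV4 (a + n - length v)"
    using ts(1) by fastforce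
  moreover have "x * (\<Sum>(c, v)\<leftarrow>ts. c * word_fun v u) = (\<Sum>(c, v)\<leftarrow>map (\<lambda>(c, v). (x * c, v)) ts. c * word_fun v u)" for u
    by (simp add: sum_list_const_mult[symmetric] case_prod_unfold o_def mult.assoc)
  ultimately show ?thesis
    using ts(2) unfolding mzfun_def by (intro exI[of _ "map (\<lambda>(c, v). (x * c, v)) ts"]) auto
qed

lemma mzfun_rat: "mzfun n f \<Longrightarrow> mzfun n (\<lambda>u. of_rat q * f u)"
  using mzfun_cmult[of n f "of_rat q" 0] CMZV4_rat[of q] by simp

lemma mzfun_word_fun: "valid_word v \<Longrightarrow> v \<noteq> [] \<Longrightarrow> c \<in> CMZV4 a \<Longrightarrow> mzfun (a + length v) (\<lambda>u. c * word_fun v u)"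
  unfolding mzfun_def by (intro exI[of _ "[(c, v)]"]) auto

lemma mzfun_tendsto_0:
  assumes "mzfun n f"
  shows "(f \<longlongrightarrow> 0) (at_right 0)"
proof -
  from assms obtain ts
    where ts: "\<forall>(c, v)\<in>set ts. valid_word v \<and> v \<noteq> [] \<and> length v \<le> n \<and> c \<in> CMZV4 (n - length v)"
      "\<forall>u. 0 < u \<longrightarrow> u < 1 \<longrightarrow> f u = (\<Sum>(c, v)\<leftarrow>ts. c * word_fun v u)"
    unfolding mzfun_def by blast
  from ts(1) have "((\<lambda>u. \<Sum>(c, v)\<leftarrow>ts. c * word_fun v u) \<longlongrightarrow> 0) (at_right 0)"
  proof (induction ts)
    case (Cons t ts)
    obtain c v where t: "t = (c, v)" by force
    have "((\<lambda>u. c * word_fun v u + (\<Sum>(c, v)\<leftarrow>ts. c * word_fun v u)) \<longlongrightarrow> c * 0 + 0) (at_right 0)"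
      using Cons t by (intro tendsto_intros word_fun_tendsto_0) (auto simp: valid_word_mz_letters)
    then show ?case by (simp add: t)
  qed simp
  then show ?thesis
    by (rule Lim_transform_eventually)
       (rule eventually_mono[OF eventually_at_right_real[of 0 1]], use ts(2) in auto)
qed

text \<open>The words in the combination may diverge individually. Adding their expansions first and
  taking the limit afterwards makes the divergent parts cancel without tracking them.\<close>

lemma mzfun_limit:
  assumes "mzfun n f" "(f \<longlongrightarrow> A) (at_left 1)"
  shows "A \<in> CMZV4 n"
proof -
  from assms obtain ts
    where ts: "\<forall>(c, v)\<in>set ts. valid_word v \<and> v \<noteq> [] \<and> length v \<le> n \<and> c \<in> CMZV4 (n - length v)"
      "\<forall>u. 0 < u \<longrightarrow> u < 1 \<longrightarrow> f u = (\<Sum>(c, v)\<leftarrow>ts. c * word_fun v u)"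
    unfolding mzfun_def by blast
  have "log_expansion n (\<lambda>u. \<Sum>t\<leftarrow>ts. (\<lambda>(c, v) u. c * word_fun v u) t u)"
  proof (rule log_expansion_sum_list)
    fix t assume t: "t \<in> set ts"
    obtain c v where [simp]: "t = (c, v)" by force
    from t ts(1) have "valid_word v" "length v \<le> n" "c \<in> CMZV4 (n - length v)" by auto
    with log_expansion_cmult[OF log_expansion_word_fun[of v] this(3)]
    show "log_expansion n ((\<lambda>(c, v) u. c * word_fun v u) t)" by simp
  qed
  then have "log_expansion n f"
    by (rule log_expansion_cong) (use ts(2) in \<open>auto simp: case_prod_unfold\<close>)
  then show ?thesis using assms(2) by (rule log_expansion_limit)
qed

lemma mzder_add: "mzder n f \<Longrightarrow> mzder n g \<Longrightarrow> mzder n (\<lambda>u. f u + g u)"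
  unfolding mzder_def by (blast intro: mzfun_add has_vector_derivative_add)

lemma mzder_rat: "mzder n f \<Longrightarrow> mzder n (\<lambda>u. of_rat q * f u)"
  unfolding mzder_def by (blast intro: mzfun_rat has_vector_derivative_mult_right)

lemma mzder_uminus: "mzder n f \<Longrightarrow> mzder n (\<lambda>u. - f u)"
  using mzder_rat[of n f "-1"] by simp

lemma mzder_diff: "mzder n f \<Longrightarrow> mzder n g \<Longrightarrow> mzder n (\<lambda>u. f u - g u)"
  using mzder_add[of n f "\<lambda>u. - g u"] mzder_uminus[of n g] by simp

lemma mzder_cong: "mzder n f \<Longrightarrow> (\<And>u. 0 < u \<Longrightarrow> u < 1 \<Longrightarrow> f u = g u) \<Longrightarrow> mzder n g"
  unfolding mzder_def by metis

lemma mzder_diff_form: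
  assumes "mzfun n f" "a \<in> mz_letters"
  shows "mzder n (\<lambda>u. diff_form a u * f u)"
proof -
  from assms obtain ts
    where ts: "\<forall>(c, v)\<in>set ts. valid_word v \<and> v \<noteq> [] \<and> length v \<le> n \<and> c \<in> CMZV4 (n - length v)"
      "\<forall>u. 0 < u \<longrightarrow> u < 1 \<longrightarrow> f u = (\<Sum>(c, v)\<leftarrow>ts. c * word_fun v u)"
    unfolding mzfun_def by blast
  define us where "us = map (\<lambda>(c, v). (c, a # v)) ts"
  have "\<forall>(c, v)\<in>set us. valid_word v \<and> v \<noteq> [] \<and> length v \<le> Suc n \<and> c \<in> CMZV4 (Suc n - length v)"
    using ts(1) assms(2) by (force simp: us_def valid_word_Cons)
  then have "mzfun (Suc n) (\<lambda>u. \<Sum>(c, v)\<leftarrow>us. c * word_fun v u)"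
    unfolding mzfun_def by (intro exI[of _ us]) simp
  moreover have "((\<lambda>u. \<Sum>(c, v)\<leftarrow>us. c * word_fun v u) has_vector_derivative diff_form a u * f u) (at u)"
    if u: "0 < u" "u < 1" for u
  proof -
    from ts(1) have "((\<lambda>u. \<Sum>(c, v)\<leftarrow>ts. c * word_fun (a # v) u) has_vector_derivative
        diff_form a u * (\<Sum>(c, v)\<leftarrow>ts. c * word_fun v u)) (at u)"
    proof (induction ts)
      case (Cons t ts)
      obtain c v where t: "t = (c, v)" by force
      with Cons.prems have "valid_word (a # v)" using assms(2) by (auto simp: valid_word_Cons)
      then have "((\<lambda>u. c * word_fun (a # v) u + (\<Sum>(c, v)\<leftarrow>ts. c * word_fun (a # v) u)) has_vector_derivative
        (c * (diff_form a u * word_fun v u) + diff_form a u * (\<Sum>(c, v)\<leftarrow>ts. c * word_fun v u))) (at u)"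
        using Cons u by (intro has_vector_derivative_add has_vector_derivative_mult_right word_fun_deriv Cons.IH) auto
      then show ?case by (simp add: t algebra_simps)
    qed simp
    then show ?thesis using ts(2) u by (simp add: us_def case_prod_unfold o_def)
  qed
  ultimately show ?thesis unfolding mzder_def by blast
qed

lemma mzder_const:
  assumes "c \<in> CMZV4 n" "a \<in> mz_letters" "a \<noteq> 0"
  shows "mzder n (\<lambda>u. diff_form a u * c)"
proof -
  have v: "valid_word [a]" using assms by (simp add: valid_word_def)
  have "((\<lambda>u. c * word_fun [a] u) has_vector_derivative diff_form a u * c) (at u)" if "0 < u" "u < 1" for u
    using has_vector_derivative_mult_right[OF word_fun_deriv[OF v that], of c] by (simp add: mult.commute)
  with mzfun_word_fun[OF v _ assms(1)] show ?thesis unfolding mzder_def by auto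
qed

text \<open>The main way to establish \<open>mzfun\<close>: a concrete function is recognized by its
  derivative and its vanishing at 0.\<close>

lemma mzfun_primitive:
  assumes "mzder n h" "\<And>u. 0 < u \<Longrightarrow> u < 1 \<Longrightarrow> (f has_vector_derivative h u) (at u)"
    "(f \<longlongrightarrow> 0) (at_right 0)"
  shows "mzfun (Suc n) f"
proof -
  obtain g where g: "mzfun (Suc n) g" "\<And>u. 0 < u \<Longrightarrow> u < 1 \<Longrightarrow> (g has_vector_derivative h u) (at u)"
    using assms(1) unfolding mzder_def by blast
  show ?thesis
    by (rule mzfun_cong[OF g(1)], rule eq_by_derivative[OF g(2) assms(2) mzfun_tendsto_0[OF g(1)] assms(3)])
qed

section \<open>The substitution x = 2u/(1 + u^2) and its differential forms\<close>

definition xpar :: "real \<Rightarrow> real" where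
  "xpar u = 2 * u / (1 + u\<^sup>2)"

definition xpar' :: "real \<Rightarrow> real" where
  "xpar' u = 2 * (1 - u\<^sup>2) / (1 + u\<^sup>2)\<^sup>2"

lemma one_plus_sq_pos: "(0::real) < 1 + u\<^sup>2"
  by (simp add: add_pos_nonneg)

lemma xpar_deriv: "(xpar has_real_derivative xpar' u) (at u)"
  unfolding xpar_def[abs_def] xpar'_def using one_plus_sq_pos[of u]
  by (auto intro!: derivative_eq_intros simp: field_simps power2_eq_square)

lemma xpar_bounds:
  assumes "0 < u" "u < 1"
  shows "0 < xpar u" "xpar u < 1"
proof -
  show "0 < xpar u" using assms one_plus_sq_pos[of u] by (simp add: xpar_def)
  have "0 < (1 - u)\<^sup>2" using assms by simp
  then have "2 * u < 1 + u\<^sup>2" by (simp add: power2_eq_square algebra_simps)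
  then show "xpar u < 1" using one_plus_sq_pos[of u] by (simp add: xpar_def)
qed

lemma isCont_xpar: "isCont xpar u"
  using xpar_deriv by (rule DERIV_isCont)

lemma xpar_tendsto_0: "filterlim xpar (nhds 0) (at_right 0)"
proof -
  have "(xpar \<longlongrightarrow> xpar 0) (at_right 0)"
    using isCont_xpar[of 0] unfolding isCont_def by (rule tendsto_mono[OF at_le, rotated]) simp
  then show ?thesis by (simp add: xpar_def)
qed

lemma xpar_tendsto_1: "filterlim xpar (at_left 1) (at_left 1)"
proof -
  have "(xpar \<longlongrightarrow> xpar 1) (at_left 1)"
    using isCont_xpar[of 1] unfolding isCont_def by (rule tendsto_mono[OF at_le, rotated]) simp
  moreover have "\<forall>\<^sub>F u in at_left 1. xpar u \<in> {..<1} \<and> xpar u \<noteq> 1"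
    by (rule eventually_mono[OF eventually_at_left_real[of 0 1]]) (use xpar_bounds in fastforce)+
  ultimately show ?thesis by (auto simp: xpar_def filterlim_at elim: eventually_mono)
qed

lemma mz_letters_simps [simp]: "0 \<in> mz_letters" "1 \<in> mz_letters" "-1 \<in> mz_letters" "\<i> \<in> mz_letters" "-\<i> \<in> mz_letters"
  by (simp_all add: mz_letters_def power4_eq_xxxx)

context
  fixes u :: real
  assumes u: "0 < u" "u < 1"
begin

text \<open>The last identity is where \<open>\<i>\<close> enters: 2 du/(1 + u^2) is d theta for x =
  sin theta, and only after multiplication by \<open>\<i>\<close> is it a difference of two of the
  forms.\<close>

lemma diff_form_values:
  "diff_form 0 u = of_real (1 / u)" "diff_form 1 u = of_real (1 / (1 - u))" "diff_form (-1) u = of_real (- 1 / (1 + u))"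
  "diff_form \<i> u + diff_form (-\<i>) u = of_real (- 2 * u / (1 + u\<^sup>2))"
  "diff_form (-\<i>) u - diff_form \<i> u = \<i> * of_real (2 / (1 + u\<^sup>2))"
proof -
  have "complex_of_real (1 + u\<^sup>2) \<noteq> 0" using one_plus_sq_pos[of u] by (simp only: of_real_eq_0_iff)
  then have "1 + (complex_of_real u)\<^sup>2 \<noteq> 0" by simp
  moreover have "Im (\<i> - of_real u) \<noteq> Im 0" "Im (- \<i> - of_real u) \<noteq> Im 0" by simp_all
  then have "\<i> - of_real u \<noteq> 0" "- \<i> - of_real u \<noteq> 0" by metis+
  ultimately have nz: "\<i> - of_real u \<noteq> 0" "- \<i> - of_real u \<noteq> 0" "1 + (complex_of_real u)\<^sup>2 \<noteq> 0"
    by blast+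
  have m: "(\<i> - of_real u) * (- \<i> - of_real u) = 1 + (complex_of_real u)\<^sup>2"
    by (simp add: algebra_simps power2_eq_square)
  show "diff_form \<i> u + diff_form (-\<i>) u = of_real (- 2 * u / (1 + u\<^sup>2))"
    "diff_form (-\<i>) u - diff_form \<i> u = \<i> * of_real (2 / (1 + u\<^sup>2))"
  proof -
    have "diff_form \<i> u + diff_form (-\<i>) u = (- 2 * of_real u) / (1 + (of_real u)\<^sup>2)"
      unfolding diff_form_def using nz by (subst m[symmetric]) (simp add: divide_simps del: mult_minus_left)
    then show "diff_form \<i> u + diff_form (-\<i>) u = of_real (- 2 * u / (1 + u\<^sup>2))" by simp
    have "diff_form (-\<i>) u - diff_form \<i> u = 2 * \<i> / (1 + (of_real u)\<^sup>2)"
      unfolding diff_form_def using nz by (subst m[symmetric]) (simp add: divide_simps del: mult_minus_left)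
    then show "diff_form (-\<i>) u - diff_form \<i> u = \<i> * of_real (2 / (1 + u\<^sup>2))" by simp
  qed
  show "diff_form 0 u = of_real (1 / u)" "diff_form 1 u = of_real (1 / (1 - u))"
    by (simp_all add: diff_form_def)
  have *: "- 1 - complex_of_real u = - of_real (1 + u)" by simp
  have **: "1 / (- X) = - 1 / X" for X :: complex by simp
  show "diff_form (-1) u = of_real (- 1 / (1 + u))" unfolding diff_form_def * ** by simp
qed

text \<open>The substitution makes 1 - x^2 a perfect square, namely of (1 - u^2)/(1 + u^2). Partial
  fractions then have simple poles at 0, 1, -1, \<open>\<i>\<close> and \<open>-\<i>\<close>
  only.\<close>

lemma forms_dx:
  "of_real (xpar' u / xpar u) = diff_form 0 u + (diff_form \<i> u + diff_form (-\<i>) u)"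
  "of_real (xpar' u / (1 - (xpar u)\<^sup>2)) = diff_form 1 u - diff_form (-1) u"
  "of_real (xpar' u * xpar u / (1 - (xpar u)\<^sup>2)) = diff_form 1 u + diff_form (-1) u - (diff_form \<i> u + diff_form (-\<i>) u)"
proof -
  have p: "0 < 1 + u\<^sup>2" "1 - u \<noteq> 0" "1 + u \<noteq> 0" "u \<noteq> 0" using u one_plus_sq_pos by auto
  have x2: "1 - (xpar u)\<^sup>2 = (1 - u)\<^sup>2 * (1 + u)\<^sup>2 / (1 + u\<^sup>2)\<^sup>2"
    using p by (simp add: xpar_def power_divide field_simps) (simp add: power2_eq_square algebra_simps)
  have x': "xpar' u = 2 * (1 - u) * (1 + u) / (1 + u\<^sup>2)\<^sup>2"
    by (simp add: xpar'_def power2_eq_square algebra_simps)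
  have "xpar' u / xpar u = 1 / u + (- 2 * u / (1 + u\<^sup>2))"
  proof -
    define s where "s = 1 + u\<^sup>2"
    have s: "1 - u\<^sup>2 = s - 2 * u\<^sup>2" "s \<noteq> 0" using p by (auto simp: s_def)
    then show ?thesis
      unfolding xpar'_def xpar_def s_def[symmetric] s(1) using p(4)
      by (simp add: divide_simps) (simp add: algebra_simps power2_eq_square)
  qed
  then show "of_real (xpar' u / xpar u) = diff_form 0 u + (diff_form \<i> u + diff_form (-\<i>) u)"
    by (simp only: diff_form_values of_real_add)
  have e: "xpar' u / (1 - (xpar u)\<^sup>2) = 2 / ((1 - u) * (1 + u))"
  proof -
    have "2 * a * b / S / (a\<^sup>2 * b\<^sup>2 / S) = 2 / (a * b)" if "a \<noteq> 0" "b \<noteq> 0" "S \<noteq> 0" for a b S :: real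
      using that by (simp add: divide_simps power2_eq_square)
    from this[of "1 - u" "1 + u" "(1 + u\<^sup>2)\<^sup>2"] show ?thesis unfolding x2 x' using p by (simp only:) simp
  qed
  also have "\<dots> = 1 / (1 - u) - (- 1 / (1 + u))"
    using p by (simp add: divide_simps)
  finally show "of_real (xpar' u / (1 - (xpar u)\<^sup>2)) = diff_form 1 u - diff_form (-1) u"
    by (simp only: diff_form_values of_real_diff)
  have "xpar' u * xpar u / (1 - (xpar u)\<^sup>2) = 2 / ((1 - u) * (1 + u)) * (2 * u / (1 + u\<^sup>2))"
    by (subst e[symmetric]) (simp add: xpar_def)
  also have "\<dots> = 1 / (1 - u) + (- 1 / (1 + u)) - (- 2 * u / (1 + u\<^sup>2))"
    using p by (simp add: divide_simps) (simp add: power2_eq_square algebra_simps)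
  finally show "of_real (xpar' u * xpar u / (1 - (xpar u)\<^sup>2)) =
     diff_form 1 u + diff_form (-1) u - (diff_form \<i> u + diff_form (-\<i>) u)"
    by (simp only: diff_form_values of_real_add of_real_diff)
qed

end

section \<open>Even and odd power series in the parametrization\<close>

definition pow_series :: "(nat \<Rightarrow> real) \<Rightarrow> real \<Rightarrow> real" where
  "pow_series c y = (\<Sum>n. c n * y ^ n)"

definition even_series :: "(nat \<Rightarrow> real) \<Rightarrow> real \<Rightarrow> real" where
  "even_series c x = pow_series c (x\<^sup>2)"

definition odd_series :: "(nat \<Rightarrow> real) \<Rightarrow> real \<Rightarrow> real" where
  "odd_series c x = x * pow_series c (x\<^sup>2)"

lemma pow_series_sums:
  assumes "\<And>n. \<bar>c n\<bar> \<le> B" "\<bar>y\<bar> < 1"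
  shows "(\<lambda>n. c n * y ^ n) sums pow_series c y"
  unfolding pow_series_def by (intro summable_sums summable_bounded_powser[of _ B]) (use assms in auto)

lemma pow_series_deriv:
  assumes c: "\<And>n. \<bar>c n\<bar> \<le> B" and y: "\<bar>y\<bar> < 1"
  obtains D where "(pow_series c has_real_derivative D) (at y)"
    "(\<lambda>n. (real n + 1) * c (Suc n) * y ^ n) sums D" "(\<lambda>n. real n * c n * y ^ n) sums (y * D)"
proof -
  have s: "summable (\<lambda>n. c n * z ^ n)" if "norm z < 1" for z
    using pow_series_sums[OF c, of z] that by (auto simp: sums_iff)
  define D where "D = (\<Sum>n. diffs c n * y ^ n)"
  have d: "(pow_series c has_real_derivative D) (at y)"
    unfolding pow_series_def[abs_def] D_def by (rule termdiffs_strong'[of 1]) (use s y in auto)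
  have sd: "summable (\<lambda>n. diffs c n * y ^ n)"
    by (rule termdiff_converges[of y 1]) (use s y in auto)
  then have sD: "(\<lambda>n. diffs c n * y ^ n) sums D" unfolding D_def by (rule summable_sums)
  then have 1: "(\<lambda>n. (real n + 1) * c (Suc n) * y ^ n) sums D"
    by (simp add: diffs_def add.commute)
  have "(\<lambda>n. real n * c n * y ^ n) sums (y * D + 0)"
    using sums_mult[OF sD, of y] sums_Suc[of "\<lambda>n. real n * c n * y ^ n" "y * D"]
    by (simp add: diffs_def mult_ac)
  with d 1 that show ?thesis by simp
qed

lemma abs_sq_less_1: "\<bar>x\<bar> < 1 \<Longrightarrow> \<bar>x\<^sup>2\<bar> < (1::real)"
  by (metis abs_power2 abs_square_less_1)

lemma even_series_deriv:
  assumes "\<And>n. \<bar>c n\<bar> \<le> B" "\<bar>x\<bar> < 1"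
  obtains D where "(even_series c has_real_derivative 2 * x * D) (at x)"
    "(\<lambda>n. (real n + 1) * c (Suc n) * (x\<^sup>2) ^ n) sums D" "(\<lambda>n. real n * c n * (x\<^sup>2) ^ n) sums (x\<^sup>2 * D)"
proof -
  obtain D where D: "(pow_series c has_real_derivative D) (at (x\<^sup>2))"
    "(\<lambda>n. (real n + 1) * c (Suc n) * (x\<^sup>2) ^ n) sums D" "(\<lambda>n. real n * c n * (x\<^sup>2) ^ n) sums (x\<^sup>2 * D)"
    by (rule pow_series_deriv[OF assms(1) abs_sq_less_1[OF assms(2)]])
  have "(even_series c has_real_derivative D * (2 * x)) (at x)"
    unfolding even_series_def[abs_def] by (rule DERIV_chain2[where f = "pow_series c" and g = "\<lambda>x. x\<^sup>2", OF D(1)]) (auto intro!: derivative_eq_intros)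
  then have "(even_series c has_real_derivative 2 * x * D) (at x)" by (simp add: mult_ac)
  from this D(2,3) show ?thesis by (rule that)
qed

lemma odd_series_deriv:
  assumes "\<And>n. \<bar>c n\<bar> \<le> B" "\<bar>x\<bar> < 1"
  obtains D where "(odd_series c has_real_derivative pow_series c (x\<^sup>2) + 2 * x\<^sup>2 * D) (at x)"
    "(\<lambda>n. (real n + 1) * c (Suc n) * (x\<^sup>2) ^ n) sums D" "(\<lambda>n. real n * c n * (x\<^sup>2) ^ n) sums (x\<^sup>2 * D)"
proof -
  obtain D where D: "(even_series c has_real_derivative 2 * x * D) (at x)"
    "(\<lambda>n. (real n + 1) * c (Suc n) * (x\<^sup>2) ^ n) sums D" "(\<lambda>n. real n * c n * (x\<^sup>2) ^ n) sums (x\<^sup>2 * D)"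
    by (rule even_series_deriv[OF assms])
  have "((\<lambda>x. x * even_series c x) has_real_derivative 1 * even_series c x + x * (2 * x * D)) (at x)"
    by (rule derivative_eq_intros D(1) refl)+ simp
  also have "(\<lambda>x. x * even_series c x) = odd_series c" by (simp add: odd_series_def[abs_def] even_series_def)
  finally have "(odd_series c has_real_derivative pow_series c (x\<^sup>2) + 2 * x\<^sup>2 * D) (at x)"
    by (simp add: even_series_def power2_eq_square mult_ac)
  from this D(2,3) show ?thesis by (rule that)
qed

text \<open>The alternative \<open>d n = 0\<close> admits the denominator \<open>real n\<close> at n
  = 0, where the quotient is 0 by convention.\<close>

lemma bounded_divide:
  assumes "\<And>n. \<bar>c n\<bar> \<le> B" "\<And>n. d n = 0 \<or> d n \<ge> 1"
  shows "\<bar>c n / d n\<bar> \<le> (B::real)"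
proof -
  have "\<bar>c n\<bar> / \<bar>d n\<bar> \<le> \<bar>c n\<bar>"
    using assms(2)[of n] by (auto simp: divide_le_eq mult_left_mono[of 1 "d n" "\<bar>c n\<bar>", simplified])
  with assms(1)[of n] show ?thesis by simp
qed

text \<open>The operator x d/dx multiplies x^(2n+1) by 2n+1. On odd series, dividing the
  coefficients by 2n+1 is therefore integration against dx/x.\<close>

lemma odd_series_integral_deriv:
  assumes "\<And>n. \<bar>c n\<bar> \<le> B" "\<bar>x\<bar> < 1"
  shows "(odd_series (\<lambda>n. c n / (2 * real n + 1)) has_real_derivative even_series c x) (at x)"
proof -
  let ?c = "\<lambda>n. c n / (2 * real n + 1)"
  have b: "\<bar>?c n\<bar> \<le> B" for n by (rule bounded_divide[OF assms(1)]) auto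
  obtain D where D: "(odd_series ?c has_real_derivative pow_series ?c (x\<^sup>2) + 2 * x\<^sup>2 * D) (at x)"
    "(\<lambda>n. (real n + 1) * ?c (Suc n) * (x\<^sup>2) ^ n) sums D"
    "(\<lambda>n. real n * ?c n * (x\<^sup>2) ^ n) sums (x\<^sup>2 * D)"
    by (rule odd_series_deriv[of ?c B x, OF b assms(2)])
  have "(\<lambda>n. ?c n * (x\<^sup>2) ^ n + 2 * (real n * ?c n * (x\<^sup>2) ^ n)) sums (pow_series ?c (x\<^sup>2) + 2 * (x\<^sup>2 * D))"
    by (intro sums_add sums_mult D(3) pow_series_sums[of _ B] b abs_sq_less_1 assms)
  moreover have "?c n * (x\<^sup>2) ^ n + 2 * (real n * ?c n * (x\<^sup>2) ^ n) = c n * (x\<^sup>2) ^ n" for n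
  proof -
    have "?c n * (x\<^sup>2) ^ n + 2 * (real n * ?c n * (x\<^sup>2) ^ n) = ?c n * (2 * real n + 1) * (x\<^sup>2) ^ n"
      by (simp only: algebra_simps)
    moreover have "2 * real n + 1 \<noteq> 0" by (simp add: add_nonneg_eq_0_iff)
    ultimately show ?thesis by simp
  qed
  ultimately have "even_series c x = pow_series ?c (x\<^sup>2) + 2 * (x\<^sup>2 * D)"
    by (simp add: sums_iff even_series_def pow_series_def)
  with D(1) show ?thesis by (simp add: mult_ac)
qed

text \<open>Here x d/dx multiplies x^(2n) by 2n, hence the factor 2. The condition
  \<open>c 0 = 0\<close> removes the term that dx/x cannot integrate.\<close>

lemma even_series_integral_deriv:
  assumes "\<And>n. \<bar>c n\<bar> \<le> B" "c 0 = 0" "\<bar>x\<bar> < 1" "x \<noteq> 0"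
  shows "(even_series (\<lambda>n. c n / real n) has_real_derivative 2 * (even_series c x / x)) (at x)"
proof -
  let ?c = "\<lambda>n. c n / real n"
  have b: "\<bar>?c n\<bar> \<le> B" for n by (rule bounded_divide[OF assms(1)]) auto
  obtain D where D: "(even_series ?c has_real_derivative 2 * x * D) (at x)"
    "(\<lambda>n. (real n + 1) * ?c (Suc n) * (x\<^sup>2) ^ n) sums D"
    "(\<lambda>n. real n * ?c n * (x\<^sup>2) ^ n) sums (x\<^sup>2 * D)"
    by (rule even_series_deriv[of ?c B x, OF b assms(3)])
  have "real n * ?c n = c n" for n using assms(2) by (cases "n = 0") auto
  with D(3) have "even_series c x = x\<^sup>2 * D" by (simp add: sums_iff even_series_def pow_series_def)
  with D(1) assms(4) show ?thesis by (simp add: power2_eq_square mult_ac)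
qed

lemma compose_xpar:
  assumes "(f has_real_derivative D) (at (xpar u))"
  shows "((\<lambda>u. k * complex_of_real (f (xpar u))) has_vector_derivative k * of_real (D * xpar' u)) (at u)"
proof -
  have "((\<lambda>u. f (xpar u)) has_real_derivative D * xpar' u) (at u)"
    using assms xpar_deriv by (rule DERIV_chain2)
  then have "((\<lambda>u. complex_of_real (f (xpar u))) has_vector_derivative of_real (D * xpar' u)) (at u)"
    by (rule has_vector_derivative_of_real)
  then show ?thesis by (rule has_vector_derivative_mult_right)
qed

lemma compose_xpar_tendsto:
  assumes "isCont f 0" "f 0 = 0"
  shows "((\<lambda>u. k * complex_of_real (f (xpar u))) \<longlongrightarrow> 0) (at_right 0)"
proof -
  have "(f \<longlongrightarrow> 0) (nhds 0)" using assms by (simp add: isCont_def tendsto_nhds_iff)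
  from filterlim_compose[OF this xpar_tendsto_0]
  have "((\<lambda>u. k * complex_of_real (f (xpar u))) \<longlongrightarrow> k * of_real 0) (at_right 0)"
    by (intro tendsto_intros)
  then show ?thesis by simp
qed

lemma odd_series_cont_0:
  assumes "\<And>n. \<bar>c n\<bar> \<le> B"
  shows "isCont (odd_series c) 0" "odd_series c 0 = 0"
proof -
  obtain D where "(odd_series c has_real_derivative pow_series c (0\<^sup>2) + 2 * 0\<^sup>2 * D) (at 0)"
    by (rule odd_series_deriv[of c B 0]) (use assms in auto)
  then show "isCont (odd_series c) 0" by (rule DERIV_isCont)
qed (simp add: odd_series_def)

lemma even_series_cont_0:
  assumes "\<And>n. \<bar>c n\<bar> \<le> B"
  shows "isCont (even_series c) 0" "even_series c 0 = c 0"
proof -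
  obtain D where "(even_series c has_real_derivative 2 * 0 * D) (at 0)"
    by (rule even_series_deriv[of c B 0]) (use assms in auto)
  then show "isCont (even_series c) 0" by (rule DERIV_isCont)
qed (simp add: even_series_def pow_series_def)

lemma xpar_abs: "0 < u \<Longrightarrow> u < 1 \<Longrightarrow> \<bar>xpar u\<bar> < 1"
  using xpar_bounds[of u] by simp

lemma mzder_dx_over_x:
  assumes "mzfun n f"
  shows "mzder n (\<lambda>u. of_real (xpar' u / xpar u) * f u)"
proof -
  have "mzder n (\<lambda>u. diff_form 0 u * f u + (diff_form \<i> u * f u + diff_form (-\<i>) u * f u))"
    by (intro mzder_add mzder_diff_form assms) auto
  then show ?thesis by (rule mzder_cong) (simp only: forms_dx distrib_right)
qed

lemma mzder_comp_dx_over_x: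
  assumes "mzfun n (\<lambda>u. k * complex_of_real (f (xpar u)))"
  shows "mzder n (\<lambda>u. k * of_real (f (xpar u) / xpar u * xpar' u))"
  by (rule mzder_cong[OF mzder_dx_over_x[OF assms]]) simp

lemma mzfun_odd_series_integral:
  assumes b: "\<And>n. \<bar>c n\<bar> \<le> B" and m: "mzfun n (\<lambda>u. k * complex_of_real (odd_series c (xpar u)))"
  shows "mzfun (Suc n) (\<lambda>u. k * complex_of_real (odd_series (\<lambda>n. c n / (2 * real n + 1)) (xpar u)))"
proof (rule mzfun_primitive[OF mzder_comp_dx_over_x[OF m]])
  fix u :: real assume u: "0 < u" "u < 1"
  have "odd_series c (xpar u) / xpar u = even_series c (xpar u)"
    using xpar_bounds[OF u] by (simp add: odd_series_def even_series_def)
  with compose_xpar[OF odd_series_integral_deriv[OF b xpar_abs[OF u]], of k]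
  show "((\<lambda>u. k * complex_of_real (odd_series (\<lambda>n. c n / (2 * real n + 1)) (xpar u))) has_vector_derivative
      k * of_real (odd_series c (xpar u) / xpar u * xpar' u)) (at u)" by simp
next
  have "\<bar>c n / (2 * real n + 1)\<bar> \<le> B" for n by (rule bounded_divide[OF b]) auto
  from odd_series_cont_0[OF this]
  show "((\<lambda>u. k * complex_of_real (odd_series (\<lambda>n. c n / (2 * real n + 1)) (xpar u))) \<longlongrightarrow> 0) (at_right 0)"
    by (intro compose_xpar_tendsto)
qed

lemma mzfun_even_series_integral:
  assumes b: "\<And>n. \<bar>c n\<bar> \<le> B" and c0: "c 0 = 0"
    and m: "mzfun n (\<lambda>u. k * complex_of_real (even_series c (xpar u)))"
  shows "mzfun (Suc n) (\<lambda>u. k * complex_of_real (even_series (\<lambda>n. c n / real n) (xpar u)))"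
proof (rule mzfun_primitive[OF mzder_rat[where q = 2, OF mzder_comp_dx_over_x[OF m]]])
  fix u :: real assume u: "0 < u" "u < 1"
  have "xpar u \<noteq> 0" using xpar_bounds[OF u] by simp
  from compose_xpar[OF even_series_integral_deriv[of c B "xpar u", OF b c0 xpar_abs[OF u] this], of k]
  show "((\<lambda>u. k * complex_of_real (even_series (\<lambda>n. c n / real n) (xpar u))) has_vector_derivative
      of_rat 2 * (k * of_real (even_series c (xpar u) / xpar u * xpar' u))) (at u)"
    by (simp add: mult_ac)
next
  have "\<bar>c n / real n\<bar> \<le> B" for n by (rule bounded_divide[OF b]) auto
  from even_series_cont_0[OF this] c0
  show "((\<lambda>u. k * complex_of_real (even_series (\<lambda>n. c n / real n) (xpar u))) \<longlongrightarrow> 0) (at_right 0)"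
    by (intro compose_xpar_tendsto) auto
qed

text \<open>This is \<open>sqrt (1 - x\<^sup>2)\<close> at \<open>x = xpar u\<close>, made rational
  by the parametrization.\<close>

definition qpar :: "real \<Rightarrow> real" where
  "qpar u = (1 - u\<^sup>2) / (1 + u\<^sup>2)"

lemma qpar_deriv: "(qpar has_real_derivative - xpar u * (2 / (1 + u\<^sup>2))) (at u)"
  unfolding qpar_def[abs_def] xpar_def using one_plus_sq_pos[of u]
  by (auto intro!: derivative_eq_intros simp: field_simps power2_eq_square)

lemma qpar_xpar:
  "(qpar u)\<^sup>2 = 1 - (xpar u)\<^sup>2" "xpar' u = qpar u * (2 / (1 + u\<^sup>2))"
  using one_plus_sq_pos[of u]
  by (simp_all add: qpar_def xpar_def xpar'_def power_divide field_simps)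
     (simp_all add: power2_eq_square power4_eq_xxxx algebra_simps)

text \<open>With \<open>x = sin \<theta>\<close>, this is \<open>d/d\<theta> (sqrt(1 - x\<^sup>2) e(x)) = (1 - x\<^sup>2) e'(x) - x e(x)\<close>.\<close>

lemma qpar_mult_deriv:
  assumes "(e has_real_derivative e') (at (xpar u))"
  shows "((\<lambda>u. qpar u * e (xpar u)) has_real_derivative
     2 / (1 + u\<^sup>2) * ((1 - (xpar u)\<^sup>2) * e' - xpar u * e (xpar u))) (at u)"
proof -
  have "((\<lambda>u. e (xpar u)) has_real_derivative e' * xpar' u) (at u)"
    using assms xpar_deriv by (rule DERIV_chain2)
  from DERIV_mult[OF qpar_deriv this]
  have "((\<lambda>u. qpar u * e (xpar u)) has_real_derivative
     - xpar u * (2 / (1 + u\<^sup>2)) * e (xpar u) + e' * xpar' u * qpar u) (at u)" .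
  moreover have "e' * xpar' u * qpar u = e' * (qpar u)\<^sup>2 * (2 / (1 + u\<^sup>2))"
    by (simp add: qpar_xpar(2) power2_eq_square)
  moreover have "- x * t * a + b * (1 - x\<^sup>2) * t = t * ((1 - x\<^sup>2) * b - x * a)" for x t a b :: real
    by (simp add: algebra_simps)
  ultimately show ?thesis by (simp only: qpar_xpar(1))
qed

text \<open>For \<open>d n\<close> equal to \<open>central_binom n\<close> times some s_n, the new
  coefficients are \<open>(2 * real n + 1) * central_binom n\<close> times s_(n+1) - s_n, so one
  entry of a nested sum is removed.\<close>

lemma even_series_qpar_deriv:
  assumes b: "\<And>n. \<bar>d n\<bar> \<le> B" and u: "0 < u" "u < 1"
  shows "((\<lambda>u. qpar u * even_series d (xpar u)) has_real_derivative
     2 / (1 + u\<^sup>2) * odd_series (\<lambda>n. 2 * (real n + 1) * d (Suc n) - (2 * real n + 1) * d n) (xpar u)) (at u)"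
proof -
  define x where "x = xpar u"
  have x: "\<bar>x\<bar> < 1" using xpar_abs[OF u] by (simp add: x_def)
  obtain D where D: "(even_series d has_real_derivative 2 * x * D) (at x)"
    "(\<lambda>n. (real n + 1) * d (Suc n) * (x\<^sup>2) ^ n) sums D" "(\<lambda>n. real n * d n * (x\<^sup>2) ^ n) sums (x\<^sup>2 * D)"
    by (rule even_series_deriv[OF b x])
  have "(\<lambda>n. 2 * ((real n + 1) * d (Suc n) * (x\<^sup>2) ^ n) - 2 * (real n * d n * (x\<^sup>2) ^ n) - d n * (x\<^sup>2) ^ n)
      sums (2 * D - 2 * (x\<^sup>2 * D) - pow_series d (x\<^sup>2))"
    by (intro sums_diff sums_mult D pow_series_sums[of _ B] b abs_sq_less_1 x)
  also have "(\<lambda>n. 2 * ((real n + 1) * d (Suc n) * (x\<^sup>2) ^ n) - 2 * (real n * d n * (x\<^sup>2) ^ n) - d n * (x\<^sup>2) ^ n)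
      = (\<lambda>n. (2 * (real n + 1) * d (Suc n) - (2 * real n + 1) * d n) * (x\<^sup>2) ^ n)"
    by (intro ext) (simp add: algebra_simps)
  finally have "odd_series (\<lambda>n. 2 * (real n + 1) * d (Suc n) - (2 * real n + 1) * d n) x
      = x * (2 * D - 2 * (x\<^sup>2 * D) - pow_series d (x\<^sup>2))"
    unfolding odd_series_def pow_series_def[of "\<lambda>n. 2 * (real n + 1) * d (Suc n) - (2 * real n + 1) * d n"]
    by (simp only: sums_unique[symmetric])
  also have "\<dots> = (1 - x\<^sup>2) * (2 * x * D) - x * even_series d x"
    by (simp add: even_series_def algebra_simps)
  finally show ?thesis using qpar_mult_deriv[OF D(1)[unfolded x_def]] by (simp only: x_def)
qed

text \<open>The odd counterpart, suited to coefficients with \<open>central_binom\<close> in the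
  denominator. At n = 0 the value \<open>g (n - 1)\<close> is \<open>g 0\<close>, but its factor
  \<open>2 * real n\<close> is 0.\<close>

lemma odd_series_qpar_deriv:
  assumes b: "\<And>n. \<bar>g n\<bar> \<le> B" and u: "0 < u" "u < 1"
  shows "((\<lambda>u. qpar u * odd_series g (xpar u)) has_real_derivative
     2 / (1 + u\<^sup>2) * even_series (\<lambda>n. (2 * real n + 1) * g n - 2 * real n * g (n - 1)) (xpar u)) (at u)"
proof -
  define x where "x = xpar u"
  have x: "\<bar>x\<bar> < 1" using xpar_abs[OF u] by (simp add: x_def)
  obtain D where D: "(odd_series g has_real_derivative pow_series g (x\<^sup>2) + 2 * x\<^sup>2 * D) (at x)"
    "(\<lambda>n. (real n + 1) * g (Suc n) * (x\<^sup>2) ^ n) sums D"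
    "(\<lambda>n. real n * g n * (x\<^sup>2) ^ n) sums (x\<^sup>2 * D)"
    by (rule odd_series_deriv[OF b x])
  have G: "(\<lambda>n. g n * (x\<^sup>2) ^ n) sums pow_series g (x\<^sup>2)"
    by (intro pow_series_sums[of _ B] b abs_sq_less_1 x)
  have 1: "(\<lambda>n. 2 * (real n * g n * (x\<^sup>2) ^ n) + g n * (x\<^sup>2) ^ n) sums (2 * (x\<^sup>2 * D) + pow_series g (x\<^sup>2))"
    by (intro sums_add sums_mult D(3) G)
  have "(\<lambda>n. x\<^sup>2 * (2 * (real n * g n * (x\<^sup>2) ^ n) + 2 * (g n * (x\<^sup>2) ^ n))) sums
      (x\<^sup>2 * (2 * (x\<^sup>2 * D) + 2 * pow_series g (x\<^sup>2)))"
    by (intro sums_add sums_mult D(3) G)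
  then have "(\<lambda>n. 2 * real n * g (n - 1) * (x\<^sup>2) ^ n) sums (x\<^sup>2 * (2 * (x\<^sup>2 * D) + 2 * pow_series g (x\<^sup>2)) + 0)"
    using sums_Suc[of "\<lambda>n. 2 * real n * g (n - 1) * (x\<^sup>2) ^ n"] by (simp add: algebra_simps)
  from sums_diff[OF 1 this]
  have "even_series (\<lambda>n. (2 * real n + 1) * g n - 2 * real n * g (n - 1)) x
      = 2 * (x\<^sup>2 * D) + pow_series g (x\<^sup>2) - (x\<^sup>2 * (2 * (x\<^sup>2 * D) + 2 * pow_series g (x\<^sup>2)) + 0)"
    by (simp add: sums_iff even_series_def pow_series_def algebra_simps)
  also have "\<dots> = (1 - x\<^sup>2) * (pow_series g (x\<^sup>2) + 2 * x\<^sup>2 * D) - x * odd_series g x"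
    by (simp add: odd_series_def algebra_simps power2_eq_square)
  finally show ?thesis using qpar_mult_deriv[OF D(1)[unfolded x_def]] by (simp only: x_def)
qed

section \<open>Powers of the arcsine\<close>

lemma zeta_sum_nonneg: "0 \<le> zeta_sum n ks"
  unfolding zeta_sum_def by (intro sum_nonneg prod_nonneg) auto

lemma decreasing_tuples_nth_ge_1:
  "ns \<in> decreasing_tuples s n \<Longrightarrow> j < s \<Longrightarrow> 1 \<le> ns ! j"
  "ns \<in> weakly_decreasing_tuples s n \<Longrightarrow> j < s \<Longrightarrow> 1 \<le> ns ! j"
  using nth_mem[of j ns] by (force simp: decreasing_tuples_def weakly_decreasing_tuples_def)+

lemma t_sum_nonneg: "0 \<le> t_sum n ks"
  unfolding t_sum_def
  by (intro sum_nonneg prod_nonneg ballI) (use decreasing_tuples_nth_ge_1(1) in fastforce)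

lemma t_star_sum_nonneg: "0 \<le> t_star_sum n ks"
  unfolding t_star_sum_def
  by (intro sum_nonneg prod_nonneg ballI) (use decreasing_tuples_nth_ge_1(2) in fastforce)

lemma zeta_sum_Suc: "zeta_sum (Suc n) (a # r) = zeta_sum n (a # r) + zeta_sum n r / (real n + 1) ^ a"
  by (simp add: zeta_sum_Cons add.commute)

lemma t_sum_Suc: "t_sum (Suc n) (a # r) = t_sum n (a # r) + t_sum n r / (2 * real n + 1) ^ a"
  by (simp add: t_sum_Cons add.commute)

lemma zeta_sum_0_Cons: "zeta_sum 0 (a # r) = 0"
  by (simp add: zeta_sum_Cons)

lemma t_sum_0_Cons: "t_sum 0 (a # r) = 0"
  by (simp add: t_sum_Cons)

lemma sum_inverse_squares_le: "(\<Sum>k=1..n. 1 / real k ^ 2) \<le> 2"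
proof -
  have "(\<Sum>k=1..Suc n. 1 / real k ^ 2) \<le> 2 - 1 / (real n + 1)" for n
  proof (induction n)
    case (Suc n)
    have "1 / (real n + 2) ^ 2 \<le> 1 / ((real n + 1) * (real n + 2))"
      by (intro divide_left_mono) (auto simp: power2_eq_square intro!: mult_right_mono)
    also have "\<dots> = 1 / (real n + 1) - 1 / (real n + 2)"
      by (simp add: divide_simps)
    finally show ?case using Suc by (simp add: add.commute)
  qed simp
  moreover have "2 - 1 / (real n + 1) \<le> 2" for n by simp
  ultimately have "(\<Sum>k=1..Suc n. 1 / real k ^ 2) \<le> 2" for n by (rule order.trans)
  then show ?thesis by (cases n) auto
qed

lemma zeta_sum_2_le: "zeta_sum n (replicate j 2) \<le> 2 ^ j"
proof (induction j arbitrary: n)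
  case (Suc j)
  have "zeta_sum n (replicate (Suc j) 2) \<le> (\<Sum>k=1..n. 1 / real k ^ 2 * 2 ^ j)"
    unfolding replicate_Suc zeta_sum_Cons by (intro sum_mono mult_left_mono Suc.IH) auto
  also have "\<dots> = (\<Sum>k=1..n. 1 / real k ^ 2) * 2 ^ j" by (simp add: sum_distrib_right)
  also have "\<dots> \<le> 2 * 2 ^ j" by (intro mult_right_mono sum_inverse_squares_le) auto
  finally show ?case by simp
qed simp

lemma t_sum_2_le: "t_sum n (replicate j 2) \<le> 2 ^ j"
proof (induction j arbitrary: n)
  case (Suc j)
  have "t_sum n (replicate (Suc j) 2) \<le> (\<Sum>k=1..n. 1 / real k ^ 2 * 2 ^ j)"
    unfolding replicate_Suc t_sum_Cons
  proof (intro sum_mono mult_mono Suc.IH)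
    fix k assume "k \<in> {1..n}"
    then show "1 / (2 * real k - 1) ^ 2 \<le> 1 / real k ^ 2"
      by (intro divide_left_mono power_mono mult_pos_pos) auto
  qed (auto intro: t_sum_nonneg)
  also have "\<dots> = (\<Sum>k=1..n. 1 / real k ^ 2) * 2 ^ j" by (simp add: sum_distrib_right)
  also have "\<dots> \<le> 2 * 2 ^ j" by (intro mult_right_mono sum_inverse_squares_le) auto
  finally show ?case by simp
qed simp

lemma mzder_theta_eq:
  assumes "0 < u" "u < 1"
  shows "diff_form (-\<i>) u * z - diff_form \<i> u * z = \<i> * of_real (2 / (1 + u\<^sup>2)) * z"
  unfolding diff_form_values(5)[OF assms, symmetric] by (simp add: algebra_simps)

text \<open>Integration against \<open>\<i>\<close> times d theta, where theta = arcsin x. The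
  powers of the arcsine arise by iterating it.\<close>

lemma mzder_theta:
  assumes "mzfun n f"
  shows "mzder n (\<lambda>u. \<i> * of_real (2 / (1 + u\<^sup>2)) * f u)"
proof -
  have "mzder n (\<lambda>u. diff_form (-\<i>) u * f u - diff_form \<i> u * f u)"
    by (intro mzder_diff mzder_diff_form assms) auto
  then show ?thesis by (rule mzder_cong) (simp only: mzder_theta_eq)
qed

lemma mzder_theta_const: "mzder 0 (\<lambda>u. \<i> * of_real (2 / (1 + u\<^sup>2)) * 1)"
proof -
  have "1 \<in> CMZV4 0" using CMZV4_rat[of 1] by simp
  then have "mzder 0 (\<lambda>u. diff_form (-\<i>) u * 1 - diff_form \<i> u * 1)"
    by (intro mzder_diff mzder_const) auto
  then show ?thesis by (rule mzder_cong) (simp only: mzder_theta_eq)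
qed

lemma qpar_mult_tendsto:
  assumes "isCont f 0"
  shows "((\<lambda>u. qpar u * f (xpar u)) \<longlongrightarrow> f 0) (at_right 0)"
proof -
  have "isCont qpar 0" using qpar_deriv by (rule DERIV_isCont)
  then have q: "(qpar \<longlongrightarrow> qpar 0) (at_right 0)"
    unfolding isCont_def by (rule tendsto_mono[OF at_le, rotated]) simp
  have "(f \<longlongrightarrow> f 0) (nhds 0)" using assms by (simp add: isCont_def tendsto_nhds_iff)
  from filterlim_compose[OF this xpar_tendsto_0] q
  have "((\<lambda>u. qpar u * f (xpar u)) \<longlongrightarrow> qpar 0 * f 0) (at_right 0)" by (intro tendsto_mult)
  then show ?thesis by (simp add: qpar_def)
qed

text \<open>The series is theta^(2j+1)/(2j+1)! with theta = arcsin x. Each induction step integrates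
  twice in theta, which raises the weight by 2 and changes the sign through the two factors
  \<open>\<i>\<close>.\<close>

lemma mzfun_arcsin_odd:
  "mzfun (2 * j + 1) (\<lambda>u. \<i> * complex_of_real
     (odd_series (\<lambda>n. central_binom n * t_sum n (replicate j 2) / (2 * real n + 1)) (xpar u)))"
proof (induction j)
  case (0)
  \<comment> \<open>This product is constantly 1 because the series is 1/sqrt(1 - x^2); it shows
    that the derivative of the arcsine series in theta is 1.\<close>
  define W where "W u = qpar u * even_series central_binom (xpar u)" for u
  have b: "\<bar>central_binom n\<bar> \<le> 1" for n using central_binom_pos[of n] central_binom_le_1[of n] by simp
  have "2 * (real n + 1) * central_binom (Suc n) - (2 * real n + 1) * central_binom n = 0" for n
    by (simp add: central_binom_Suc field_simps)
  then have dW: "(W has_real_derivative 0) (at u)" if "0 < u" "u < 1" for u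
    using even_series_qpar_deriv[of central_binom 1, OF b that] by (simp add: W_def[abs_def] odd_series_def pow_series_def)
  have W1: "W u = 1" if u: "0 < u" "u < 1" for u
  proof -
    have "complex_of_real (W u - 1) = 0"
    proof (rule eq_by_derivative[where f = "\<lambda>u. complex_of_real (W u - 1)" and g = "\<lambda>_. 0" and D = "\<lambda>_. 0"])
      fix u :: real assume "0 < u" "u < 1"
      then have "((\<lambda>u. W u - 1) has_real_derivative 0) (at u)"
        using DERIV_diff[OF dW DERIV_const[of 1]] by simp
      from has_vector_derivative_of_real[OF this]
      show "((\<lambda>u. complex_of_real (W u - 1)) has_vector_derivative 0) (at u)" by simp
    next
      have "(W \<longlongrightarrow> 1) (at_right 0)"
        using qpar_mult_tendsto[OF even_series_cont_0(1)[of central_binom 1, OF b]] even_series_cont_0(2)[of central_binom 1, OF b]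
        by (simp add: W_def[abs_def])
      then have "((\<lambda>u. complex_of_real (W u - 1)) \<longlongrightarrow> of_real (1 - 1)) (at_right 0)"
        by (intro tendsto_intros)
      then show "((\<lambda>u. complex_of_real (W u - 1)) \<longlongrightarrow> 0) (at_right 0)" by simp
    qed (use u in auto)
    then show ?thesis by (simp only: of_real_eq_0_iff)
  qed
  have "mzfun (Suc 0) (\<lambda>u. \<i> * complex_of_real (odd_series (\<lambda>n. central_binom n / (2 * real n + 1)) (xpar u)))"
  proof (rule mzfun_primitive[OF mzder_theta_const])
    fix u :: real assume u: "0 < u" "u < 1"
    have "even_series central_binom (xpar u) * xpar' u = 2 / (1 + u\<^sup>2)"
      using W1[OF u] by (simp add: W_def qpar_xpar(2) mult_ac)
    with compose_xpar[OF odd_series_integral_deriv[of central_binom 1 "xpar u", OF b xpar_abs[OF u]], of \<i>]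
    show "((\<lambda>u. \<i> * complex_of_real (odd_series (\<lambda>n. central_binom n / (2 * real n + 1)) (xpar u))) has_vector_derivative
      \<i> * of_real (2 / (1 + u\<^sup>2)) * 1) (at u)" by simp
  next
    have "\<bar>central_binom n / (2 * real n + 1)\<bar> \<le> 1" for n by (rule bounded_divide[OF b]) auto
    from odd_series_cont_0[OF this]
    show "((\<lambda>u. \<i> * complex_of_real (odd_series (\<lambda>n. central_binom n / (2 * real n + 1)) (xpar u))) \<longlongrightarrow> 0) (at_right 0)"
      by (intro compose_xpar_tendsto)
  qed
  then show ?case by simp
next
  case (Suc j)
  define d where "d n = central_binom n * t_sum n (replicate (Suc j) 2)" for n
  define c where "c n = central_binom n * t_sum n (replicate j 2) / (2 * real n + 1)" for n
  \<comment> \<open>The intermediate even power theta^(2j+2)/(2j+2)!: its derivative in theta is the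
    given odd power, and it is itself the derivative of the next one.\<close>
  define W where "W u = qpar u * even_series d (xpar u)" for u
  have b: "\<bar>d n\<bar> \<le> 2 ^ Suc j" for n
    using mult_mono[OF central_binom_le_1[of n] t_sum_2_le[of n "Suc j"]] central_binom_pos[of n] t_sum_nonneg[of n "replicate (Suc j) 2"]
    by (simp add: d_def abs_mult)
  have "2 * (real n + 1) * d (Suc n) - (2 * real n + 1) * d n = c n" for n
  proof -
    have "2 * real n + 1 \<noteq> 0" "2 * real n + 2 \<noteq> 0" by (simp_all add: add_nonneg_eq_0_iff)
    then show ?thesis
      unfolding d_def c_def central_binom_Suc replicate_Suc t_sum_Suc
      by (simp add: divide_simps) (simp add: algebra_simps power2_eq_square)
  qed
  then have dW: "(W has_real_derivative 2 / (1 + u\<^sup>2) * odd_series c (xpar u)) (at u)" if "0 < u" "u < 1" for u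
    using even_series_qpar_deriv[of d, OF b that] by (simp add: W_def[abs_def])
  \<comment> \<open>The minus sign is the product of the \<open>\<i>\<close> in the induction
    hypothesis with the \<open>\<i>\<close> of the form.\<close>
  have "mzfun (Suc (2 * j + 1)) (\<lambda>u. - complex_of_real (W u))"
  proof (rule mzfun_primitive[OF mzder_theta[OF Suc.IH]])
    fix u :: real assume "0 < u" "u < 1"
    from has_vector_derivative_minus[OF has_vector_derivative_of_real[OF dW[OF this]]]
    have "((\<lambda>u. - complex_of_real (W u)) has_vector_derivative
       - of_real (2 / (1 + u\<^sup>2) * odd_series c (xpar u))) (at u)" .
    also have "- of_real (2 / (1 + u\<^sup>2) * odd_series c (xpar u)) =
      \<i> * of_real (2 / (1 + u\<^sup>2)) * (\<i> * complex_of_real (odd_series c (xpar u)))"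
    proof -
      have "\<i> * a * (\<i> * b) = (\<i> * \<i>) * (a * b)" for a b by (simp only: mult_ac)
      then show ?thesis by simp
    qed
    finally show "((\<lambda>u. - complex_of_real (W u)) has_vector_derivative
       \<i> * of_real (2 / (1 + u\<^sup>2)) * (\<i> * complex_of_real
         (odd_series (\<lambda>n. central_binom n * t_sum n (replicate j 2) / (2 * real n + 1)) (xpar u)))) (at u)"
      by (simp only: c_def[abs_def])
  next
    have "(W \<longlongrightarrow> 0) (at_right 0)"
      using qpar_mult_tendsto[OF even_series_cont_0(1)[of d, OF b]] even_series_cont_0(2)[of d, OF b]
      by (simp add: W_def[abs_def] d_def t_sum_0_Cons)
    then have "((\<lambda>u. - complex_of_real (W u)) \<longlongrightarrow> - of_real 0) (at_right 0)"
      by (intro tendsto_intros)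
    then show "((\<lambda>u. - complex_of_real (W u)) \<longlongrightarrow> 0) (at_right 0)" by simp
  qed
  then have W: "mzfun (2 * j + 2) (\<lambda>u. of_rat (-1) * - complex_of_real (W u))"
    by (intro mzfun_rat) simp
  have "mzfun (Suc (2 * j + 2)) (\<lambda>u. \<i> * complex_of_real (odd_series (\<lambda>n. d n / (2 * real n + 1)) (xpar u)))"
  proof (rule mzfun_primitive[OF mzder_theta[OF W]])
    fix u :: real assume u: "0 < u" "u < 1"
    have "even_series d (xpar u) * xpar' u = 2 / (1 + u\<^sup>2) * W u"
      by (simp add: W_def qpar_xpar(2) mult_ac)
    with compose_xpar[OF odd_series_integral_deriv[of d _ "xpar u", OF b xpar_abs[OF u]], of \<i>]
    have "((\<lambda>u. \<i> * complex_of_real (odd_series (\<lambda>n. d n / (2 * real n + 1)) (xpar u))) has_vector_derivative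
      \<i> * of_real (2 / (1 + u\<^sup>2) * W u)) (at u)" by (simp only:)
    also have "\<i> * of_real (2 / (1 + u\<^sup>2) * W u) =
      \<i> * of_real (2 / (1 + u\<^sup>2)) * (of_rat (-1) * - complex_of_real (W u))" by simp
    finally show "((\<lambda>u. \<i> * complex_of_real (odd_series (\<lambda>n. d n / (2 * real n + 1)) (xpar u))) has_vector_derivative
      \<i> * of_real (2 / (1 + u\<^sup>2)) * (of_rat (-1) * - complex_of_real (W u))) (at u)" .
  next
    have "\<bar>d n / (2 * real n + 1)\<bar> \<le> 2 ^ Suc j" for n by (rule bounded_divide[OF b]) auto
    from odd_series_cont_0[OF this]
    show "((\<lambda>u. \<i> * complex_of_real (odd_series (\<lambda>n. d n / (2 * real n + 1)) (xpar u))) \<longlongrightarrow> 0) (at_right 0)"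
      by (intro compose_xpar_tendsto)
  qed
  then show ?case by (simp add: d_def)
qed

lemma even_series_shift:
  assumes b: "\<And>n. \<bar>e n\<bar> \<le> B" and e0: "e 0 = 0" and x: "\<bar>x\<bar> < 1"
  shows "even_series e x = x * odd_series (\<lambda>n. e (Suc n)) x"
proof -
  have "(\<lambda>n. e (Suc n) * (x\<^sup>2) ^ n) sums pow_series (\<lambda>n. e (Suc n)) (x\<^sup>2)"
    by (intro pow_series_sums[of _ B] b abs_sq_less_1 x)
  from sums_mult[OF this, of "x\<^sup>2"]
  have "(\<lambda>n. e n * (x\<^sup>2) ^ n) sums (x\<^sup>2 * pow_series (\<lambda>n. e (Suc n)) (x\<^sup>2) + 0)"
    using sums_Suc[of "\<lambda>n. e n * (x\<^sup>2) ^ n"] e0 by (simp add: mult_ac)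
  then show ?thesis by (simp add: sums_iff even_series_def odd_series_def pow_series_def power2_eq_square)
qed

lemma inverse_central_binom_le: "1 / central_binom n \<le> 2 * real n" if "n \<ge> 1"
proof -
  have "real n powr (1/2) \<le> real n powr 1" using that by (intro powr_mono) auto
  with inverse_central_binom_le_powr[OF that] that show ?thesis by simp
qed

text \<open>The series is (2 theta)^(2j+2)/(2j+2)! with theta = arcsin x; an even number of
  integrations in theta leaves no factor \<open>\<i>\<close>.\<close>

lemma mzfun_arcsin_even:
  "mzfun (2 * j + 2) (\<lambda>u. complex_of_real
     (even_series (\<lambda>n. zeta_sum (n - 1) (replicate j 2) / (central_binom n * real n ^ 2)) (xpar u)))"
proof -
  define e where "e j n = zeta_sum (n - 1) (replicate j 2) / (central_binom n * real n)" for j n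
  define c where "c j n = zeta_sum (n - 1) (replicate j 2) / (central_binom n * real n ^ 2)" for j n
  \<comment> \<open>The odd power (2 theta)^(2j+1)/(2j+1)! between two even ones: half the
    derivative of \<open>even_series (c j)\<close> in theta. The index shift in \<open>e\<close> is
    the division by x that makes the series odd.\<close>
  define W where "W j u = qpar u * odd_series (\<lambda>n. e j (Suc n)) (xpar u)" for j u
  have ce: "c j n = e j n / real n" for j n by (simp add: c_def e_def power2_eq_square)
  have b: "\<bar>e j n\<bar> \<le> 2 ^ j * 2" for j n
  proof (cases "n = 0")
    case False
    then have "1 / central_binom n / real n \<le> 2"
      using inverse_central_binom_le[of n] by (subst pos_divide_le_eq) auto
    then have "zeta_sum (n - 1) (replicate j 2) * (1 / central_binom n / real n) \<le> 2 ^ j * 2"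
      using zeta_sum_2_le[of "n - 1" j] central_binom_pos[of n] zeta_sum_nonneg[of "n - 1"] by (intro mult_mono) auto
    moreover have "0 \<le> e j n" using central_binom_pos[of n] zeta_sum_nonneg by (simp add: e_def)
    ultimately show ?thesis by (simp add: e_def)
  qed (simp add: e_def)
  have bc: "\<bar>c j n\<bar> \<le> 2 ^ j * 2" for j n
    unfolding ce by (rule bounded_divide[OF b]) auto
  have e0: "e j 0 = 0" for j by (simp add: e_def)
  have eS: "(2 * real n + 1) * e j (Suc n) = 2 * (zeta_sum n (replicate j 2) / central_binom n)" for j n
    using central_binom_pos[of n] by (simp add: e_def central_binom_Suc divide_simps)
  have e2: "2 * real n * e j n = (if n = 0 then 0 else 2 * (zeta_sum (n - 1) (replicate j 2) / central_binom n))" for j n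
    using central_binom_pos[of n] by (simp add: e_def)
  \<comment> \<open>For the empty composition the sums do not change with n, so all coefficients
    cancel except the one at n = 0. The remaining constant 2 starts the iteration.\<close>
  have z0: "(2 * real n + 1) * e 0 (Suc n) - 2 * real n * e 0 (Suc (n - 1)) = (if n = 0 then 2 else 0)" for n
    using eS[of n 0] e2[of n 0] by (cases n) auto
  have zS: "(2 * real n + 1) * e (Suc j) (Suc n) - 2 * real n * e (Suc j) (Suc (n - 1)) = 2 * c j n" for j n
  proof (cases n)
    case 0
    then show ?thesis using eS[of 0 "Suc j"] by (simp add: zeta_sum_0_Cons c_def)
  next
    case (Suc k)
    have "zeta_sum n (replicate (Suc j) 2) = zeta_sum k (replicate (Suc j) 2) + zeta_sum k (replicate j 2) / real n ^ 2"
      unfolding Suc replicate_Suc zeta_sum_Suc by (simp add: add.commute)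
    then show ?thesis using eS[of n "Suc j"] e2[of n "Suc j"] Suc
      by (simp add: c_def add_divide_distrib mult.commute del: replicate_Suc of_nat_Suc)
  qed
  have dW: "(W j has_real_derivative 2 / (1 + u\<^sup>2) *
      even_series (\<lambda>n. (2 * real n + 1) * e j (Suc n) - 2 * real n * e j (Suc (n - 1))) (xpar u)) (at u)"
    if "0 < u" "u < 1" for j u
    unfolding W_def[abs_def] by (rule odd_series_qpar_deriv[OF b that])
  have W0: "((\<lambda>u. \<i> * complex_of_real (W j u)) \<longlongrightarrow> 0) (at_right 0)" for j
  proof -
    have "(W j \<longlongrightarrow> 0) (at_right 0)"
      using qpar_mult_tendsto[OF odd_series_cont_0(1)[of "\<lambda>n. e j (Suc n)", OF b]]
      by (simp add: W_def[abs_def] odd_series_def)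
    then have "((\<lambda>u. \<i> * complex_of_real (W j u)) \<longlongrightarrow> \<i> * of_real 0) (at_right 0)"
      by (intro tendsto_intros)
    then show ?thesis by simp
  qed
  have Y: "mzfun (Suc (Suc n)) (\<lambda>u. complex_of_real (even_series (c j) (xpar u)))"
    if W: "mzfun (Suc n) (\<lambda>u. \<i> * complex_of_real (W j u))" for n j
  \<comment> \<open>The factor -2 combines the 2 from integrating an even series with the sign of
    \<open>\<i> * \<i>\<close>.\<close>
  proof (rule mzfun_primitive[OF mzder_rat[where q = "-2", OF mzder_theta[OF W]]])
    fix u :: real assume u: "0 < u" "u < 1"
    have x: "xpar u \<noteq> 0" "\<bar>xpar u\<bar> < 1" using xpar_bounds[OF u] by auto
    have "2 * (even_series (e j) (xpar u) / xpar u) * xpar' u = 2 * (2 / (1 + u\<^sup>2)) * W j u"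
      using x unfolding even_series_shift[of "e j", OF b e0 x(2)] by (simp add: W_def qpar_xpar(2) mult_ac)
    then show "((\<lambda>u. complex_of_real (even_series (c j) (xpar u))) has_vector_derivative
      of_rat (- 2) * (\<i> * of_real (2 / (1 + u\<^sup>2)) * (\<i> * complex_of_real (W j u)))) (at u)"
      using compose_xpar[OF even_series_integral_deriv[of "e j" _ "xpar u", OF b e0 x(2,1)], of 1]
      by (simp add: ce[abs_def] mult_ac of_rat_minus)
  next
    show "((\<lambda>u. complex_of_real (even_series (c j) (xpar u))) \<longlongrightarrow> 0) (at_right 0)"
      using compose_xpar_tendsto[of "even_series (c j)" 1] even_series_cont_0[of "c j", OF bc] by (simp add: c_def)
  qed
  have "mzfun (2 * j + 2) (\<lambda>u. complex_of_real (even_series (c j) (xpar u)))"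
  proof (induction j)
    case 0
    have "mzfun (Suc 0) (\<lambda>u. \<i> * complex_of_real (W 0 u))"
    proof (rule mzfun_primitive[OF mzder_rat[where q = 2, OF mzder_theta_const] _ W0])
      fix u :: real assume u: "0 < u" "u < 1"
      have "even_series (\<lambda>n. (2 * real n + 1) * e 0 (Suc n) - 2 * real n * e 0 (Suc (n - 1))) (xpar u) = 2"
        unfolding z0 even_series_def pow_series_def by (subst suminf_finite[of "{0}"]) auto
      with has_vector_derivative_mult_right[OF has_vector_derivative_of_real[OF dW[OF u, of 0]], of \<i>]
      show "((\<lambda>u. \<i> * complex_of_real (W 0 u)) has_vector_derivative
          of_rat 2 * (\<i> * of_real (2 / (1 + u\<^sup>2)) * 1)) (at u)"
        by (simp add: mult_ac)
    qed
    from Y[OF this] show ?case by (simp add: numeral_2_eq_2)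
  next
    case (Suc j)
    have "mzfun (Suc (2 * j + 2)) (\<lambda>u. \<i> * complex_of_real (W (Suc j) u))"
    proof (rule mzfun_primitive[OF mzder_rat[where q = 2, OF mzder_theta[OF Suc.IH]] _ W0])
      fix u :: real assume u: "0 < u" "u < 1"
      have x: "\<bar>xpar u\<bar> < 1" by (rule xpar_abs[OF u])
      have "even_series (\<lambda>n. (2 * real n + 1) * e (Suc j) (Suc n) - 2 * real n * e (Suc j) (Suc (n - 1))) (xpar u)
          = 2 * even_series (c j) (xpar u)"
        unfolding zS using sums_mult[OF pow_series_sums[of "c j", OF bc abs_sq_less_1[OF x]], of 2]
        by (simp add: even_series_def pow_series_def[of "\<lambda>n. 2 * c j n"] sums_iff mult_ac)
      with has_vector_derivative_mult_right[OF has_vector_derivative_of_real[OF dW[OF u, of "Suc j"]], of \<i>]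
      show "((\<lambda>u. \<i> * complex_of_real (W (Suc j) u)) has_vector_derivative
          of_rat 2 * (\<i> * of_real (2 / (1 + u\<^sup>2)) * complex_of_real (even_series (c j) (xpar u)))) (at u)"
        by (simp add: mult_ac)
    qed
    from Y[OF this] show ?case by simp
  qed
  then show ?thesis by (simp add: c_def[abs_def])
qed

section \<open>Peeling off the star sum\<close>

text \<open>Tonelli for the nonnegative double series over \<open>j < n\<close>, summed by rows and
  by columns. It is used twice: with star sums for the values, and with powers for the generating
  function of the tails.\<close>

lemma sums_swap_tail:
  fixes b c :: "nat \<Rightarrow> real"
  assumes c: "\<And>n. 0 \<le> c n" and b: "\<And>n. 0 \<le> b n" and sc: "summable c"
    and sm: "summable (\<lambda>n. c n * (\<Sum>j<n. b j))"
  shows "(\<lambda>j. (\<Sum>m. c (m + Suc j)) * b j) sums (\<Sum>n. c n * (\<Sum>j<n. b j))"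
proof -
  define f where "f = (\<lambda>(n, j). if j < n then c n * b j else 0)"
  have f_nonneg: "0 \<le> f z" for z using b c by (cases z) (auto simp: f_def)
  have rows: "((\<lambda>j. f (n, j)) has_sum c n * (\<Sum>j<n. b j)) UNIV" for n
  proof (rule sums_nonneg_imp_has_sum[OF _ f_nonneg])
    have "(\<lambda>j. f (n, j)) sums (\<Sum>j<n. f (n, j))" by (rule sums_finite) (auto simp: f_def)
    also have "(\<Sum>j<n. f (n, j)) = c n * (\<Sum>j<n. b j)" by (simp add: f_def sum_distrib_left)
    finally show "(\<lambda>j. f (n, j)) sums (c n * (\<Sum>j<n. b j))" .
  qed
  have cols: "((\<lambda>n. f (n, j)) has_sum (\<Sum>m. c (m + Suc j)) * b j) UNIV" for j
  proof (rule sums_nonneg_imp_has_sum[OF _ f_nonneg])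
    have "summable (\<lambda>m. c (m + Suc j))" using sc by (subst summable_iff_shift)
    then have "(\<lambda>m. c (m + Suc j) * b j) sums ((\<Sum>m. c (m + Suc j)) * b j)"
      by (intro sums_mult2 summable_sums)
    then have "(\<lambda>m. f (m + Suc j, j)) sums ((\<Sum>m. c (m + Suc j)) * b j)" by (simp add: f_def)
    moreover have "(\<Sum>n<Suc j. f (n, j)) = 0" by (rule sum.neutral) (auto simp: f_def)
    ultimately show "(\<lambda>n. f (n, j)) sums ((\<Sum>m. c (m + Suc j)) * b j)"
      by (subst (asm) sums_iff_shift) simp
  qed
  have outer: "((\<lambda>n. c n * (\<Sum>j<n. b j)) has_sum (\<Sum>n. c n * (\<Sum>j<n. b j))) UNIV"
    using c b by (intro sums_nonneg_imp_has_sum summable_sums sm mult_nonneg_nonneg sum_nonneg) auto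
  have "f summable_on UNIV \<times> UNIV"
    by (rule summable_on_SigmaI[OF rows]) (use outer f_nonneg in \<open>auto simp: summable_on_def\<close>)
  then have "(f has_sum (\<Sum>n. c n * (\<Sum>j<n. b j))) (UNIV \<times> UNIV)"
    by (rule has_sum_SigmaI[OF rows outer])
  then have "((\<lambda>(j, n). f (n, j)) has_sum (\<Sum>n. c n * (\<Sum>j<n. b j))) (UNIV \<times> UNIV)"
    by (subst (asm) has_sum_swap)
  from has_sum_SigmaD[OF this, of "\<lambda>j. (\<Sum>m. c (m + Suc j)) * b j"]
  show ?thesis using cols by (intro has_sum_imp_sums) simp
qed

text \<open>All compositions are required at once, because peeling changes the coefficients and
  shortens the composition: the tails against \<open>ks\<close> converge since \<open>c\<close>
  converges against \<open>a # ks\<close>.\<close>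

definition star_summable :: "(nat \<Rightarrow> real) \<Rightarrow> bool" where
  "star_summable c \<longleftrightarrow> (\<forall>n. 0 \<le> c n) \<and> (\<forall>ks. composition ks \<longrightarrow> summable (\<lambda>n. c n * t_star_sum n ks))"

lemma star_summable_summable: "star_summable c \<Longrightarrow> summable c"
  unfolding star_summable_def by (elim conjE allE[of _ "[]"]) (simp add: composition_def)

lemma star_summable_nonneg: "star_summable c \<Longrightarrow> 0 \<le> c n"
  by (simp add: star_summable_def)

lemma star_summable_bounded: "star_summable c \<Longrightarrow> \<bar>c n\<bar> \<le> suminf c"
  using sum_le_suminf[of c "{n}"] star_summable_summable[of c] star_summable_nonneg[of c] by simp

lemma pow_series_limit:
  assumes "star_summable c"
  shows "(pow_series c \<longlongrightarrow> suminf c) (at_left 1)"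
proof -
  have "(\<lambda>n. complex_of_real (c n)) sums of_real (suminf c)"
    using star_summable_summable[OF assms] by (intro sums_of_real summable_sums)
  from tendsto_Re[OF Abel_limit[OF this]]
  have "((\<lambda>u. Re (\<Sum>n. complex_of_real (c n) * of_real u ^ n)) \<longlongrightarrow> suminf c) (at_left 1)" by simp
  then show ?thesis
  proof (rule Lim_transform_eventually)
    show "\<forall>\<^sub>F u in at_left 1. Re (\<Sum>n. complex_of_real (c n) * of_real u ^ n) = pow_series c u"
    proof (rule eventually_mono[OF eventually_at_left_real[of 0 1]])
      fix u :: real assume "u \<in> {0<..<1}"
      then have "(\<lambda>n. c n * u ^ n) sums pow_series c u"
        by (intro pow_series_sums[of _ "suminf c"] star_summable_bounded assms) auto
      then have "(\<lambda>n. complex_of_real (c n * u ^ n)) sums of_real (pow_series c u)" by (rule sums_of_real)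
      then show "Re (\<Sum>n. complex_of_real (c n) * of_real u ^ n) = pow_series c u" by (simp add: sums_iff)
    qed simp
  qed
qed

lemma even_series_limit:
  assumes "star_summable c"
  shows "((\<lambda>u. even_series c (xpar u)) \<longlongrightarrow> suminf c) (at_left 1)"
proof -
  have "((\<lambda>u. (xpar u)\<^sup>2) \<longlongrightarrow> 1\<^sup>2) (at_left 1)"
    using xpar_tendsto_1 by (intro tendsto_intros) (simp add: filterlim_at)
  moreover have "\<forall>\<^sub>F u in at_left 1. (xpar u)\<^sup>2 \<in> {..<1} \<and> (xpar u)\<^sup>2 \<noteq> 1"
  proof (rule eventually_mono[OF eventually_at_left_real[of 0 1]])
    fix u :: real assume "u \<in> {0<..<1}"
    then have "(xpar u)\<^sup>2 < 1" using abs_sq_less_1[OF xpar_abs[of u]] by simp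
    then show "(xpar u)\<^sup>2 \<in> {..<1} \<and> (xpar u)\<^sup>2 \<noteq> 1" by simp
  qed simp
  ultimately have "filterlim (\<lambda>u. (xpar u)\<^sup>2) (at_left 1) (at_left 1)"
    by (auto simp: filterlim_at elim: eventually_mono)
  from filterlim_compose[OF pow_series_limit[OF assms] this] show ?thesis by (simp add: even_series_def)
qed

lemma mzder_dx_over_1_minus_sq:
  assumes "mzfun n f"
  shows "mzder n (\<lambda>u. of_real (xpar' u / (1 - (xpar u)\<^sup>2)) * f u)"
proof -
  have "mzder n (\<lambda>u. diff_form 1 u * f u - diff_form (-1) u * f u)"
    by (intro mzder_diff mzder_diff_form assms) auto
  then show ?thesis by (rule mzder_cong) (simp only: forms_dx left_diff_distrib)
qed

lemma mzder_const_dx_over_1_minus_sq: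
  assumes "c \<in> CMZV4 n"
  shows "mzder n (\<lambda>u. of_real (xpar' u / (1 - (xpar u)\<^sup>2)) * c)"
proof -
  have "mzder n (\<lambda>u. diff_form 1 u * c - diff_form (-1) u * c)"
    by (intro mzder_diff mzder_const assms) auto
  then show ?thesis by (rule mzder_cong) (simp only: forms_dx left_diff_distrib)
qed

lemma mzder_xdx_over_1_minus_sq:
  assumes "mzfun n f"
  shows "mzder n (\<lambda>u. of_real (xpar' u * xpar u / (1 - (xpar u)\<^sup>2)) * f u)"
proof -
  have "mzder n (\<lambda>u. diff_form 1 u * f u + diff_form (-1) u * f u - (diff_form \<i> u * f u + diff_form (-\<i>) u * f u))"
    by (intro mzder_diff mzder_add mzder_diff_form assms) auto
  then show ?thesis by (rule mzder_cong) (simp only: forms_dx left_diff_distrib distrib_right)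
qed

definition tail_diff_form :: "complex \<Rightarrow> (nat \<Rightarrow> real) \<Rightarrow> real \<Rightarrow> complex" where
  "tail_diff_form k c u = k * of_real ((suminf c - even_series c (xpar u)) / (1 - (xpar u)\<^sup>2) * xpar' u)"

text \<open>The invariant of the peeling induction. It records the form of the tails instead of the
  generating function, because the latter is available in varying shape: even, times x, or divided
  by x.\<close>

definition tail_state :: "complex \<Rightarrow> nat \<Rightarrow> (nat \<Rightarrow> real) \<Rightarrow> bool" where
  "tail_state k n c \<longleftrightarrow> star_summable c \<and> k * of_real (suminf c) \<in> CMZV4 n \<and> mzder n (tail_diff_form k c)"

lemma tail_state_from_even:
  assumes g: "star_summable c" and m: "mzfun n (\<lambda>u. k * complex_of_real (even_series c (xpar u)))"
  shows "tail_state k n c"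
proof -
  have "((\<lambda>u. k * complex_of_real (even_series c (xpar u))) \<longlongrightarrow> k * of_real (suminf c)) (at_left 1)"
    by (intro tendsto_intros even_series_limit g)
  with m have v: "k * of_real (suminf c) \<in> CMZV4 n" by (rule mzfun_limit)
  have "mzder n (\<lambda>u. of_real (xpar' u / (1 - (xpar u)\<^sup>2)) * (k * of_real (suminf c))
      - of_real (xpar' u / (1 - (xpar u)\<^sup>2)) * (k * complex_of_real (even_series c (xpar u))))"
    by (intro mzder_diff mzder_const_dx_over_1_minus_sq mzder_dx_over_1_minus_sq m v)
  then have "mzder n (tail_diff_form k c)"
    by (rule mzder_cong) (simp add: tail_diff_form_def diff_divide_distrib algebra_simps)
  with g v show ?thesis by (simp add: tail_state_def)
qed

text \<open>Only xF is known to be an \<open>mzfun\<close>, not F. The decomposition 1/(x(1 - x^2))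
  = 1/x + x/(1 - x^2) still expresses F dx/(1 - x^2) by forms applied to xF.\<close>

lemma tail_state_from_odd:
  assumes g: "star_summable c" and m: "mzfun n (\<lambda>u. k * complex_of_real (odd_series c (xpar u)))"
  shows "tail_state k n c"
proof -
  have "((\<lambda>u. k * complex_of_real (xpar u * even_series c (xpar u))) \<longlongrightarrow> k * of_real (1 * suminf c)) (at_left 1)"
    using xpar_tendsto_1 by (intro tendsto_intros even_series_limit g) (simp add: filterlim_at)
  then have "((\<lambda>u. k * complex_of_real (odd_series c (xpar u))) \<longlongrightarrow> k * of_real (suminf c)) (at_left 1)"
    by (simp add: odd_series_def even_series_def)
  with m have v: "k * of_real (suminf c) \<in> CMZV4 n" by (rule mzfun_limit)
  have "mzder n (\<lambda>u. of_real (xpar' u / (1 - (xpar u)\<^sup>2)) * (k * of_real (suminf c))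
      - (of_real (xpar' u / xpar u) * (k * complex_of_real (odd_series c (xpar u)))
        + of_real (xpar' u * xpar u / (1 - (xpar u)\<^sup>2)) * (k * complex_of_real (odd_series c (xpar u)))))"
    by (intro mzder_diff mzder_add mzder_const_dx_over_1_minus_sq mzder_dx_over_x
        mzder_xdx_over_1_minus_sq m v)
  then have "mzder n (tail_diff_form k c)"
  proof (rule mzder_cong)
    fix u :: real assume u: "0 < u" "u < 1"
    define x where "x = xpar u"
    have x: "x \<noteq> 0" "1 - x\<^sup>2 \<noteq> 0" using xpar_bounds[OF u] abs_sq_less_1[OF xpar_abs[OF u]] by (auto simp: x_def)
    have "odd_series c x = x * even_series c x" by (simp add: odd_series_def even_series_def)
    with x have "xpar' u / (1 - x\<^sup>2) * suminf c - (xpar' u / x * odd_series c x + xpar' u * x / (1 - x\<^sup>2) * odd_series c x)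
      = (suminf c - even_series c x) / (1 - x\<^sup>2) * xpar' u"
      by (simp add: divide_simps) (simp add: algebra_simps power2_eq_square)
    then have "tail_diff_form k c u = k * of_real (xpar' u / (1 - x\<^sup>2) * suminf c
        - (xpar' u / x * odd_series c x + xpar' u * x / (1 - x\<^sup>2) * odd_series c x))"
      by (simp only: tail_diff_form_def x_def)
    then show "of_real (xpar' u / (1 - (xpar u)\<^sup>2)) * (k * of_real (suminf c))
      - (of_real (xpar' u / xpar u) * (k * complex_of_real (odd_series c (xpar u)))
        + of_real (xpar' u * xpar u / (1 - (xpar u)\<^sup>2)) * (k * complex_of_real (odd_series c (xpar u)))) = tail_diff_form k c u"
      by (simp add: x_def algebra_simps)
  qed
  with g v show ?thesis by (simp add: tail_state_def)
qed

text \<open>Here F = xG with G the known odd series, so F dx/(1 - x^2) is the form x dx/(1 - x^2)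
  applied to G, and F and G have the same limit at 1.\<close>

lemma tail_state_from_odd_shift:
  assumes g: "star_summable c" and c0: "c 0 = 0" and m: "mzfun n (\<lambda>u. k * complex_of_real (odd_series (\<lambda>n. c (Suc n)) (xpar u)))"
  shows "tail_state k n c"
proof -
  let ?c = "\<lambda>n. c (Suc n)"
  have even_series: "even_series c (xpar u) = xpar u * odd_series ?c (xpar u)" if "0 < u" "u < 1" for u
    using star_summable_bounded[OF g] c0 xpar_abs[OF that] by (rule even_series_shift)
  have "((\<lambda>u. k * complex_of_real (even_series c (xpar u) / xpar u)) \<longlongrightarrow> k * of_real (suminf c / 1)) (at_left 1)"
    using xpar_tendsto_1 by (intro tendsto_intros even_series_limit g) (simp_all add: filterlim_at)
  then have "((\<lambda>u. k * complex_of_real (odd_series ?c (xpar u))) \<longlongrightarrow> k * of_real (suminf c / 1)) (at_left 1)"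
  proof (rule Lim_transform_eventually)
    show "\<forall>\<^sub>F u in at_left 1. k * complex_of_real (even_series c (xpar u) / xpar u) = k * complex_of_real (odd_series ?c (xpar u))"
    proof (rule eventually_mono[OF eventually_at_left_real[of 0 1]])
      fix u :: real assume "u \<in> {0<..<1}"
      then show "k * complex_of_real (even_series c (xpar u) / xpar u) = k * complex_of_real (odd_series ?c (xpar u))"
        using xpar_bounds[of u] by (simp add: even_series)
    qed simp
  qed
  then have "((\<lambda>u. k * complex_of_real (odd_series ?c (xpar u))) \<longlongrightarrow> k * of_real (suminf c)) (at_left 1)" by simp
  with m have v: "k * of_real (suminf c) \<in> CMZV4 n" by (rule mzfun_limit)
  have "mzder n (\<lambda>u. of_real (xpar' u / (1 - (xpar u)\<^sup>2)) * (k * of_real (suminf c))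
      - of_real (xpar' u * xpar u / (1 - (xpar u)\<^sup>2)) * (k * complex_of_real (odd_series ?c (xpar u))))"
    by (intro mzder_diff mzder_const_dx_over_1_minus_sq mzder_xdx_over_1_minus_sq m v)
  then have "mzder n (tail_diff_form k c)"
    by (rule mzder_cong) (simp add: tail_diff_form_def even_series diff_divide_distrib algebra_simps)
  with g v show ?thesis by (simp add: tail_state_def)
qed

lemma mzfun_odd_series_iterate:
  assumes b: "\<And>n. \<bar>c n\<bar> \<le> B" and m: "mzfun n (\<lambda>u. k * complex_of_real (odd_series c (xpar u)))"
  shows "mzfun (n + j) (\<lambda>u. k * complex_of_real (odd_series (\<lambda>n. c n / (2 * real n + 1) ^ j) (xpar u)))"
proof (induction j)
  case 0
  with m show ?case by simp
next
  case (Suc j)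
  have "\<bar>c n / (2 * real n + 1) ^ j\<bar> \<le> B" for n
    by (rule bounded_divide[OF b]) (auto intro: one_le_power)
  from mzfun_odd_series_integral[OF this Suc.IH] show ?case by (simp add: mult.commute)
qed

lemma mzfun_even_series_iterate:
  assumes b: "\<And>n. \<bar>c n\<bar> \<le> B" and c0: "c 0 = 0" and m: "mzfun n (\<lambda>u. k * complex_of_real (even_series c (xpar u)))"
  shows "mzfun (n + j) (\<lambda>u. k * complex_of_real (even_series (\<lambda>n. c n / real n ^ j) (xpar u)))"
proof (induction j)
  case 0
  with m show ?case by simp
next
  case (Suc j)
  have "\<bar>c n / real n ^ j\<bar> \<le> B" for n
  proof (cases "n = 0")
    case False
    have "\<bar>c m / (if m = 0 then 1 else real m ^ j)\<bar> \<le> B" for m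
      by (rule bounded_divide[OF b]) (auto intro: one_le_power)
    from this[of n] False show ?thesis by simp
  next
    case True
    then show ?thesis using b[of 0] c0 by simp
  qed
  from mzfun_even_series_integral[OF this _ Suc.IH] show ?case using c0 by (simp add: mult.commute)
qed

text \<open>Tails belong to indices \<open>n \<ge> 1\<close>; the value \<open>0\<close> at \<open>n = 0\<close> lets the sums run over all \<open>n\<close>.\<close>

definition tail_seq :: "nat \<Rightarrow> (nat \<Rightarrow> real) \<Rightarrow> nat \<Rightarrow> real" where
  "tail_seq a c n = (case n of 0 \<Rightarrow> 0 | Suc j \<Rightarrow> (\<Sum>m. c (m + Suc j)) / (2 * real j + 1) ^ a)"

lemma t_star_sum_Cons':
  "t_star_sum n (a # ks) = (\<Sum>j<n. t_star_sum (Suc j) ks / (2 * real j + 1) ^ a)"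
proof -
  have "(\<Sum>k=1..n. 1 / (2 * real k - 1) ^ a * t_star_sum k ks)
      = (\<Sum>j<n. 1 / (2 * real (Suc j) - 1) ^ a * t_star_sum (Suc j) ks)"
    by (rule sum.reindex_bij_witness[of _ Suc "\<lambda>k. k - 1"]) auto
  then show ?thesis by (simp add: t_star_sum_Cons add.commute)
qed

text \<open>The outermost index k = j + 1 of the star sum satisfies k <= n exactly when
  \<open>j < n\<close>; exchanging the summations moves the sum over n into the
  coefficients.\<close>

lemma tail_seq_sums:
  assumes g: "star_summable c" and a: "1 \<le> a" and ks: "composition ks"
  shows "(\<lambda>n. tail_seq a c n * t_star_sum n ks) sums (\<Sum>n. c n * t_star_sum n (a # ks))"
proof -
  have "composition (a # ks)" using a ks by (simp add: composition_def)
  then have "summable (\<lambda>n. c n * (\<Sum>j<n. t_star_sum (Suc j) ks / (2 * real j + 1) ^ a))"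
    using g by (simp add: star_summable_def t_star_sum_Cons'[symmetric])
  then have "(\<lambda>j. (\<Sum>m. c (m + Suc j)) * (t_star_sum (Suc j) ks / (2 * real j + 1) ^ a)) sums
      (\<Sum>n. c n * (\<Sum>j<n. t_star_sum (Suc j) ks / (2 * real j + 1) ^ a))"
    using star_summable_nonneg[OF g] star_summable_summable[OF g] t_star_sum_nonneg by (intro sums_swap_tail) auto
  then have "(\<lambda>j. tail_seq a c (Suc j) * t_star_sum (Suc j) ks) sums (\<Sum>n. c n * t_star_sum n (a # ks))"
    by (simp add: t_star_sum_Cons'[symmetric] tail_seq_def)
  from sums_Suc[OF this] show ?thesis by (simp add: tail_seq_def)
qed

lemma star_summable_tail_seq:
  assumes g: "star_summable c" and a: "1 \<le> a"
  shows "star_summable (tail_seq a c)"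
  unfolding star_summable_def
proof (intro conjI allI impI)
  fix n show "0 \<le> tail_seq a c n"
  proof (cases n)
    case (Suc j)
    have "summable (\<lambda>m. c (m + Suc j))" using star_summable_summable[OF g] by (subst summable_iff_shift)
    then have "0 \<le> (\<Sum>m. c (m + Suc j))" using star_summable_nonneg[OF g] by (intro suminf_nonneg)
    then show ?thesis unfolding Suc tail_seq_def by (simp del: add_Suc_right)
  qed (simp add: tail_seq_def)
qed (use tail_seq_sums[OF g a] in \<open>auto simp: sums_iff\<close>)

text \<open>Exchange the summations with powers of y = x^2 as inner terms and sum the geometric
  progression (1 - y^n)/(1 - y).\<close>

lemma tail_even_series:
  assumes g: "star_summable c" and x: "0 < x" "x < 1"
  shows "even_series (\<lambda>j. \<Sum>m. c (m + Suc j)) x = (suminf c - even_series c x) / (1 - x\<^sup>2)"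
proof -
  define y where "y = x\<^sup>2"
  have y: "0 \<le> y" "y < 1" using abs_sq_less_1[of x] x by (auto simp: y_def)
  have geo: "(\<Sum>j<n. y ^ j) = (1 - y ^ n) / (1 - y)" for n
    using y sum_gp_strict[of y n] by simp
  have "(\<lambda>n. (c n - c n * y ^ n) / (1 - y)) sums ((suminf c - pow_series c y) / (1 - y))"
    using y by (intro sums_divide sums_diff summable_sums star_summable_summable g pow_series_sums[of _ "suminf c"] star_summable_bounded) auto
  then have s: "(\<lambda>n. c n * (\<Sum>j<n. y ^ j)) sums ((suminf c - pow_series c y) / (1 - y))"
    by (simp add: geo right_diff_distrib)
  have "(\<lambda>j. (\<Sum>m. c (m + Suc j)) * y ^ j) sums (\<Sum>n. c n * (\<Sum>j<n. y ^ j))"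
    using star_summable_nonneg[OF g] star_summable_summable[OF g] y s by (intro sums_swap_tail) (auto simp: sums_iff)
  with s show ?thesis by (simp add: sums_iff even_series_def pow_series_def y_def)
qed

lemma tail_odd_series_deriv:
  assumes g: "star_summable c" and u: "0 < u" "u < 1"
  shows "((\<lambda>u. k * complex_of_real (odd_series (\<lambda>j. (\<Sum>m. c (m + Suc j)) / (2 * real j + 1)) (xpar u)))
     has_vector_derivative tail_diff_form k c u) (at u)"
proof -
  have b: "\<bar>\<Sum>m. c (m + Suc j)\<bar> \<le> suminf c" for j
  proof -
    have "summable (\<lambda>m. c (m + Suc j))" using star_summable_summable[OF g] by (subst summable_iff_shift)
    then have "0 \<le> (\<Sum>m. c (m + Suc j))" using star_summable_nonneg[OF g] by (intro suminf_nonneg)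
    moreover have "suminf c = (\<Sum>m. c (m + Suc j)) + (\<Sum>i<Suc j. c i)"
      by (rule suminf_split_initial_segment[OF star_summable_summable[OF g]])
    moreover have "0 \<le> (\<Sum>i<Suc j. c i)" using star_summable_nonneg[OF g] by (intro sum_nonneg)
    ultimately show ?thesis by linarith
  qed
  from compose_xpar[OF odd_series_integral_deriv[of "\<lambda>j. \<Sum>m. c (m + Suc j)" _ "xpar u", OF b xpar_abs[OF u]], of k]
  show ?thesis by (simp only: tail_diff_form_def tail_even_series[OF g xpar_bounds[OF u]])
qed

text \<open>Integrating the form of the tails yields their odd series with one division by 2j+1; the
  other \<open>a - 1\<close> divisions are integrations against dx/x. Together they raise the weight
  by \<open>a\<close>.\<close>

lemma tail_state_step:
  assumes s: "tail_state k n c" and a: "1 \<le> a"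
  shows "tail_state k (n + a) (tail_seq a c)"
proof -
  from s have g: "star_summable c" and m: "mzder n (tail_diff_form k c)" by (auto simp: tail_state_def)
  \<comment> \<open>Tails are indexed from j = 0 here and from n = j + 1 in \<open>tail_seq\<close>,
    so that 2j+1 is the denominator 2n-1 of the star sum.\<close>
  let ?r = "\<lambda>j. (\<Sum>m. c (m + Suc j)) / (2 * real j + 1)"
  have g1: "star_summable (tail_seq 1 c)" using g by (rule star_summable_tail_seq) simp
  have r: "?r j = tail_seq 1 c (Suc j)" for j by (simp add: tail_seq_def)
  have b: "\<bar>?r j\<bar> \<le> suminf (tail_seq 1 c)" for j unfolding r by (rule star_summable_bounded[OF g1])
  have "mzfun (Suc n) (\<lambda>u. k * complex_of_real (odd_series ?r (xpar u)))"
    using compose_xpar_tendsto[OF odd_series_cont_0[of ?r, OF b]] by (intro mzfun_primitive[OF m tail_odd_series_deriv[OF g]])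
  from mzfun_odd_series_iterate[OF b this, of "a - 1"]
  have "mzfun (n + a) (\<lambda>u. k * complex_of_real (odd_series (\<lambda>j. ?r j / (2 * real j + 1) ^ (a - 1)) (xpar u)))"
    using a by simp
  moreover have "?r j / (2 * real j + 1) ^ (a - 1) = tail_seq a c (Suc j)" for j
    using a by (cases a) (auto simp: tail_seq_def)
  ultimately have "mzfun (n + a) (\<lambda>u. k * complex_of_real (odd_series (\<lambda>j. tail_seq a c (Suc j)) (xpar u)))" by simp
  with star_summable_tail_seq[OF g a] show ?thesis by (intro tail_state_from_odd_shift) (auto simp: tail_seq_def)
qed

lemma tail_state_t_star_sum:
  "tail_state k n c \<Longrightarrow> composition ks \<Longrightarrow> k * of_real (\<Sum>m. c m * t_star_sum m ks) \<in> CMZV4 (n + sum_list ks)"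
proof (induction ks arbitrary: n c)
  case Nil
  then show ?case by (simp add: tail_state_def)
next
  case (Cons a ks)
  then have a: "1 \<le> a" "composition ks" by (auto simp: composition_def)
  have "(\<Sum>m. tail_seq a c m * t_star_sum m ks) = (\<Sum>m. c m * t_star_sum m (a # ks))"
    using tail_seq_sums[of c a ks] a Cons.prems by (simp add: sums_iff tail_state_def)
  with Cons.IH[OF tail_state_step[OF Cons.prems(1) a(1)] a(2)] show ?case by (simp add: add.assoc)
qed

section \<open>Growth of star sums and convergence of the two series\<close>

lemma sum_powr_le: "(\<Sum>j=1..n. real j powr (-3/4)) \<le> 4 * real n powr (1/4)"
proof (induction n)
  case (Suc n)
  define a b where "a = real (Suc n) powr (1/4)" and "b = real n powr (1/4)"
  have ab: "0 \<le> b" "b \<le> a" "0 < a" unfolding a_def b_def by (auto intro: powr_mono2)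
  have "(real m powr (1/4)) ^ 4 = real m" for m by (cases "m = 0") (auto simp: powr_power)
  then have "a ^ 4 = real (Suc n)" "b ^ 4 = real n"
    unfolding a_def b_def by blast+
  \<comment> \<open>With a and b the fourth roots of consecutive integers, factoring 1 = a^4 - b^4
    bounds 1/a^3 by the increment 4(a - b).\<close>
  then have "1 = a ^ 4 - b ^ 4" by simp
  also have "\<dots> = (a - b) * (a ^ 3 + a ^ 2 * b + a * b ^ 2 + b ^ 3)"
    by (simp add: algebra_simps power2_eq_square power3_eq_cube power4_eq_xxxx)
  also have "\<dots> \<le> (a - b) * (a ^ 3 + a ^ 2 * a + a * a ^ 2 + a ^ 3)"
    using ab by (intro mult_left_mono add_mono power_mono order.refl) auto
  also have "\<dots> = 4 * (a - b) * a ^ 3" by (simp add: power2_eq_square power3_eq_cube)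
  finally have "1 / a ^ 3 \<le> 4 * (a - b)" using ab by (simp add: divide_le_eq)
  moreover have "real (Suc n) powr (-3/4) = 1 / a ^ 3"
    unfolding a_def by (simp add: powr_power powr_minus_divide del: of_nat_Suc)
  ultimately have "real (Suc n) powr (-3/4) \<le> 4 * (a - b)" by simp
  with Suc show ?case by (simp add: a_def b_def)
qed simp

text \<open>Star sums grow at most like powers of a logarithm. The cruder order n^(1/4) reproduces
  itself under summation with weight 1/j, and being below n^(1/2) it leaves enough room for terms of
  order n^(-3/2).\<close>

lemma t_star_sum_le:
  "composition ks \<Longrightarrow> 1 \<le> n \<Longrightarrow> t_star_sum n ks \<le> 4 ^ length ks * real n powr (1/4)"
proof (induction ks arbitrary: n)
  case Nil
  then show ?case by (simp add: ge_one_powr_ge_zero)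
next
  case (Cons a ks)
  then have a: "1 \<le> a" "composition ks" by (auto simp: composition_def)
  have "t_star_sum n (a # ks) \<le> (\<Sum>j=1..n. 4 ^ length ks * real j powr (-3/4))"
    unfolding t_star_sum_Cons
  proof (rule sum_mono)
    fix j assume j: "j \<in> {1..n}"
    have "real j \<le> 2 * real j - 1" using j by simp
    also have "\<dots> \<le> (2 * real j - 1) ^ a"
      using j a(1) power_increasing[of 1 a "2 * real j - 1"] by simp
    finally have "real j \<le> (2 * real j - 1) ^ a" .
    then have "1 / (2 * real j - 1) ^ a \<le> 1 / real j"
      using j by (intro divide_left_mono) auto
    then have "1 / (2 * real j - 1) ^ a * t_star_sum j ks \<le> 1 / real j * (4 ^ length ks * real j powr (1/4))"
      using j Cons.IH[OF a(2), of j] by (intro mult_mono t_star_sum_nonneg) auto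
    also have "\<dots> = 4 ^ length ks * (real j powr (1/4) / real j powr 1)"
      using j by simp
    also have "\<dots> = 4 ^ length ks * real j powr (-3/4)"
      by (subst powr_diff[symmetric]) simp
    finally show "1 / (2 * real j - 1) ^ a * t_star_sum j ks \<le> 4 ^ length ks * real j powr (-3/4)" .
  qed
  also have "\<dots> = 4 ^ length ks * (\<Sum>j=1..n. real j powr (-3/4))" by (simp add: sum_distrib_left)
  also have "\<dots> \<le> 4 ^ length ks * (4 * real n powr (1/4))"
    by (intro mult_left_mono sum_powr_le) auto
  finally show ?case by simp
qed

text \<open>The product of both bounds has exponent -3/2 + 1/4 = -5/4, which is below -1. The
  coefficients of both series, decaying at least like n^(-3/2), meet the hypothesis.\<close>

lemma goodI:
  assumes "\<And>n. 0 \<le> c n" "\<And>n. 1 \<le> n \<Longrightarrow> c n \<le> B * real n powr (-3/2)"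
  shows "star_summable c"
  unfolding star_summable_def
proof (intro conjI allI impI assms)
  fix ks assume ks: "composition ks"
  show "summable (\<lambda>n. c n * t_star_sum n ks)"
  proof (rule summable_comparison_test_ev)
    show "summable (\<lambda>n. B * 4 ^ length ks * real n powr (-5/4))"
      by (intro summable_mult) (simp add: summable_real_powr_iff)
    have "norm (c n * t_star_sum n ks) \<le> B * 4 ^ length ks * real n powr (-5/4)" if n: "1 \<le> n" for n
    proof -
      have "c n * t_star_sum n ks \<le> (B * real n powr (-3/2)) * (4 ^ length ks * real n powr (1/4))"
        using assms(1)[of n] assms(2)[OF n] t_star_sum_le[OF ks n] t_star_sum_nonneg[of n ks]
        by (intro mult_mono) auto
      also have "\<dots> = B * 4 ^ length ks * (real n powr (-3/2) * real n powr (1/4))" by simp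
      also have "\<dots> = B * 4 ^ length ks * real n powr (-5/4)"
        by (subst powr_add[symmetric]) simp
      finally show ?thesis using assms(1)[of n] t_star_sum_nonneg[of n ks] by simp
    qed
    then show "\<forall>\<^sub>F n in sequentially. norm (c n * t_star_sum n ks) \<le> B * 4 ^ length ks * real n powr (-5/4)"
      using eventually_sequentially by blast
  qed
qed

lemma series1_star_summable:
  assumes "1 \<le> m"
  shows "star_summable (\<lambda>n. central_binom n * t_sum n (replicate j 2) / (2 * real n + 1) ^ m)"
proof (rule goodI)
  fix n :: nat assume n: "1 \<le> n"
  have "real n \<le> (2 * real n + 1) ^ m"
    using power_increasing[OF assms, of "2 * real n + 1"] by simp
  then have "central_binom n * t_sum n (replicate j 2) / (2 * real n + 1) ^ m \<le> real n powr (-1/2) * 2 ^ j / real n powr 1"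
    using n central_binom_le_powr[OF n] t_sum_2_le[of n j] central_binom_pos[of n] t_sum_nonneg[of n]
    by (intro divide_mono mult_mono) auto
  also have "\<dots> = 2 ^ j * (real n powr (-1/2) / real n powr 1)" by simp
  also have "\<dots> = 2 ^ j * real n powr (-3/2)" by (subst powr_diff[symmetric]) simp
  finally show "central_binom n * t_sum n (replicate j 2) / (2 * real n + 1) ^ m \<le> 2 ^ j * real n powr (-3/2)" .
next
  fix n show "0 \<le> central_binom n * t_sum n (replicate j 2) / (2 * real n + 1) ^ m"
    by (intro divide_nonneg_nonneg mult_nonneg_nonneg t_sum_nonneg less_imp_le[OF central_binom_pos]) auto
qed

lemma series2_star_summable:
  assumes "1 \<le> m"
  shows "star_summable (\<lambda>n. zeta_sum (n - 1) (replicate j 2) / (central_binom n * real n ^ (m + 1)))"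
proof (rule goodI)
  fix n :: nat assume n: "1 \<le> n"
  have "real n ^ 2 \<le> real n ^ (m + 1)" using n assms by (intro power_increasing) auto
  then have p: "real n powr 2 \<le> real n ^ (m + 1)" using n by (simp add: powr_numeral)
  have "zeta_sum (n - 1) (replicate j 2) * (1 / central_binom n) / real n ^ (m + 1)
      \<le> 2 ^ j * (2 * real n powr (1/2)) / real n powr 2"
    using n p inverse_central_binom_le_powr[OF n] zeta_sum_2_le[of "n - 1" j] central_binom_pos[of n] zeta_sum_nonneg[of "n - 1"]
    by (intro divide_mono mult_mono) auto
  also have "\<dots> = 2 * 2 ^ j * (real n powr (1/2) / real n powr 2)" by simp
  also have "\<dots> = 2 * 2 ^ j * real n powr (-3/2)" by (subst powr_diff[symmetric]) simp
  finally show "zeta_sum (n - 1) (replicate j 2) / (central_binom n * real n ^ (m + 1)) \<le> 2 * 2 ^ j * real n powr (-3/2)"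
    by simp
next
  fix n show "0 \<le> zeta_sum (n - 1) (replicate j 2) / (central_binom n * real n ^ (m + 1))"
    by (intro divide_nonneg_nonneg mult_nonneg_nonneg zeta_sum_nonneg less_imp_le[OF central_binom_pos]) auto
qed

section \<open>The initial states and the final assembly\<close>

text \<open>The odd arcsine power already contains one factor \<open>2 * real n + 1\<close>, so
  \<open>m - 1\<close> integrations against dx/x remain.\<close>

lemma tail_state_series1:
  assumes "1 \<le> m"
  shows "tail_state \<i> (2 * j + m) (\<lambda>n. central_binom n * t_sum n (replicate j 2) / (2 * real n + 1) ^ m)"
proof (rule tail_state_from_odd[OF series1_star_summable[OF assms]])
  let ?c = "\<lambda>n. central_binom n * t_sum n (replicate j 2) / (2 * real n + 1)"
  have "\<bar>?c n\<bar> \<le> suminf ?c" for n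
    using star_summable_bounded[OF series1_star_summable[of 1 j], of n] by simp
  from mzfun_odd_series_iterate[OF this mzfun_arcsin_odd, of "m - 1"]
  show "mzfun (2 * j + m) (\<lambda>u. \<i> * complex_of_real
      (odd_series (\<lambda>n. central_binom n * t_sum n (replicate j 2) / (2 * real n + 1) ^ m) (xpar u)))"
    using assms by (cases m) simp_all
qed

text \<open>The even arcsine power already contains \<open>real n ^ 2\<close>, which is the case m =
  1; again \<open>m - 1\<close> integrations remain.\<close>

lemma tail_state_series2:
  assumes "1 \<le> m"
  shows "tail_state 1 (2 * j + m + 1) (\<lambda>n. zeta_sum (n - 1) (replicate j 2) / (central_binom n * real n ^ (m + 1)))"
proof (rule tail_state_from_even[OF series2_star_summable[OF assms]])
  let ?c = "\<lambda>n. zeta_sum (n - 1) (replicate j 2) / (central_binom n * real n ^ 2)"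
  have b: "\<bar>?c n\<bar> \<le> suminf ?c" for n
    using star_summable_bounded[OF series2_star_summable[of 1 j], of n] by (simp add: numeral_2_eq_2)
  have m: "mzfun (2 * j + 2) (\<lambda>u. 1 * complex_of_real (even_series ?c (xpar u)))"
    using mzfun_arcsin_even[of j] by simp
  have "?c n / real n ^ (m - 1) = zeta_sum (n - 1) (replicate j 2) / (central_binom n * real n ^ (m + 1))" for n
  proof -
    have "2 + (m - 1) = m + 1" using assms by simp
    then have "real n ^ 2 * real n ^ (m - 1) = real n ^ (m + 1)" by (simp only: power_add[symmetric])
    then show ?thesis by (simp only: divide_divide_eq_left mult.assoc)
  qed
  moreover have "mzfun (2 * j + 2 + (m - 1)) (\<lambda>u. 1 * complex_of_real (even_series (\<lambda>n. ?c n / real n ^ (m - 1)) (xpar u)))"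
    by (rule mzfun_even_series_iterate[OF b _ m]) simp
  moreover have "2 * j + 2 + (m - 1) = 2 * j + m + 1" using assms by simp
  ultimately show "mzfun (2 * j + m + 1) (\<lambda>u. 1 * complex_of_real
      (even_series (\<lambda>n. zeta_sum (n - 1) (replicate j 2) / (central_binom n * real n ^ (m + 1))) (xpar u)))"
    by (simp only:)
qed

(* The series over n >= 1 in the first claim fails for p = 1 and ks = []: with m = 1 it equals
   pi/2 - 1, which is not in iCMZV4 1.  For p >= 2 or ks nonempty the term at n = 0 vanishes;
   in the remaining case it is 1 and has to be included, which is the second claim. *)
theorem theorem9p6:
  fixes m p :: nat and ks :: "nat list"
  assumes "1 \<le> m" and "1 \<le> p" and "composition ks"
  shows "(2 \<le> p \<or> ks \<noteq> [] \<longrightarrow>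
            series_from_in 1 (series1_term m p ks) (iCMZV4 (2 * p + m + sum_list ks - 2)))
       \<and> series_from_in 0 (series1_term m p ks) (iCMZV4 (2 * p + m + sum_list ks - 2))
       \<and> series_from_in 1 (series2_term m p ks) (CMZV4 (2 * p + m + sum_list ks - 1))"
proof -
  obtain j where p: "p = Suc j" using assms(2) by (cases p) auto
  define c1 where "c1 n = central_binom n * t_sum n (replicate j 2) / (2 * real n + 1) ^ m" for n
  define c2 where "c2 n = zeta_sum (n - 1) (replicate j 2) / (central_binom n * real n ^ (m + 1))" for n
  have s1: "series1_term m p ks = (\<lambda>n. c1 n * t_star_sum n ks)"
    by (intro ext) (simp add: series1_term_def c1_def central_binom_def p)
  have s2: "series2_term m p ks = (\<lambda>n. c2 n * t_star_sum n ks)"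
    by (intro ext) (simp add: series2_term_def c2_def central_binom_def p)
  have st: "tail_state \<i> (2 * j + m) c1" "tail_state 1 (2 * j + m + 1) c2"
    using tail_state_series1[OF assms(1)] tail_state_series2[OF assms(1)] by (simp_all add: c1_def[abs_def] c2_def[abs_def])
  then have sum1: "summable (series1_term m p ks)" and sum2: "summable (series2_term m p ks)"
    using assms(3) by (auto simp: tail_state_def star_summable_def s1 s2)
  have w: "2 * p + m + sum_list ks - 2 = 2 * j + m + sum_list ks"
    "2 * p + m + sum_list ks - 1 = 2 * j + m + 1 + sum_list ks"
    using p assms(1) by auto
  have shift: "summable f \<and> (\<Sum>n. f (n + 1)) = suminf f" if "summable f" "f 0 = 0" for f :: "nat \<Rightarrow> real"
    using suminf_split_initial_segment[OF that(1), of 1] that by simp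
  have v1: "of_real (suminf (series1_term m p ks)) \<in> iCMZV4 (2 * p + m + sum_list ks - 2)"
  proof -
    have "\<i> * of_real (suminf (series1_term m p ks)) \<in> CMZV4 (2 * p + m + sum_list ks - 2)"
      using tail_state_t_star_sum[OF st(1) assms(3)] by (simp add: s1 w)
    \<comment> \<open>The value s must be written as \<open>\<i>\<close> times an element of the
      span, and that element is the negative of \<open>\<i> * s\<close>.\<close>
    then have "0 - \<i> * of_real (suminf (series1_term m p ks)) \<in> CMZV4 (2 * p + m + sum_list ks - 2)"
      by (intro CMZV4_diff CMZV4_0)
    from imageI[OF this, of "\<lambda>x. \<i> * x"] show ?thesis
      by (simp add: iCMZV4_def mult.assoc[symmetric])
  qed
  have "series_from_in 0 (series1_term m p ks) (iCMZV4 (2 * p + m + sum_list ks - 2))"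
    using sum1 v1 by (simp add: series_from_in_def)
  moreover have "series_from_in 1 (series1_term m p ks) (iCMZV4 (2 * p + m + sum_list ks - 2))"
    if "2 \<le> p \<or> ks \<noteq> []"
  proof -
    have "series1_term m p ks 0 = 0"
    proof (cases ks)
      case Nil
      with that p obtain i where "j = Suc i" by (cases j) auto
      then show ?thesis by (simp add: s1 c1_def t_sum_0_Cons)
    next
      case (Cons a ks')
      then have "t_star_sum 0 ks = 0" by (simp add: t_star_sum_Cons)
      then show ?thesis by (simp add: s1)
    qed
    with shift[OF sum1] v1 sum1 show ?thesis
      by (simp add: series_from_in_def summable_Suc_iff)
  qed
  moreover have "series_from_in 1 (series2_term m p ks) (CMZV4 (2 * p + m + sum_list ks - 1))"
  proof -
    have "of_real (suminf (series2_term m p ks)) \<in> CMZV4 (2 * p + m + sum_list ks - 1)"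
      using tail_state_t_star_sum[OF st(2) assms(3)] unfolding s2 w by simp
    moreover have "series2_term m p ks 0 = 0" by (simp add: s2 c2_def)
    ultimately show ?thesis using shift[OF sum2] sum2
      by (simp add: series_from_in_def summable_Suc_iff)
  qed
  ultimately show ?thesis by blast
qed

end
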